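(* There is an algorithm that, given integers $k\ge 1$, $h\ge 2$ and a $K_h$-minor-free black and white graph $G=(B\uplus W,E)$ with $n$ vertices, finds a set $U\subseteq B\uplus W$ with $|U|\le k$ such that every vertex $v\in B\setminus U$ satisfies $N(v)\cap U\neq\emptyset$, whenever such a set exists, in time $(O(\log h))^{hk/2}\, n$.
   Context: All graphs are finite, undirected and simple. A black and white graph $G=(B\uplus W,E)$ is a graph whose vertex set is partitioned into two disjoint sets $B$ (black) and $W$ (white). $N(v)$ is the set of neighbors of $v$ (not including $v$). A graph is $K_h$-minor-free if the complete graph $K_h$ cannot be obtained from a subgraph of it by a sequence of edge contractions. The constant hidden in $O(\log h)$ is absolute. *)

theory Defs
  imports Complex_Main
begin

section \<open>Graphs and complete minors\<close>

type_synonym 'a graph = "'a set \<times> 'a set set"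

definition simple_graph :: "'a graph \<Rightarrow> bool" where
  "simple_graph = (\<lambda>(V, E). finite V \<and> (\<forall>e\<in>E. e \<subseteq> V \<and> card e = 2))"

definition subgraph :: "'a graph \<Rightarrow> 'a graph \<Rightarrow> bool" where
  "subgraph H G \<longleftrightarrow> simple_graph H \<and> fst H \<subseteq> fst G \<and> snd H \<subseteq> snd G"

(* The vertex v is merged into u, which names the merged vertex.  The contracted edge
   becomes {u} and is dropped; parallel edges coincide because E is a set. *)
inductive contraction :: "'a graph \<Rightarrow> 'a graph \<Rightarrow> bool" where
  "u \<noteq> v \<Longrightarrow> {u, v} \<in> E \<Longrightarrow>
    contraction (V, E) (V - {v}, (\<lambda>e. (id(v := u)) ` e) ` E - {{u}})"

(* Isomorphism with the complete graph on h vertices (h positive). *)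
definition complete_on :: "nat \<Rightarrow> 'a graph \<Rightarrow> bool" where
  "complete_on h = (\<lambda>(V, E). finite V \<and> card V = h \<and> E = {e. e \<subseteq> V \<and> card e = 2})"

definition K_minor_free :: "nat \<Rightarrow> 'a graph \<Rightarrow> bool" where
  "K_minor_free h G \<longleftrightarrow>
    \<not> (\<exists>H K. subgraph H G \<and> contraction\<^sup>*\<^sup>* H K \<and> complete_on h K)"


section \<open>Black and white graphs\<close>

definition bw_graph :: "'a set \<Rightarrow> 'a set \<Rightarrow> 'a set set \<Rightarrow> bool" where
  "bw_graph B W E \<longleftrightarrow> B \<inter> W = {} \<and> simple_graph (B \<union> W, E)"

definition nbrs :: "'a set set \<Rightarrow> 'a \<Rightarrow> 'a set" where
  "nbrs E v = {u. u \<noteq> v \<and> {u, v} \<in> E}"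

definition dominating :: "nat \<Rightarrow> 'a set \<Rightarrow> 'a set \<Rightarrow> 'a set set \<Rightarrow> 'a set \<Rightarrow> bool" where
  "dominating k B W E U \<longleftrightarrow>
    U \<subseteq> B \<union> W \<and> card U \<le> k \<and> (\<forall>v\<in>B - U. nbrs E v \<inter> U \<noteq> {})"


section \<open>Word RAM\<close>

(* Structured programs for a random access machine.  Registers are named by the program text,
   so a program uses finitely many of them; memory is addressed indirectly through registers. *)
datatype com =
    Skip
  | Const nat nat            (* r := constant *)
  | Copy nat nat             (* r := x *)
  | Add nat nat nat          (* r := x + y *)
  | Sub nat nat nat          (* r := x - y *)
  | Load nat nat             (* r := memory[x] *)
  | Store nat nat            (* memory[x] := y *)
  | Seq com com
  | IfLess nat nat com com
  | WhileLess nat nat com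

record state =
  regs :: "nat \<Rightarrow> nat"
  mem :: "nat \<Rightarrow> nat"

definition set_reg :: "nat \<Rightarrow> nat \<Rightarrow> state \<Rightarrow> state" where
  "set_reg r a s = s\<lparr>regs := (regs s)(r := a)\<rparr>"

(* exec w P s T s': with words of w bits, P started in s halts in s' after T steps, every
   elementary operation and every test costing one step.  Addition is modulo 2 ^ w,
   subtraction is cut off at 0.  A program that does not halt has no execution. *)
inductive exec :: "nat \<Rightarrow> com \<Rightarrow> state \<Rightarrow> nat \<Rightarrow> state \<Rightarrow> bool" for w where
  Skip: "exec w Skip s 1 s"
| Const: "exec w (Const r a) s 1 (set_reg r (a mod 2 ^ w) s)"
| Copy: "exec w (Copy r x) s 1 (set_reg r (regs s x) s)"
| Add: "exec w (Add r x y) s 1 (set_reg r ((regs s x + regs s y) mod 2 ^ w) s)"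
| Sub: "exec w (Sub r x y) s 1 (set_reg r (regs s x - regs s y) s)"
| Load: "exec w (Load r x) s 1 (set_reg r (mem s (regs s x)) s)"
| Store: "exec w (Store x y) s 1 (s\<lparr>mem := (mem s)(regs s x := regs s y)\<rparr>)"
| Seq: "exec w P s T s' \<Longrightarrow> exec w Q s' T' s'' \<Longrightarrow> exec w (Seq P Q) s (T + T') s''"
| IfTrue: "regs s x < regs s y \<Longrightarrow> exec w P s T s' \<Longrightarrow> exec w (IfLess x y P Q) s (1 + T) s'"
| IfFalse: "\<not> regs s x < regs s y \<Longrightarrow> exec w Q s T s' \<Longrightarrow> exec w (IfLess x y P Q) s (1 + T) s'"
| WhileFalse: "\<not> regs s x < regs s y \<Longrightarrow> exec w (WhileLess x y P) s 1 s"
| WhileTrue: "regs s x < regs s y \<Longrightarrow> exec w P s T s' \<Longrightarrow> exec w (WhileLess x y P) s' T' s''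
    \<Longrightarrow> exec w (WhileLess x y P) s (1 + T + T') s''"

lemma exec_deterministic:
  "exec w P s T s' \<Longrightarrow> exec w P s T' s'' \<Longrightarrow> T' = T \<and> s'' = s'"
proof (induction arbitrary: T' s'' rule: exec.induct)
  case (Seq P s T s' Q U t)
  from Seq.prems Seq.IH show ?case by (cases rule: exec.cases) blast+
next
  case (IfTrue s x y P T s' Q)
  from IfTrue.prems IfTrue.hyps IfTrue.IH show ?case by (cases rule: exec.cases) blast+
next
  case (IfFalse s x y Q T s' P)
  from IfFalse.prems IfFalse.hyps IfFalse.IH show ?case by (cases rule: exec.cases) blast+
next
  case (WhileFalse s x y P)
  from WhileFalse.prems WhileFalse.hyps show ?case by (cases rule: exec.cases) blast+
next
  case (WhileTrue s x y P T s' U t)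
  from WhileTrue.prems WhileTrue.hyps WhileTrue.IH show ?case by (cases rule: exec.cases) blast+
qed (erule exec.cases; simp)+


section \<open>Input and output format\<close>

(* Adjacency lists of a graph on the vertices 0, ..., n - 1; the order of the neighbours
   in each list is arbitrary. *)
definition adjacency_lists :: "nat \<Rightarrow> nat set set \<Rightarrow> nat list list \<Rightarrow> bool" where
  "adjacency_lists n E adj \<longleftrightarrow>
    length adj = n \<and> (\<forall>v<n. distinct (adj ! v) \<and> set (adj ! v) = nbrs E v)"

(* Cell v holds the colour of v (1 for black); cell n + v holds the address at which the
   neighbours of v start, and cell n + v + 1 the address just after them. *)
definition input_words :: "nat \<Rightarrow> nat set \<Rightarrow> nat list list \<Rightarrow> nat list" where
  "input_words n B adj =
    map (\<lambda>v. if v \<in> B then 1 else 0) [0..<n]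
    @ map (\<lambda>v. 2 * n + 1 + length (concat (take v adj))) [0..<n + 1]
    @ concat adj"

definition init_state :: "nat \<Rightarrow> nat \<Rightarrow> nat \<Rightarrow> nat set \<Rightarrow> nat list list \<Rightarrow> state" where
  "init_state k h n B adj =
    \<lparr>regs = (\<lambda>_. 0)(0 := n, 1 := k, 2 := h),
     mem = (\<lambda>i. if i < length (input_words n B adj) then input_words n B adj ! i else 0)\<rparr>"

(* Register 0 is 0 to report failure; otherwise registers 1 and 2 hold the start address and
   the length of the list of vertices that is returned. *)
definition result :: "state \<Rightarrow> nat list option" where
  "result s =
    (if regs s 0 = 0 then None
     else Some (map (\<lambda>i. mem s (regs s 1 + i)) [0..<regs s 2]))"

end

theory Submission
  imports Defs
begin

text \<open>
  Depth-first search over partial solutions.  Black vertices dominated by the partial solution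
  count as white, and vertices that dominate the same remaining black vertices are interchangeable,
  so it suffices to branch over one representative of each class in the closed neighbourhood of a
  single black vertex, chosen so that the number of these classes is smallest.  Partition refinement
  finds the classes in linear time.

  In a \<open>K\<^sub>h\<close>-minor-free graph that smallest number is at most \<open>c\<^sup>h\<close>.  Merge white vertices greedily
  into one of two non-adjacent black neighbours.  Each merge creates a new edge between black
  vertices, and the neighbourhoods of the white vertices that remain become cliques.  So it is
  enough to bound the edges and the cliques of a \<open>K\<^sub>h\<close>-minor-free graph by \<open>c\<^sup>h\<close> times its number of
  vertices.  With \<open>p\<^sup>4\<close> of order \<open>h\<close>, minimal minors above a linear density have dense neighbourhoods,
  where disjoint dominating stars form a complete minor; this bounds the average degree by a
  multiple of \<open>p\<^sup>5\<close>.  A graph on more than \<open>5p\<^sup>4\<close> vertices that misses few edges contains disjoint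
  dominating edges, hence has a vertex with more than \<open>p\<^sup>2\<close> non-neighbours, and splitting the cliques
  at such vertices shows that \<open>m\<close> vertices span at most \<open>2\<close> to the power \<open>5p\<^sup>4\<close> times
  \<open>(1 + 1/p)\<^sup>m\<close> cliques.  This is exponential in \<open>h\<close> for \<open>m\<close> of order \<open>p\<^sup>5\<close>, and \<open>c\<^sup>h\<close> is below
  \<open>(O(log h))\<close> to the power \<open>h/2\<close>.
\<close>

section \<open>Complete minors and branch sets\<close>

text \<open>Two obstacles shape the argument. Sparsity does not control single white vertices: a
  black vertex may have arbitrarily many white neighbours, and only their distinct neighbourhoods
  can be bounded. After the merging these are cliques of a minor, so cliques have to be counted. A
  degree bound alone fails there: degrees of order \<open>p^5\<close>, that is
  \<open>h^(5/4)\<close>, allow 2 to the power \<open>p^5\<close> cliques in a neighbourhood, which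
  is not exponential in \<open>h\<close>. Two estimates are therefore balanced. Splitting at a
  vertex with more than \<open>p^2\<close> non-neighbours gives the recurrence
  \<open>f m = f (m - 1) + f (m - 1 - p^2)\<close> with growth rate at most \<open>1 + 1/p\<close>,
  so \<open>p^5\<close> vertices contribute only a factor \<open>exp (O (p^4))\<close>. The fourth
  power in \<open>p^4\<close> comes from the domination by edges: it succeeds when each vertex has
  at most \<open>p^2\<close> non-neighbours and the number of branch sets is at least the square of
  that. The logarithm in the running time enters only through \<open>ln h \<ge> ln 2\<close>: the
  search takes \<open>a^(h k)\<close> steps up to the factor \<open>n\<close>, and \<open>a\<close>
  is rewritten as the square root of \<open>a^2\<close>.\<close>

definition conn :: "('a \<Rightarrow> 'a \<Rightarrow> bool) \<Rightarrow> 'a set \<Rightarrow> bool" where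
  "conn R X \<longleftrightarrow> X \<noteq> {} \<and>
    (\<forall>A. A \<noteq> {} \<longrightarrow> A \<subset> X \<longrightarrow> (\<exists>a\<in>A. \<exists>b\<in>X - A. R a b))"

text \<open>Branch sets of a \<open>K_t\<close> minor. Adjacency is a relation rather than a set of
  edges, so that contracted and merged graphs need no encoding; \<open>conn\<close> speaks of cuts
  because cuts pull back along a contraction without any paths.\<close>

definition clique_model :: "nat \<Rightarrow> 'a set \<Rightarrow> ('a \<Rightarrow> 'a \<Rightarrow> bool) \<Rightarrow> (nat \<Rightarrow> 'a set) \<Rightarrow> bool" where
  "clique_model t V R X \<longleftrightarrow>
    (\<forall>i<t. X i \<subseteq> V \<and> conn R (X i)) \<and>
    (\<forall>i<t. \<forall>j<t. i \<noteq> j \<longrightarrow> X i \<inter> X j = {} \<and> (\<exists>a\<in>X i. \<exists>b\<in>X j. R a b))"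

definition no_model :: "nat \<Rightarrow> 'a set \<Rightarrow> ('a \<Rightarrow> 'a \<Rightarrow> bool) \<Rightarrow> bool" where
  "no_model t V R \<longleftrightarrow> (\<nexists>X. clique_model t V R X)"

lemma conn_singleton: "conn R {a}"
  unfolding conn_def by auto

lemma conn_mono:
  assumes "conn R X" "\<And>a b. a \<in> X \<Longrightarrow> b \<in> X \<Longrightarrow> R a b \<Longrightarrow> R' a b"
  shows "conn R' X"
  unfolding conn_def
proof (intro conjI allI impI)
  show "X \<noteq> {}" using assms(1) unfolding conn_def by blast
  fix A assume A: "A \<noteq> {}" "A \<subset> X"
  then obtain a b where "a \<in> A" "b \<in> X - A" "R a b"
    using assms(1) unfolding conn_def by blast
  then show "\<exists>a\<in>A. \<exists>b\<in>X - A. R' a b" using A assms(2) by blast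
qed

lemma clique_model_mono:
  assumes "clique_model t V R X" "V \<subseteq> V'" "\<And>a b. a \<in> V \<Longrightarrow> b \<in> V \<Longrightarrow> R a b \<Longrightarrow> R' a b" "s \<le> t"
  shows "clique_model s V' R' X"
proof -
  have "X i \<subseteq> V' \<and> conn R' (X i)" if "i < s" for i
  proof -
    have "i < t" using that assms(4) by simp
    then have X: "X i \<subseteq> V" "conn R (X i)" using assms(1) unfolding clique_model_def by auto
    have "conn R' (X i)" by (rule conn_mono[OF X(2)]) (use assms(3) X(1) in blast)
    then show ?thesis using X assms(2) by blast
  qed
  moreover have "X i \<inter> X j = {} \<and> (\<exists>a\<in>X i. \<exists>b\<in>X j. R' a b)" if "i < s" "j < s" "i \<noteq> j" for i j
  proof -
    have ij: "i < t" "j < t" using that assms(4) by simp_all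
    then have "X i \<subseteq> V" "X j \<subseteq> V" "X i \<inter> X j = {} \<and> (\<exists>a\<in>X i. \<exists>b\<in>X j. R a b)"
      using assms(1) that(3) unfolding clique_model_def by auto
    then show ?thesis using assms(3) by blast
  qed
  ultimately show ?thesis unfolding clique_model_def by blast
qed

lemma no_model_mono:
  assumes "no_model s V' R'" "V \<subseteq> V'" "\<And>a b. a \<in> V \<Longrightarrow> b \<in> V \<Longrightarrow> R a b \<Longrightarrow> R' a b" "s \<le> t"
  shows "no_model t V R"
  unfolding no_model_def
proof
  assume "\<exists>X. clique_model t V R X"
  then obtain X where "clique_model t V R X" by blast
  then have "clique_model s V' R' X" by (rule clique_model_mono) (use assms in auto)
  then show False using assms(1) unfolding no_model_def by blast
qed

text \<open>Every fibre of \<open>f\<close> over \<open>X\<close> is a star around its fixed point.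
  A cut of the preimage either separates some \<open>a\<close> from \<open>f a\<close>, and then a
  star edge crosses it, or it is a union of fibres, and then an \<open>R'\<close> edge across the
  induced cut of \<open>X\<close> lifts.\<close>

lemma conn_preimage:
  assumes conn: "conn R' X" and X: "X \<subseteq> V'" and V': "V' \<subseteq> V"
    and retr: "\<And>x. x \<in> V' \<Longrightarrow> f x = x"
    and star: "\<And>a. a \<in> V \<Longrightarrow> f a \<noteq> a \<Longrightarrow> R a (f a)"
    and edge: "\<And>x y. x \<in> V' \<Longrightarrow> y \<in> V' \<Longrightarrow> R' x y \<Longrightarrow> \<exists>a\<in>V. \<exists>b\<in>V. f a = x \<and> f b = y \<and> R a b"
    and sym: "\<And>a b. R a b \<Longrightarrow> R b a"
  shows "conn R {a \<in> V. f a \<in> X}"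
  unfolding conn_def
proof (intro conjI allI impI)
  obtain x where "x \<in> X" using conn unfolding conn_def by blast
  moreover from this have "x \<in> V'" using X by blast
  ultimately show "{a \<in> V. f a \<in> X} \<noteq> {}" using V' retr[of x] by auto
next
  fix A assume A: "A \<noteq> {}" "A \<subset> {a \<in> V. f a \<in> X}"
  show "\<exists>a\<in>A. \<exists>b\<in>{a \<in> V. f a \<in> X} - A. R a b"
  proof (cases "\<exists>a\<in>{a \<in> V. f a \<in> X}. (a \<in> A) \<noteq> (f a \<in> A)")
    case True
    then obtain a where a: "a \<in> V" "f a \<in> X" "(a \<in> A) \<noteq> (f a \<in> A)" by blast
    then have "f a \<noteq> a" by auto
    then have "R a (f a)" "R (f a) a" using star a sym by auto
    moreover have "f a \<in> {a \<in> V. f a \<in> X}" using a X V' retr by auto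
    ultimately show ?thesis using a A by blast
  next
    case False
    have "A \<inter> X \<noteq> {}" using A False by blast
    moreover have "A \<inter> X \<subset> X" using A False by blast
    ultimately obtain x y where xy: "x \<in> A \<inter> X" "y \<in> X - A \<inter> X" "R' x y"
      using conn unfolding conn_def by metis
    then obtain a b where "a \<in> V" "b \<in> V" "f a = x" "f b = y" "R a b"
      using edge[of x y] X by blast
    then show ?thesis using xy False by blast
  qed
qed

text \<open>The common form of all contractions below: contracting one edge is the retraction
  \<open>id(v := u)\<close>, and merging outside vertices into a set \<open>B\<close> is another
  instance. Branch sets are pulled back along \<open>f\<close>.\<close>

lemma no_model_retract:
  assumes nm: "no_model t V R" and V': "V' \<subseteq> V"
    and retr: "\<And>x. x \<in> V' \<Longrightarrow> f x = x"
    and star: "\<And>a. a \<in> V \<Longrightarrow> f a \<noteq> a \<Longrightarrow> R a (f a)"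
    and edge: "\<And>x y. x \<in> V' \<Longrightarrow> y \<in> V' \<Longrightarrow> R' x y \<Longrightarrow> \<exists>a\<in>V. \<exists>b\<in>V. f a = x \<and> f b = y \<and> R a b"
    and sym: "\<And>a b. R a b \<Longrightarrow> R b a"
  shows "no_model t V' R'"
  unfolding no_model_def
proof
  assume "\<exists>X. clique_model t V' R' X"
  then obtain X where X: "clique_model t V' R' X" by blast
  have "clique_model t V R (\<lambda>i. {a \<in> V. f a \<in> X i})"
    unfolding clique_model_def
  proof (intro conjI allI impI)
    fix i assume "i < t"
    then have "conn R' (X i)" "X i \<subseteq> V'" using X unfolding clique_model_def by auto
    then show "conn R {a \<in> V. f a \<in> X i}"
      using conn_preimage[of R' "X i" V' V f R] assms by blast
  next
    fix i j assume ij: "i < t" "j < t" "i \<noteq> j"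
    then have "X i \<inter> X j = {}" "\<exists>a\<in>X i. \<exists>b\<in>X j. R' a b" "X i \<subseteq> V'" "X j \<subseteq> V'"
      using X unfolding clique_model_def by auto
    then show "{a \<in> V. f a \<in> X i} \<inter> {a \<in> V. f a \<in> X j} = {}"
      "\<exists>a\<in>{a \<in> V. f a \<in> X i}. \<exists>b\<in>{a \<in> V. f a \<in> X j}. R a b"
      using edge by blast+
  qed auto
  then show False using nm unfolding no_model_def by blast
qed

text \<open>While some branch set has two elements, its connectivity provides an edge inside it to
  contract; once all are singletons the graph is complete, since no vertex lies outside the branch
  sets.\<close>

lemma model_imp_complete_minor:
  fixes V :: "'a set"
  assumes "simple_graph (V, E)" "clique_model h V (\<lambda>a b. {a, b} \<in> E) X" "V = (\<Union>i<h. X i)"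
  shows "\<exists>K. contraction\<^sup>*\<^sup>* (V, E) K \<and> complete_on h K"
  using assms
proof (induction "card V" arbitrary: V E X rule: less_induct)
  case (less V E X)
  have fin: "finite V" and E: "\<And>e. e \<in> E \<Longrightarrow> e \<subseteq> V \<and> card e = 2"
    using less.prems(1) unfolding simple_graph_def by auto
  have conn: "conn (\<lambda>a b. {a, b} \<in> E) (X i)" "X i \<subseteq> V" if "i < h" for i
    using less.prems(2) that unfolding clique_model_def by auto
  have disj: "X i \<inter> X j = {}" and cross: "\<exists>a\<in>X i. \<exists>b\<in>X j. {a, b} \<in> E"
    if "i < h" "j < h" "i \<noteq> j" for i j
    using less.prems(2) that unfolding clique_model_def by auto
  show ?case
  proof (cases "\<exists>i<h. \<exists>u\<in>X i. \<exists>v\<in>X i. u \<noteq> v")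
    case True
    then obtain i u' v' where i: "i < h" "u' \<in> X i" "v' \<in> X i" "u' \<noteq> v'" by blast
    then have "{u'} \<noteq> {}" "{u'} \<subset> X i" by auto
    then obtain v where v: "v \<in> X i" "v \<noteq> u'" "{u', v} \<in> E"
      using conn(1)[OF i(1)] unfolding conn_def by blast
    define u where "u = u'"
    have u: "u \<in> X i" "v \<in> X i" "u \<noteq> v" "{u, v} \<in> E" using v i u_def by auto
    let ?f = "id(v := u)"
    define V' where "V' = V - {v}"
    define E' where "E' = (\<lambda>e. ?f ` e) ` E - {{u}}"
    define Y where "Y = (\<lambda>j. X j - {v})"
    have step: "contraction (V, E) (V', E')"
      unfolding V'_def E'_def using contraction.intros[OF u(3,4)] by simp
    have uV: "u \<in> V" "v \<in> V" using conn(2)[OF i(1)] u by auto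
    have sg: "simple_graph (V', E')"
      unfolding simple_graph_def
    proof (clarsimp, intro conjI ballI)
      show "finite V'" using fin V'_def by simp
      fix e assume e: "e \<in> E'"
      then obtain e0 where e0: "e0 \<in> E" "e = ?f ` e0" "e \<noteq> {u}" unfolding E'_def by auto
      have e0': "e0 \<subseteq> V" "card e0 = 2" using E e0 by auto
      then show "e \<subseteq> V'" using e0 uV u(3) unfolding V'_def by (auto split: if_splits)
      obtain a b where ab: "e0 = {a, b}" "a \<noteq> b" using e0'(2) card_2_iff[of e0] by blast
      have e_eq: "e = {?f a, ?f b}" using ab e0(2) by simp
      moreover have "?f a \<noteq> ?f b"
      proof
        assume eq: "?f a = ?f b"
        then have "?f a = u" using ab(2) by (auto split: if_splits)
        then show False using e_eq eq e0(3) by simp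
      qed
      ultimately show "card e = 2" by simp
    qed
    \<comment> \<open>An edge survives the contraction unless its ends are identified, in which case
      its image is the deleted \<open>{u}\<close>.\<close>
    have lift: "{?f a, ?f b} \<in> E'" if "{a, b} \<in> E" "?f a \<noteq> ?f b" for a b
    proof -
      have "{?f a, ?f b} = ?f ` {a, b}" by simp
      then have "{?f a, ?f b} \<in> (\<lambda>e. ?f ` e) ` E" using that(1) by (metis image_eqI)
      moreover have "{?f a, ?f b} \<noteq> {u}" using that(2) by auto
      ultimately show ?thesis unfolding E'_def by simp
    qed
    have vj: "v \<in> X j \<longleftrightarrow> j = i" if "j < h" for j using disj[of i j] u i that by auto
    have uj: "u \<in> X j \<longleftrightarrow> j = i" if "j < h" for j using disj[of i j] u i that by auto
    have fY: "?f a \<in> Y j \<longleftrightarrow> a \<in> X j" if "j < h" for a j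
      using vj[OF that] uj[OF that] u(3) unfolding Y_def by auto
    have "clique_model h V' (\<lambda>a b. {a, b} \<in> E') Y"
      unfolding clique_model_def
    proof (intro conjI allI impI)
      fix j assume j: "j < h"
      show "Y j \<subseteq> V'" using conn(2)[OF j] unfolding Y_def V'_def by auto
      show "conn (\<lambda>a b. {a, b} \<in> E') (Y j)"
        unfolding conn_def
      proof (intro conjI allI impI)
        show "Y j \<noteq> {}"
          using conn(1)[OF j] fY[OF j] unfolding conn_def by blast
        fix A assume A: "A \<noteq> {}" "A \<subset> Y j"
        \<comment> \<open>The cut is pulled back along \<open>?f\<close> and crossed by an edge of
          \<open>X j\<close>; that edge does not collapse, because its ends are mapped to different
          sides.\<close>
        define A' where "A' = {a. ?f a \<in> A}"
        have "A' \<subseteq> X j"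
        proof
          fix a assume "a \<in> A'"
          then have "?f a \<in> Y j" using A unfolding A'_def by blast
          then show "a \<in> X j" using fY[OF j] by blast
        qed
        moreover obtain y where y: "y \<in> Y j" "y \<notin> A" using A by blast
        then have "y \<in> X j" "?f y = y" unfolding Y_def by auto
        then have "y \<in> X j" "y \<notin> A'" using y(2) unfolding A'_def by (simp_all only: mem_Collect_eq not_False_eq_True)
        then have "A' \<noteq> X j" by blast
        moreover obtain z where z: "z \<in> A" "z \<in> Y j" using A by blast
        then have "z \<in> A'" unfolding A'_def Y_def by auto
        then have "A' \<noteq> {}" by blast
        ultimately obtain a b where ab: "a \<in> A'" "b \<in> X j - A'" "{a, b} \<in> E"
          using conn(1)[OF j] unfolding conn_def by (meson psubsetI)
        have fab: "?f a \<in> A" "?f b \<in> Y j" "?f b \<notin> A"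
          using ab fY[OF j, of b] unfolding A'_def by blast+
        then have "{?f a, ?f b} \<in> E'" using lift[OF ab(3)] by metis
        then show "\<exists>a\<in>A. \<exists>b\<in>Y j - A. {a, b} \<in> E'" using fab by blast
      qed
    next
      fix j l assume jl: "j < h" "l < h" "j \<noteq> l"
      show dY: "Y j \<inter> Y l = {}" using disj[OF jl] unfolding Y_def by auto
      obtain a b where "a \<in> X j" "b \<in> X l" "{a, b} \<in> E" using cross[OF jl] by blast
      then have "?f a \<in> Y j" "?f b \<in> Y l" using fY jl by auto
      then show "\<exists>a\<in>Y j. \<exists>b\<in>Y l. {a, b} \<in> E'"
        using lift[OF \<open>{a, b} \<in> E\<close>] dY by (metis IntI empty_iff)
    qed
    moreover have "V' = (\<Union>i<h. Y i)" unfolding V'_def Y_def using less.prems(3) by auto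
    moreover have "card V' < card V" unfolding V'_def using fin uV by (metis card_Diff1_less)
    ultimately obtain K where "contraction\<^sup>*\<^sup>* (V', E') K" "complete_on h K"
      using less.hyps[of V' E' Y] sg by blast
    then show ?thesis using step by (meson converse_rtranclp_into_rtranclp)
  next
    case False
    have "\<exists>x. X i = {x}" if i: "i < h" for i
    proof -
      obtain y where "y \<in> X i" using conn(1)[OF i] unfolding conn_def by blast
      then have "X i = {y}" using False i by blast
      then show ?thesis by blast
    qed
    then obtain x where x: "\<And>i. i < h \<Longrightarrow> X i = {x i}" by metis
    have inj: "inj_on x {..<h}"
      unfolding inj_on_def using x disj by (metis Int_absorb insert_not_empty lessThan_iff)
    have V: "V = x ` {..<h}" using less.prems(3) x by auto
    have "E = {e. e \<subseteq> V \<and> card e = 2}"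
    proof
      show "E \<subseteq> {e. e \<subseteq> V \<and> card e = 2}" using E by auto
      show "{e. e \<subseteq> V \<and> card e = 2} \<subseteq> E"
      proof
        fix e assume "e \<in> {e. e \<subseteq> V \<and> card e = 2}"
        then obtain a b where ab: "e = {a, b}" "a \<noteq> b" "a \<in> V" "b \<in> V" by (auto simp: card_2_iff)
        then obtain i j where "i < h" "j < h" "a = x i" "b = x j" "i \<noteq> j" using V by auto
        then show "e \<in> E" using cross[of i j] x ab by auto
      qed
    qed
    then have "complete_on h (V, E)"
      unfolding complete_on_def using fin V inj by (simp add: card_image)
    then show ?thesis by blast
  qed
qed

text \<open>Minor-freeness allows passing to a subgraph first: here the one induced by the union of
  the branch sets, where only contractions remain to be done.\<close>

lemma K_minor_free_no_model:
  assumes "simple_graph (V, E)" "K_minor_free h (V, E)"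
  shows "no_model h V (\<lambda>a b. {a, b} \<in> E)"
  unfolding no_model_def
proof
  assume "\<exists>X. clique_model h V (\<lambda>a b. {a, b} \<in> E) X"
  then obtain X where X: "clique_model h V (\<lambda>a b. {a, b} \<in> E) X" by blast
  define V' where "V' = (\<Union>i<h. X i)"
  define E' where "E' = {e \<in> E. e \<subseteq> V'}"
  have V': "V' \<subseteq> V" using X unfolding V'_def clique_model_def by auto
  have "simple_graph (V', E')"
    using assms(1) V' finite_subset unfolding simple_graph_def E'_def by auto
  moreover have "conn (\<lambda>a b. {a, b} \<in> E') (X i)" if "i < h" for i
    using X that conn_mono[of "\<lambda>a b. {a, b} \<in> E" "X i" "\<lambda>a b. {a, b} \<in> E'"]
    unfolding clique_model_def E'_def V'_def by blast
  then have "clique_model h V' (\<lambda>a b. {a, b} \<in> E') X"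
    using X unfolding clique_model_def E'_def V'_def by fastforce
  ultimately obtain K where "contraction\<^sup>*\<^sup>* (V', E') K" "complete_on h K"
    using model_imp_complete_minor[of V' E' h X] V'_def by blast
  moreover have "subgraph (V', E') (V, E)"
    using \<open>simple_graph (V', E')\<close> V' unfolding subgraph_def E'_def by auto
  ultimately show False using assms(2) unfolding K_minor_free_def by blast
qed

section \<open>Density\<close>

definition rdeg :: "('a \<Rightarrow> 'a \<Rightarrow> bool) \<Rightarrow> 'a set \<Rightarrow> 'a \<Rightarrow> nat" where
  "rdeg R V a = card {b \<in> V. R a b}"

(* Ordered pairs: every edge counts twice. *)
definition arcs :: "'a set \<Rightarrow> ('a \<Rightarrow> 'a \<Rightarrow> bool) \<Rightarrow> ('a \<times> 'a) set" where
  "arcs V R = {(a, b). a \<in> V \<and> b \<in> V \<and> R a b}"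

lemma arcs_subset: "arcs V R \<subseteq> V \<times> V"
  unfolding arcs_def by auto

lemma finite_arcs: "finite V \<Longrightarrow> finite (arcs V R)"
  using arcs_subset finite_subset by (metis finite_cartesian_product)

lemma sum_rdeg:
  assumes "finite V" shows "(\<Sum>a\<in>V. rdeg R V a) = card (arcs V R)"
proof -
  have "arcs V R = Sigma V (\<lambda>a. {b \<in> V. R a b})" unfolding arcs_def by auto
  then show ?thesis unfolding rdeg_def using assms by simp
qed

section \<open>Complete minors in graphs with few non-neighbours\<close>

lemma exists_le_average:
  fixes f :: "'a \<Rightarrow> nat"
  assumes "finite A" "A \<noteq> {}"
  shows "\<exists>a\<in>A. f a * card A \<le> sum f A"
proof -
  obtain a where a: "a \<in> A" "\<And>b. b \<in> A \<Longrightarrow> f a \<le> f b"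
    using ex_is_arg_min_if_finite[of A f] assms
    by (metis arg_min_if_finite(1) arg_min_least)
  then have "(\<Sum>b\<in>A. f a) \<le> sum f A" by (intro sum_mono) auto
  then show ?thesis using a by (auto simp: mult.commute)
qed

text \<open>Double counting of the \<open>N\<close>-related pairs between \<open>A\<close> and
  \<open>S\<close>. It is applied to non-adjacency, where some \<open>y\<close> leaves few vertices
  of \<open>S\<close> undominated.\<close>

lemma exists_few_related:
  assumes "finite A" "finite S" "A \<noteq> {}" and sym: "symp N"
    and le: "\<And>s. s \<in> S \<Longrightarrow> card {y \<in> A. N s y} \<le> D"
  shows "\<exists>y\<in>A. card {s \<in> S. N y s} * card A \<le> card S * D"
proof -
  obtain y where y: "y \<in> A" "card {s \<in> S. N y s} * card A \<le> (\<Sum>y\<in>A. card {s \<in> S. N y s})"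
    using exists_le_average[OF assms(1,3), of "\<lambda>y. card {s \<in> S. N y s}"] by blast
  have "(\<Sum>y\<in>A. card {s \<in> S. N y s}) = (\<Sum>s\<in>S. card {y \<in> A. N y s})"
    by (rule sum_multicount_gen) (use assms in auto)
  also have "\<dots> = (\<Sum>s\<in>S. card {y \<in> A. N s y})"
  proof -
    have "N y s = N s y" for y s using sym by (auto dest: sympD)
    then show ?thesis by simp
  qed
  also have "\<dots> \<le> card S * D" using sum_bounded_above[of S "\<lambda>s. card {y \<in> A. N s y}" D] le by simp
  finally show ?thesis using y le_trans by blast
qed

lemma conn_star:
  assumes "symp R" "a \<in> X" "\<And>x. x \<in> X \<Longrightarrow> x = a \<or> R a x"
  shows "conn R X"
  unfolding conn_def
proof (intro conjI allI impI)
  show "X \<noteq> {}" using assms(2) by blast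
  fix A assume A: "A \<noteq> {}" "A \<subset> X"
  show "\<exists>a\<in>A. \<exists>b\<in>X - A. R a b"
  proof (cases "a \<in> A")
    case True
    obtain b where "b \<in> X - A" using A by blast
    moreover from this have "R a b" using assms(3) True by blast
    ultimately show ?thesis using True by blast
  next
    case False
    obtain b where "b \<in> A" using A by blast
    then have "b \<in> X" "b \<noteq> a" using A False by auto
    then have "R b a" using assms(1,3) by (metis sympD)
    then show ?thesis using \<open>b \<in> A\<close> False assms(2) by blast
  qed
qed

(* Greedily adding leaves shrinks the set of undominated vertices by the factor D / c. *)
lemma exists_dominating_star:
  assumes V: "finite V" and sym: "symp R"
    and D: "\<And>a. a \<in> V \<Longrightarrow> card {b \<in> V. \<not> R a b} \<le> D"
    and A: "A \<subseteq> V" "c + D \<le> card A" and c: "0 < c"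
  shows "\<exists>a X. a \<in> X \<and> X \<subseteq> A \<and> (\<forall>x\<in>X. x = a \<or> R a x) \<and> card X \<le> Suc i \<and>
    card {b \<in> V. \<forall>x\<in>X. \<not> R x b} * c ^ i \<le> D ^ Suc i"
proof (induction i)
  case 0
  obtain a where a: "a \<in> A" using A c by fastforce
  then have "card {b \<in> V. \<forall>x\<in>{a}. \<not> R x b} \<le> D" using D A by auto
  then show ?case using a by (intro exI[of _ a] exI[of _ "{a}"]) auto
next
  case (Suc i)
  then obtain a X where X: "a \<in> X" "X \<subseteq> A" "\<forall>x\<in>X. x = a \<or> R a x" "card X \<le> Suc i"
    "card {b \<in> V. \<forall>x\<in>X. \<not> R x b} * c ^ i \<le> D ^ Suc i" by blast
  define S where "S = {b \<in> V. \<forall>x\<in>X. \<not> R x b}"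
  define A' where "A' = {y \<in> A. R a y}"
  have finA: "finite A" using A V finite_subset by blast
  \<comment> \<open>Leaves must be adjacent to the centre \<open>a\<close>. At most \<open>D\<close>
    vertices of \<open>A\<close> fail this, so at least \<open>c\<close> eligible leaves remain, and
    averaging over them gains the factor \<open>D / c\<close>.\<close>
  have "card A \<le> card (A' \<union> {b \<in> V. \<not> R a b})"
    using A V finA unfolding A'_def by (intro card_mono) auto
  also have "\<dots> \<le> card A' + D" using card_Un_le[of A' "{b \<in> V. \<not> R a b}"] D[of a] X A by force
  finally have cA': "c \<le> card A'" using A by simp
  then have "A' \<noteq> {}" using c by auto
  moreover have "finite A'" using finA unfolding A'_def by auto
  moreover have "card {y \<in> A'. \<not> R s y} \<le> D" if "s \<in> S" for s
  proof -
    have "card {y \<in> A'. \<not> R s y} \<le> card {b \<in> V. \<not> R s b}"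
      using V A unfolding A'_def by (intro card_mono) auto
    also have "\<dots> \<le> D" using D that unfolding S_def by blast
    finally show ?thesis .
  qed
  moreover have "symp (\<lambda>x y. \<not> R x y)" using sym unfolding symp_def by blast
  moreover have "finite S" using V unfolding S_def by simp
  ultimately obtain y where y: "y \<in> A'" "card {s \<in> S. \<not> R y s} * card A' \<le> card S * D"
    using exists_few_related[of A' S "\<lambda>x y. \<not> R x y" D] by blast
  have S': "{b \<in> V. \<forall>x\<in>insert y X. \<not> R x b} = {s \<in> S. \<not> R y s}" unfolding S_def by auto
  have "card {s \<in> S. \<not> R y s} * c ^ Suc i = card {s \<in> S. \<not> R y s} * c * c ^ i" by simp
  also have "\<dots> \<le> card {s \<in> S. \<not> R y s} * card A' * c ^ i" using cA' by simp
  also have "\<dots> \<le> card S * D * c ^ i" using y by simp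
  also have "\<dots> = card S * c ^ i * D" by simp
  also have "\<dots> \<le> D ^ Suc i * D" using X(5) unfolding S_def[symmetric] by (rule mult_right_mono) simp
  finally have "card {s \<in> S. \<not> R y s} * c ^ Suc i \<le> D ^ Suc (Suc i)" by (simp add: mult.commute)
  moreover have "card (insert y X) \<le> Suc (Suc i)" using X(4) card_insert_le_m1[of "Suc (Suc i)" X y] by simp
  ultimately show ?case
    using X y S' unfolding A'_def by (intro exI[of _ a] exI[of _ "insert y X"]) auto
qed

lemma dense_model:
  assumes V: "finite V" and sym: "symp R"
    and D: "\<And>a. a \<in> V \<Longrightarrow> card {b \<in> V. \<not> R a b} \<le> D"
    and c: "0 < c" "t * Suc i + c + D \<le> card V" "D ^ Suc i < c ^ i"
  shows "\<not> no_model t V R"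
proof -
  let ?P = "\<lambda>s X. (\<forall>j<s. X j \<subseteq> V \<and> conn R (X j) \<and> card (X j) \<le> Suc i \<and> (\<forall>b\<in>V. \<exists>x\<in>X j. R x b)) \<and>
      (\<forall>j<s. \<forall>l<s. j \<noteq> l \<longrightarrow> X j \<inter> X l = {})"
  have "\<exists>X. ?P s X" if "s \<le> t" for s
    using that
  proof (induction s)
    case 0
    then show ?case by simp
  next
    case (Suc s)
    obtain X where X0: "?P s X"
      using Suc.IH[OF Suc_leD[OF Suc.prems]] by (elim exE)
    then have X: "\<And>j. j < s \<Longrightarrow> X j \<subseteq> V \<and> conn R (X j) \<and> card (X j) \<le> Suc i \<and> (\<forall>b\<in>V. \<exists>x\<in>X j. R x b)"
      "\<And>j l. j < s \<Longrightarrow> l < s \<Longrightarrow> j \<noteq> l \<Longrightarrow> X j \<inter> X l = {}"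
      by simp_all
    define A where "A = V - (\<Union>j<s. X j)"
    have "card (\<Union>j<s. X j) \<le> (\<Sum>j<s. card (X j))" by (rule card_UN_le) simp
    also have "\<dots> \<le> s * Suc i" using sum_bounded_above[of "{..<s}" "\<lambda>j. card (X j)" "Suc i"] X by simp
    also have "\<dots> \<le> t * Suc i" using Suc.prems by (intro mult_right_mono) auto
    finally have "card (\<Union>j<s. X j) \<le> t * Suc i" .
    moreover have "(\<Union>j<s. X j) \<subseteq> V" using X(1) by blast
    then have "card V - card (\<Union>j<s. X j) \<le> card A"
      unfolding A_def by (intro diff_card_le_card_Diff finite_subset[OF _ V])
    ultimately have "c + D \<le> card A" using c by linarith
    moreover have "A \<subseteq> V" unfolding A_def by blast
    ultimately obtain a Y where Y: "a \<in> Y" "Y \<subseteq> A" "\<forall>x\<in>Y. x = a \<or> R a x" "card Y \<le> Suc i"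
      "card {b \<in> V. \<forall>x\<in>Y. \<not> R x b} * c ^ i \<le> D ^ Suc i"
      using exists_dominating_star[OF V sym D, of A c i] c by blast
    \<comment> \<open>The number of undominated vertices is an integer whose product with
      \<open>c ^ i\<close> is below \<open>c ^ i\<close>.\<close>
    have "card {b \<in> V. \<forall>x\<in>Y. \<not> R x b} = 0"
    proof (rule ccontr)
      assume "card {b \<in> V. \<forall>x\<in>Y. \<not> R x b} \<noteq> 0"
      then have "c ^ i \<le> card {b \<in> V. \<forall>x\<in>Y. \<not> R x b} * c ^ i" by simp
      then show False using Y(5) c(3) by linarith
    qed
    then have dom: "\<forall>b\<in>V. \<exists>x\<in>Y. R x b" using V by auto
    have cY: "conn R Y" using conn_star[OF sym Y(1)] Y(3) by blast
    have YV: "Y \<subseteq> V" "\<And>j. j < s \<Longrightarrow> X j \<inter> Y = {}" "\<And>j. j < s \<Longrightarrow> Y \<inter> X j = {}"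
      using Y(2) unfolding A_def by auto
    show ?case
      by (intro exI[of _ "X(s := Y)"]) (use X YV cY dom Y(4) in \<open>auto simp: less_Suc_eq\<close>)
  qed
  from this[OF le_refl]
  obtain X where X0: "?P t X"
    by (elim exE)
  then have X: "\<And>j. j < t \<Longrightarrow> X j \<subseteq> V \<and> conn R (X j) \<and> (\<forall>b\<in>V. \<exists>x\<in>X j. R x b)"
      "\<And>j l. j < t \<Longrightarrow> l < t \<Longrightarrow> j \<noteq> l \<Longrightarrow> X j \<inter> X l = {}" by simp_all
  have "clique_model t V R X"
    unfolding clique_model_def
  proof (intro conjI allI impI)
    fix j l assume jl: "j < t" "l < t" "j \<noteq> l"
    obtain b where "b \<in> X l" using X(1)[OF jl(2)] unfolding conn_def by blast
    then have "b \<in> V" using X(1)[OF jl(2)] by blast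
    then obtain x where "x \<in> X j" "R x b" using X(1)[OF jl(1)] by blast
    then show "\<exists>a\<in>X j. \<exists>b\<in>X l. R a b" using \<open>b \<in> X l\<close> by blast
  qed (use X in auto)
  then show ?thesis unfolding no_model_def by blast
qed

section \<open>Minimal minors above a linear density\<close>

lemma arcs_delete_vertex:
  assumes "finite V" "symp R" "v \<in> V" "rdeg R V v = 0"
  shows "arcs (V - {v}) R = arcs V R"
proof -
  have "{b \<in> V. R v b} = {}" using assms unfolding rdeg_def by simp
  then have "\<not> R v b" "\<not> R b v" if "b \<in> V" for b using that assms(2) by (auto dest: sympD)
  then show ?thesis unfolding arcs_def by auto
qed

lemma card_arcs_le:
  assumes "finite V" "irreflp R"
  shows "card (arcs V R) \<le> card V * (card V - 1)"
proof -
  have "rdeg R V a \<le> card V - 1" if "a \<in> V" for a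
  proof -
    have "{b \<in> V. R a b} \<subseteq> V - {a}" using assms(2) by (auto dest: irreflpD)
    then have "rdeg R V a \<le> card (V - {a})" unfolding rdeg_def using assms(1) by (intro card_mono) auto
    then show ?thesis using that assms(1) by simp
  qed
  then have "(\<Sum>a\<in>V. rdeg R V a) \<le> card V * (card V - 1)"
    using sum_bounded_above[of V "rdeg R V" "card V - 1"] by simp
  then show ?thesis using sum_rdeg[OF assms(1)] by metis
qed

definition contract :: "'a \<Rightarrow> 'a \<Rightarrow> ('a \<Rightarrow> 'a \<Rightarrow> bool) \<Rightarrow> 'a \<Rightarrow> 'a \<Rightarrow> bool" where
  "contract u v R a b \<longleftrightarrow> a \<noteq> b \<and> (R a b \<or> a = u \<and> R v b \<or> b = u \<and> R a v)"

text \<open>Lost are the two arcs between \<open>u\<close> and \<open>v\<close> and, for every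
  common neighbour \<open>c\<close>, the two arcs between \<open>v\<close> and \<open>c\<close>,
  which coincide with those between \<open>u\<close> and \<open>c\<close>. Outside this set
  \<open>D\<close> the relabelling is injective.\<close>

lemma card_arcs_contract:
  assumes V: "finite V" and sym: "symp R" and irr: "irreflp R" and uv: "u \<in> V" "v \<in> V" "R u v"
  shows "card (arcs V R) \<le>
    card (arcs (V - {v}) (contract u v R)) + 2 + 2 * card {c \<in> V. R u c \<and> R v c}"
proof -
  let ?f = "id(v := u)"
  let ?g = "\<lambda>(a, b). (?f a, ?f b)"
  define C where "C = {c \<in> V. R u c \<and> R v c}"
  define D where "D = {(u, v), (v, u)} \<union> (\<lambda>c. (v, c)) ` C \<union> (\<lambda>c. (c, v)) ` C"
  have neq: "u \<noteq> v" using uv irr by (auto dest: irreflpD)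
  have nR: "\<not> R a a" for a using irr by (auto dest: irreflpD)
  have C: "finite C" using V unfolding C_def by simp
  have "card D \<le> card {(u, v), (v, u)} + card ((\<lambda>c. (v, c)) ` C) + card ((\<lambda>c. (c, v)) ` C)"
    unfolding D_def by (meson card_Un_le le_trans add_le_mono1)
  also have "\<dots> \<le> 2 + card C + card C"
    using card_image_le[OF C] card_insert_le_m1[of 2 "{(v, u)}" "(u, v)"] by (intro add_mono) auto
  finally have D: "card D \<le> 2 + 2 * card C" by simp
  have inj: "inj_on ?g (arcs V R - D)"
  proof (rule inj_onI, clarify)
    fix a b a' b'
    assume ab: "(a, b) \<in> arcs V R" "(a, b) \<notin> D" "(a', b') \<in> arcs V R" "(a', b') \<notin> D"
      and eq: "?f a = ?f a'" "?f b = ?f b'"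
    have r: "R a b" "R a' b'" "R b a" "R b' a'" "a \<in> V" "b \<in> V" "a' \<in> V" "b' \<in> V"
      using ab sym unfolding arcs_def by (auto dest: sympD)
    have nD: "(a, b) \<noteq> (u, v)" "(a, b) \<noteq> (v, u)" "a = v \<Longrightarrow> b \<notin> C" "b = v \<Longrightarrow> a \<notin> C"
      "(a', b') \<noteq> (u, v)" "(a', b') \<noteq> (v, u)" "a' = v \<Longrightarrow> b' \<notin> C" "b' = v \<Longrightarrow> a' \<notin> C"
      using ab unfolding D_def by auto
    have "a = a' \<or> a = v \<and> a' = u \<or> a = u \<and> a' = v" using eq(1) by (auto split: if_splits)
    moreover have "b = b' \<or> b = v \<and> b' = u \<or> b = u \<and> b' = v" using eq(2) by (auto split: if_splits)
    ultimately show "a = a' \<and> b = b'"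
      using r nD nR neq unfolding C_def by blast
  qed
  have sub: "?g ` (arcs V R - D) \<subseteq> arcs (V - {v}) (contract u v R)"
  proof clarify
    fix a b assume ab: "(a, b) \<in> arcs V R" "(a, b) \<notin> D"
    have r: "R a b" "a \<in> V" "b \<in> V" "a \<noteq> b" using ab nR unfolding arcs_def by auto
    have nD: "(a, b) \<noteq> (u, v)" "(a, b) \<noteq> (v, u)" using ab unfolding D_def by auto
    show "(?f a, ?f b) \<in> arcs (V - {v}) (contract u v R)"
      using r nD neq uv nR unfolding arcs_def contract_def by auto
  qed
  have "card (arcs V R - D) \<le> card (arcs (V - {v}) (contract u v R))"
    using card_inj_on_le[OF inj sub] V finite_arcs by blast
  moreover have "card (arcs V R) - card D \<le> card (arcs V R - D)"
    using C unfolding D_def by (intro diff_card_le_card_Diff) auto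
  ultimately show ?thesis using D unfolding C_def by linarith
qed

lemma no_model_contract:
  assumes "no_model t V R" "symp R" "u \<in> V" "v \<in> V" "R u v" "u \<noteq> v"
  shows "no_model t (V - {v}) (contract u v R)"
proof (rule no_model_retract[OF assms(1), where f = "id(v := u)"])
  fix x y assume "x \<in> V - {v}" "y \<in> V - {v}" "contract u v R x y"
  then have xy: "x \<in> V" "y \<in> V" "x \<noteq> v" "y \<noteq> v" "R x y \<or> x = u \<and> R v y \<or> y = u \<and> R x v"
    unfolding contract_def by auto
  then obtain a b where "a \<in> V" "b \<in> V" "(id(v := u)) a = x" "(id(v := u)) b = y" "R a b"
    using assms(4) by (metis fun_upd_other fun_upd_same id_apply)
  then show "\<exists>a\<in>V. \<exists>b\<in>V. (id(v := u)) a = x \<and> (id(v := u)) b = y \<and> R a b" by blast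
qed (use assms in \<open>auto dest: sympD\<close>)

definition graph_rel :: "'a set \<Rightarrow> ('a \<Rightarrow> 'a \<Rightarrow> bool) \<Rightarrow> bool" where
  "graph_rel V R \<longleftrightarrow> finite V \<and> symp R \<and> irreflp R"

lemma graph_relD: "graph_rel V R \<Longrightarrow> finite V" "graph_rel V R \<Longrightarrow> symp R" "graph_rel V R \<Longrightarrow> irreflp R"
  unfolding graph_rel_def by auto

lemma graph_rel_contract: "graph_rel V R \<Longrightarrow> graph_rel (V - {v}) (contract u v R)"
  unfolding graph_rel_def symp_def irreflp_def contract_def by auto

text \<open>A minor that is minimal subject to having at least \<open>x n - y\<close> edges on
  \<open>n\<close> vertices (arcs count twice). By the first hypothesis even the complete graph on
  \<open>n1\<close> vertices lies below this line, so the reduction stops earlier. Surplus edges and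
  isolated vertices can be deleted, and an edge with fewer than \<open>x\<close> common neighbours
  can be contracted: this loses at most \<open>x\<close> edges, while the line falls by
  \<open>x\<close>.\<close>

lemma affine_reduction:
  fixes x y n1 N :: nat and V :: "'a set"
  assumes n1: "n1 * (n1 - 1) + 2 * y < 2 * x * n1"
    and "graph_rel V R" "no_model t V R" "n1 \<le> card V" "card V \<le> N"
    and "2 * x * card V \<le> card (arcs V R) + 2 * y"
  shows "\<exists>(V' :: 'a set) R'. graph_rel V' R' \<and> no_model t V' R' \<and> n1 < card V' \<and> card V' \<le> N \<and>
    card (arcs V' R') + 2 * y \<le> 2 * x * card V' + 1 \<and> (\<forall>a\<in>V'. 0 < rdeg R' V' a) \<and>
    (\<forall>a\<in>V'. \<forall>b\<in>V'. R' a b \<longrightarrow> x \<le> card {c \<in> V'. R' a c \<and> R' b c})"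
  using assms(2-)
proof (induction "card V" arbitrary: V R rule: less_induct)
  case less
  note outer = less.hyps
  from less.prems show ?case
  proof (induction "card (arcs V R)" arbitrary: R rule: less_induct)
    case (less R)
    note G = graph_relD[OF less.prems(1)]
    have n: "n1 < card V"
    proof (rule ccontr)
      assume "\<not> n1 < card V"
      then have "card V = n1" using less.prems by simp
      then show False using n1 less.prems(5) card_arcs_le[OF G(1,3)] by simp
    qed
    have xn: "2 * x * n1 \<le> 2 * x * card V" using n by simp
    have step: "2 * x * (card V - 1) + 2 * x = 2 * x * card V"
      using n by (cases "card V") (auto simp: algebra_simps)
    show ?case
    \<comment> \<open>A surplus of two arcs pays for the deletion of one edge; this keeps
      \<open>V\<close> and uses the inner induction.\<close>
    proof (cases "2 * x * card V + 2 \<le> card (arcs V R) + 2 * y")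
      case True
      then have "card (arcs V R) > 0" using n1 xn by linarith
      then obtain p where "p \<in> arcs V R" by (metis card_gt_0_iff ex_in_conv)
      then obtain u v where uv: "u \<in> V" "v \<in> V" "R u v" unfolding arcs_def by blast
      define R' where "R' = (\<lambda>a b. R a b \<and> (a, b) \<noteq> (u, v) \<and> (a, b) \<noteq> (v, u))"
      have "arcs V R = arcs V R' \<union> {(u, v), (v, u)}"
        using uv G(2) unfolding arcs_def R'_def by (auto dest: sympD)
      then have "card (arcs V R) \<le> card (arcs V R') + card {(u, v), (v, u)}" by (metis card_Un_le)
      also have "\<dots> \<le> card (arcs V R') + 2"
        using card_insert_le_m1[of 2 "{(v, u)}" "(u, v)"] by (intro add_left_mono) auto
      finally have c1: "card (arcs V R) \<le> card (arcs V R') + 2" .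
      have "arcs V R' \<subset> arcs V R" using uv unfolding arcs_def R'_def by auto
      then have "card (arcs V R') < card (arcs V R)" using finite_arcs[OF G(1)] psubset_card_mono by blast
      moreover have "graph_rel V R'"
        using less.prems(1) unfolding graph_rel_def R'_def symp_def irreflp_def by auto
      moreover have "no_model t V R'"
        by (rule no_model_mono[OF less.prems(2)]) (auto simp: R'_def)
      moreover have "2 * x * card V \<le> card (arcs V R') + 2 * y" using True c1 by linarith
      ultimately show ?thesis by (intro less.hyps[of R'] less.prems(3,4))
    next
      case False
      show ?thesis
      proof (cases "\<forall>a\<in>V. 0 < rdeg R V a")
        case nz: True
        show ?thesis
        proof (cases "\<forall>a\<in>V. \<forall>b\<in>V. R a b \<longrightarrow> x \<le> card {c \<in> V. R a c \<and> R b c}")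
          case True
          have le: "card (arcs V R) + 2 * y \<le> 2 * x * card V + 1" using False by linarith
          show ?thesis
            by (rule exI[of _ V], rule exI[of _ R], intro conjI) (fact less.prems(1,2,4) n True nz le)+
        next
          case no: False
          then obtain u v where uv: "u \<in> V" "v \<in> V" "R u v" "card {c \<in> V. R u c \<and> R v c} < x"
            using not_le by blast
          have neq: "u \<noteq> v" using uv G(3) by (auto dest: irreflpD)
          have cV: "card (V - {v}) = card V - 1" using uv by simp
          have "card (arcs V R) \<le> card (arcs (V - {v}) (contract u v R)) + 2 * x"
            using card_arcs_contract[OF G uv(1,2,3)] uv(4) by linarith
          then have "2 * x * card (V - {v}) \<le> card (arcs (V - {v}) (contract u v R)) + 2 * y"
            unfolding cV using step less.prems(5) by linarith
          moreover have "card (V - {v}) < card V" using cV n by linarith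
          moreover have "n1 \<le> card (V - {v})" "card (V - {v}) \<le> N" using cV n less.prems(4) by linarith+
          ultimately show ?thesis
            by (intro outer[of "V - {v}" "contract u v R"] graph_rel_contract[OF less.prems(1)]
              no_model_contract[OF less.prems(2) G(2) uv(1,2,3) neq])
        qed
      next
        case no: False
        then obtain v where v: "v \<in> V" "rdeg R V v = 0" by auto
        have cV: "card (V - {v}) = card V - 1" using v by simp
        have "2 * x * card (V - {v}) \<le> card (arcs (V - {v}) R) + 2 * y"
          using step cV less.prems(5) arcs_delete_vertex[OF G(1,2) v] by simp
        moreover have "card (V - {v}) < card V" using cV n by linarith
        moreover have "n1 \<le> card (V - {v})" "card (V - {v}) \<le> N" using cV n less.prems(4) by linarith+
        moreover have "graph_rel (V - {v}) R" using less.prems(1) unfolding graph_rel_def by simp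
        moreover have "no_model t (V - {v}) R"
          by (rule no_model_mono[OF less.prems(2)]) auto
        ultimately show ?thesis by (intro outer[of "V - {v}" R])
      qed
    qed
  qed
qed

text \<open>\<open>H\<close> is the neighbourhood of a vertex of at most average degree in the
  reduced minor. Every edge there lies in at least \<open>x\<close> triangles, which is minimum
  degree \<open>x\<close> inside \<open>H\<close>, while the average degree bounds
  \<open>card H\<close> by about \<open>2 x - 2 y / n\<close>.\<close>

lemma dense_neighbourhood:
  fixes x y n1 N :: nat and V :: "'a set"
  assumes "n1 * (n1 - 1) + 2 * y < 2 * x * n1"
    and "graph_rel V R" "no_model t V R" "n1 \<le> card V" "card V \<le> N"
    and "2 * x * card V \<le> card (arcs V R) + 2 * y"
  obtains H :: "'a set" and R' n where "graph_rel H R'" "no_model t H R'" "n1 < n" "n \<le> N"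
    "card H * n + 2 * y \<le> 2 * x * n + 1" "x < card H" "\<forall>a\<in>H. x \<le> rdeg R' H a"
proof -
  let ?P = "\<lambda>(V' :: 'a set) R'. graph_rel V' R' \<and> no_model t V' R' \<and> n1 < card V' \<and> card V' \<le> N \<and>
    card (arcs V' R') + 2 * y \<le> 2 * x * card V' + 1 \<and> (\<forall>a\<in>V'. 0 < rdeg R' V' a) \<and>
    (\<forall>a\<in>V'. \<forall>b\<in>V'. R' a b \<longrightarrow> x \<le> card {c \<in> V'. R' a c \<and> R' b c})"
  have "\<exists>V' R'. ?P V' R'" by (rule affine_reduction[OF assms])
  then obtain V' where "\<exists>R'. ?P V' R'" by (rule exE)
  then obtain R' where "?P V' R'" by (rule exE)
  then have V': "graph_rel V' R'" "no_model t V' R'" "n1 < card V'" "card V' \<le> N"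
    "card (arcs V' R') + 2 * y \<le> 2 * x * card V' + 1" "\<forall>a\<in>V'. 0 < rdeg R' V' a"
    "\<forall>a\<in>V'. \<forall>b\<in>V'. R' a b \<longrightarrow> x \<le> card {c \<in> V'. R' a c \<and> R' b c}" by simp_all
  note G = graph_relD[OF V'(1)]
  have "V' \<noteq> {}" using V'(3) by auto
  then obtain v where v: "v \<in> V'" "rdeg R' V' v * card V' \<le> card (arcs V' R')"
    using exists_le_average[OF G(1), of "rdeg R' V'"] sum_rdeg[OF G(1), of R'] by auto
  define H where "H = {b \<in> V'. R' v b}"
  have H: "H \<subseteq> V'" "finite H" "card H = rdeg R' V' v" using G(1) unfolding H_def rdeg_def by auto
  have deg: "x \<le> rdeg R' H a" if "a \<in> H" for a
  proof -
    have "{c \<in> V'. R' v c \<and> R' a c} = {b \<in> H. R' a b}" unfolding H_def by auto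
    then show ?thesis using V'(7) v(1) that unfolding H_def rdeg_def by fastforce
  qed
  have "0 < card H" using V'(6) v H by simp
  then obtain a where a: "a \<in> H" by (metis card_gt_0_iff ex_in_conv)
  have "rdeg R' H a < card H"
    unfolding rdeg_def using a G(3) H(2) by (intro psubset_card_mono) (auto dest: irreflpD)
  then have "x < card H" using deg[OF a] by linarith
  moreover have "card H * card V' + 2 * y \<le> 2 * x * card V' + 1" using v(2) V'(5) H(3) by simp
  moreover have "graph_rel H R'" using V'(1) H unfolding graph_rel_def by blast
  moreover have "no_model t H R'" by (rule no_model_mono[OF V'(2) H(1)]) auto
  ultimately show thesis using that[of H R' "card V'"] V'(3,4) deg by simp
qed

(* First stage: a neighbourhood of average density 1/2 (x = 14 g, y = 0).  Second stage: on such a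
   graph the affine potential x n - y with x = 8 g, y = 28 g^2 stays between the number of edges
   and n^2 / 2, which pushes the density of a neighbourhood up to 4/7. *)
lemma card_arcs_less:
  fixes g i t :: nat and V :: "'a set"
  assumes G: "graph_rel V R" and nm: "no_model t V R" and V: "V \<noteq> {}"
    and g: "0 < g" "t * Suc i \<le> g" "(6 * g) ^ Suc i < (7 * g) ^ i"
  shows "card (arcs V R) < 28 * g * card V"
proof (rule ccontr)
  assume "\<not> card (arcs V R) < 28 * g * card V"
  then have big: "2 * (14 * g) * card V \<le> card (arcs V R) + 2 * 0" by simp
  have V1: "1 \<le> card V" using V G unfolding graph_rel_def by (auto simp: Suc_le_eq card_gt_0_iff)
  have line1: "1 * (1 - 1) + 2 * 0 < 2 * (14 * g) * (1::nat)" using g by simp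
  obtain H1 :: "'a set" and R1 n where H1: "graph_rel H1 R1" "no_model t H1 R1" "1 < n" "n \<le> card V"
    "card H1 * n + 2 * 0 \<le> 2 * (14 * g) * n + 1" "14 * g < card H1" "\<forall>a\<in>H1. 14 * g \<le> rdeg R1 H1 a"
    by (rule dense_neighbourhood[OF line1 G nm V1 le_refl big])
  \<comment> \<open>The rounding error \<open>1\<close> disappears because \<open>n\<close> is at
    least 2.\<close>
  have m1: "card H1 \<le> 28 * g"
  proof (rule ccontr)
    assume "\<not> card H1 \<le> 28 * g"
    then have "(28 * g + 1) * n \<le> card H1 * n" by (intro mult_right_mono) auto
    then show False using H1(3,5) by (simp add: algebra_simps)
  qed
  \<comment> \<open>The second line passes below \<open>H1\<close>: with \<open>m = card H1\<close>,
    the gap \<open>16 g m - 14 g m = 2 g m\<close> is at most \<open>56 g^2 = 2 y\<close>, since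
    \<open>m \<le> 28 g\<close>.\<close>
  have "card H1 * (14 * g) \<le> card (arcs H1 R1)"
    using sum_rdeg[OF graph_relD(1)[OF H1(1)], of R1] sum_mono[of H1 "\<lambda>_. 14 * g" "rdeg R1 H1"] H1(7) by simp
  moreover have "card H1 * (2 * g) \<le> 28 * g * (2 * g)" using m1 by (rule mult_right_mono) simp
  moreover have "2 * (8 * g) * card H1 = card H1 * (14 * g) + card H1 * (2 * g)"
    "28 * g * (2 * g) = 2 * (28 * g * g)" by (simp_all add: algebra_simps)
  ultimately have e1: "2 * (8 * g) * card H1 \<le> card (arcs H1 R1) + 2 * (28 * g * g)" by linarith
  \<comment> \<open>A complete graph on \<open>8 g\<close> vertices has fewer than
    \<open>64 g^2\<close> arcs, and \<open>64 + 56 < 128\<close>.\<close>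
  have line2: "(8 * g) * (8 * g - 1) + 2 * (28 * g * g) < 2 * (8 * g) * (8 * g)"
  proof -
    have "(8 * g) * (8 * g - 1) \<le> (8 * g) * (8 * g)" by (rule mult_left_mono) auto
    moreover have "0 < g * g" using g by simp
    ultimately show ?thesis by (simp only: mult.assoc mult.commute mult.left_commute)
  qed
  have n1: "8 * g \<le> card H1" using H1(6) by simp
  obtain H :: "'a set" and R' n' where H: "graph_rel H R'" "no_model t H R'" "8 * g < n'" "n' \<le> 28 * g"
    "card H * n' + 2 * (28 * g * g) \<le> 2 * (8 * g) * n' + 1" "8 * g < card H" "\<forall>a\<in>H. 8 * g \<le> rdeg R' H a"
    by (rule dense_neighbourhood[OF line2 H1(1,2) n1 m1 e1])
  \<comment> \<open>The average degree is about \<open>16 g - 56 g^2 / n'\<close>, which is at most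
    \<open>14 g\<close> because \<open>n' \<le> 28 g\<close>.\<close>
  have m: "card H \<le> 14 * g"
  proof (rule ccontr)
    assume "\<not> card H \<le> 14 * g"
    then have "(14 * g + 1) * n' \<le> card H * n'" by (intro mult_right_mono) auto
    then have "14 * g * n' + n' + 56 * g * g \<le> 16 * g * n' + 1" using H(5) by (simp add: algebra_simps)
    then have "n' + 56 * g * g \<le> 2 * g * n' + 1" by (simp add: algebra_simps)
    moreover have "2 * g * n' \<le> 2 * g * (28 * g)" using H(4) by (rule mult_left_mono) simp
    moreover have "2 * g * (28 * g) = 56 * g * g" by simp
    ultimately have "n' \<le> 1" by linarith
    then show False using H(3) g by simp
  qed
  note GH = graph_relD[OF H(1)]
  have D: "card {b \<in> H. \<not> R' a b} \<le> card H - 8 * g" if "a \<in> H" for a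
  proof -
    have "{b \<in> H. \<not> R' a b} = H - {b \<in> H. R' a b}" by auto
    then have "card {b \<in> H. \<not> R' a b} = card H - rdeg R' H a"
      unfolding rdeg_def using GH(1) by (simp add: card_Diff_subset)
    moreover have "8 * g \<le> rdeg R' H a" using H(7) that by blast
    ultimately show ?thesis by linarith
  qed
  \<comment> \<open>Minimum degree \<open>8 g\<close> among at most \<open>14 g\<close> vertices
    leaves at most \<open>6 g\<close> non-neighbours. The remaining \<open>8 g\<close> vertices are
    shared out as \<open>g\<close> for the stars already built and \<open>c = 7 g\<close> for
    candidates; this is the origin of \<open>6\<close> and \<open>7\<close> in the
    hypothesis.\<close>
  have "(card H - 8 * g) ^ Suc i \<le> (6 * g) ^ Suc i" using m by (intro power_mono) auto
  then have "(card H - 8 * g) ^ Suc i < (7 * g) ^ i" using g by linarith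
  moreover have "t * Suc i + 7 * g + (card H - 8 * g) \<le> card H" using g H(6) by linarith
  ultimately show False
    using dense_model[OF GH(1,2) D, of "7 * g" t i] g H(2) by simp
qed

section \<open>Cliques and distinct neighbourhoods\<close>

definition cliques :: "'a set \<Rightarrow> ('a \<Rightarrow> 'a \<Rightarrow> bool) \<Rightarrow> 'a set set" where
  "cliques V R = {S. S \<subseteq> V \<and> (\<forall>a\<in>S. \<forall>b\<in>S. a \<noteq> b \<longrightarrow> R a b)}"

lemma finite_cliques: "finite V \<Longrightarrow> finite (cliques V R)"
  unfolding cliques_def by simp

lemma card_cliques_split:
  assumes "finite V"
  shows "card (cliques V R) \<le> card (cliques (V - {v}) R) + card (cliques {b \<in> V. R v b} R)"
proof -
  have "cliques V R \<subseteq> cliques (V - {v}) R \<union> insert v ` cliques {b \<in> V. R v b} R"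
  proof
    fix S assume S: "S \<in> cliques V R"
    show "S \<in> cliques (V - {v}) R \<union> insert v ` cliques {b \<in> V. R v b} R"
    proof (cases "v \<in> S")
      case True
      then have "S = insert v (S - {v})" by blast
      moreover have "S - {v} \<in> cliques {b \<in> V. R v b} R" using S True unfolding cliques_def by auto
      ultimately show ?thesis by blast
    next
      case False
      then show ?thesis using S unfolding cliques_def by blast
    qed
  qed
  moreover have fin: "finite (cliques (V - {v}) R)" "finite (cliques {b \<in> V. R v b} R)"
    using assms by (simp_all add: finite_cliques)
  ultimately have "card (cliques V R) \<le> card (cliques (V - {v}) R \<union> insert v ` cliques {b \<in> V. R v b} R)"
    by (intro card_mono) auto
  also have "\<dots> \<le> card (cliques (V - {v}) R) + card (insert v ` cliques {b \<in> V. R v b} R)"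
    by (rule card_Un_le)
  also have "\<dots> \<le> card (cliques (V - {v}) R) + card (cliques {b \<in> V. R v b} R)"
    using card_image_le[OF fin(2)] by simp
  finally show ?thesis .
qed

lemma no_model_subset: "no_model t V R \<Longrightarrow> A \<subseteq> V \<Longrightarrow> no_model t A R"
  using no_model_mono by (metis order_refl)

lemma graph_rel_subset: "graph_rel V R \<Longrightarrow> A \<subseteq> V \<Longrightarrow> graph_rel A R"
  unfolding graph_rel_def using finite_subset by blast

text \<open>The vertices of a clique are themselves branch sets.\<close>

lemma clique_card_less:
  assumes "no_model t V R" "S \<in> cliques V R" "finite V"
  shows "card S < t"
proof (rule ccontr)
  assume "\<not> card S < t"
  then have t: "t \<le> card S" by simp
  have S: "finite S" "S \<subseteq> V" "\<forall>a\<in>S. \<forall>b\<in>S. a \<noteq> b \<longrightarrow> R a b"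
    using assms finite_subset unfolding cliques_def by auto
  obtain x where x: "bij_betw x {0..<card S} S" using ex_bij_betw_nat_finite[OF S(1)] by blast
  have xS: "x i \<in> S" if "i < t" for i using bij_betwE[OF x] that t by auto
  have inj: "x i \<noteq> x j" if "i < t" "j < t" "i \<noteq> j" for i j
    using bij_betw_imp_inj_on[OF x] that t unfolding inj_on_def by auto
  have "clique_model t V R (\<lambda>i. {x i})"
    unfolding clique_model_def using xS inj S conn_singleton by auto
  then show False using assms(1) unfolding no_model_def by blast
qed

(* A vertex with more than s non-neighbours exists as long as 5 t < |V|; splitting the cliques at
   it gives the recurrence f m = f (m - 1) + f (m - 1 - s), which has growth rate at most x. *)
lemma card_cliques_le_power:
  fixes x :: real and s t :: nat
  assumes x: "1 \<le> x" "1 \<le> x ^ s * (x - 1)" and s: "s * s \<le> t" "1 \<le> t"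
    and "graph_rel V R" "no_model t V R"
  shows "real (card (cliques V R)) \<le> 2 ^ (5 * t) * x ^ card V"
  using assms(5-)
proof (induction "card V" arbitrary: V rule: less_induct)
  case less
  note G = graph_relD[OF less.prems(1)]
  show ?case
  proof (cases "card V \<le> 5 * t")
    case True
    have "card (cliques V R) \<le> card (Pow V)"
      unfolding cliques_def using G(1) by (intro card_mono) auto
    then have "real (card (cliques V R)) \<le> 2 ^ card V" using G(1) by (simp add: card_Pow)
    also have "\<dots> \<le> 2 ^ (5 * t) * 1" using True by simp
    also have "\<dots> \<le> 2 ^ (5 * t) * x ^ card V" using x by (intro mult_left_mono) auto
    finally show ?thesis .
  next
    case False
    have "\<exists>v\<in>V. s < card {b \<in> V. \<not> R v b}"
    proof (rule ccontr)
      assume *: "\<not> (\<exists>v\<in>V. s < card {b \<in> V. \<not> R v b})"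
      have D: "card {b \<in> V. \<not> R a b} \<le> s" if "a \<in> V" for a
        using * that not_le by blast
      \<comment> \<open>Otherwise dominating edges exist: \<open>dense_model\<close> with
        \<open>i = 1\<close>, \<open>D = s\<close> and \<open>c = s * s + 1\<close> needs
        \<open>2 t + s^2 + 1 + s\<close> vertices, which is at most \<open>5 t + 1\<close>.\<close>
      have "s \<le> t" using le_trans[OF le_square[of s] s(1)] .
      then have "t * Suc 1 + (s * s + 1) + s \<le> card V" using s False by simp
      then show False using dense_model[OF G(1,2) D, of "s * s + 1" t 1] less.prems(2) by simp
    qed
    then obtain v where v: "v \<in> V" "s < card {b \<in> V. \<not> R v b}" by blast
    define N where "N = {b \<in> V. R v b}"
    have "card (N \<union> {b \<in> V. \<not> R v b}) = card N + card {b \<in> V. \<not> R v b}"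
      unfolding N_def using G(1) by (intro card_Un_disjoint) auto
    moreover have "N \<union> {b \<in> V. \<not> R v b} = V" unfolding N_def by auto
    ultimately have "card V = card N + card {b \<in> V. \<not> R v b}" by simp
    then have cN: "card N + Suc s \<le> card V" using v(2) by linarith
    have cV: "card (V - {v}) = card V - 1" using v by simp
    define m where "m = card V - Suc s"
    have m: "card V = m + s + 1" "card N \<le> m" "card (V - {v}) = m + s" using cN cV unfolding m_def by auto
    have sub: "V - {v} \<subseteq> V" "N \<subseteq> V" unfolding N_def by auto
    have IH1: "real (card (cliques (V - {v}) R)) \<le> 2 ^ (5 * t) * x ^ (m + s)"
      using less.hyps[OF _ graph_rel_subset[OF less.prems(1) sub(1)] no_model_subset[OF less.prems(2) sub(1)]] m by simp
    have "real (card (cliques N R)) \<le> 2 ^ (5 * t) * x ^ card N"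
      using less.hyps[OF _ graph_rel_subset[OF less.prems(1) sub(2)] no_model_subset[OF less.prems(2) sub(2)]] m by simp
    also have "\<dots> \<le> 2 ^ (5 * t) * x ^ m" using m x by (intro mult_left_mono power_increasing) auto
    finally have IH2: "real (card (cliques N R)) \<le> 2 ^ (5 * t) * x ^ m" .
    have "real (card (cliques V R)) \<le> real (card (cliques (V - {v}) R)) + real (card (cliques N R))"
      using card_cliques_split[OF G(1), of R v] unfolding N_def by linarith
    also have "\<dots> \<le> 2 ^ (5 * t) * (x ^ (m + s) + x ^ m)" using IH1 IH2 by (simp add: algebra_simps)
    also have "x ^ (m + s) + x ^ m \<le> x ^ card V"
    proof -
      \<comment> \<open>The hypothesis \<open>1 \<le> x ^ s * (x - 1)\<close> says that
        \<open>x ^ s + 1 \<le> x ^ (s + 1)\<close>, which is the recurrence.\<close>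
      have "x ^ m * 1 \<le> x ^ m * (x ^ s * (x - 1))" using x by (intro mult_left_mono) auto
      then show ?thesis unfolding m by (simp add: power_add algebra_simps)
    qed
    finally show ?thesis by simp
  qed
qed

text \<open>Degeneracy: a vertex of at most average degree has at most \<open>e\<close> neighbours,
  so at most \<open>F\<close> cliques pass through it, and it is removed. The summand
  \<open>1\<close> is the empty clique.\<close>

lemma card_cliques_linear:
  fixes F :: real
  assumes arcs: "\<And>A. A \<subseteq> V \<Longrightarrow> A \<noteq> {} \<Longrightarrow> card (arcs A R) \<le> e * card A"
    and F: "\<And>A. A \<subseteq> V \<Longrightarrow> card A \<le> e \<Longrightarrow> real (card (cliques A R)) \<le> F"
    and G: "graph_rel V R"
  shows "real (card (cliques V R)) \<le> 1 + real (card V) * F"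
  using assms
proof (induction "card V" arbitrary: V)
  case 0
  then have "V = {}" unfolding graph_rel_def by auto
  then have "cliques V R = {{}}" unfolding cliques_def by auto
  then show ?case using \<open>V = {}\<close> by simp
next
  case (Suc n)
  note G = graph_relD[OF Suc.prems(3)]
  have ne: "V \<noteq> {}" using Suc(2) by auto
  then obtain v where v: "v \<in> V" "rdeg R V v * card V \<le> e * card V"
    using exists_le_average[OF G(1) ne, of "rdeg R V"] sum_rdeg[OF G(1), of R] Suc.prems(1)[OF order_refl ne]
    by (metis le_trans)
  then have "rdeg R V v \<le> e" using Suc(2) by simp
  then have N: "real (card (cliques {b \<in> V. R v b} R)) \<le> F"
    using Suc.prems(2)[of "{b \<in> V. R v b}"] unfolding rdeg_def by simp
  have cV: "n = card (V - {v})" using v Suc(2) by simp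
  have "real (card (cliques (V - {v}) R)) \<le> 1 + real (card (V - {v})) * F"
  proof (rule Suc.hyps(1)[OF cV])
    have sub: "V - {v} \<subseteq> V" by blast
    show "graph_rel (V - {v}) R" by (rule graph_rel_subset[OF Suc.prems(3) sub])
    show "card (arcs A R) \<le> e * card A" if "A \<subseteq> V - {v}" "A \<noteq> {}" for A
      using Suc.prems(1)[of A] that sub by blast
    show "real (card (cliques A R)) \<le> F" if "A \<subseteq> V - {v}" "card A \<le> e" for A
      using Suc.prems(2)[of A] that sub by blast
  qed
  then have "real (card (cliques V R)) \<le> 1 + real (card (V - {v})) * F + F"
    using card_cliques_split[OF G(1), of R v] N by linarith
  also have "\<dots> = 1 + real (Suc n) * F" using cV by (simp add: algebra_simps)
  finally show ?case using Suc(2) by simp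
qed

(* The vertex w of W is merged into f w. *)
definition merge :: "'a set \<Rightarrow> ('a \<Rightarrow> 'a) \<Rightarrow> ('a \<Rightarrow> 'a \<Rightarrow> bool) \<Rightarrow> 'a \<Rightarrow> 'a \<Rightarrow> bool" where
  "merge W f R x y \<longleftrightarrow> x \<noteq> y \<and> (R x y \<or> (\<exists>w\<in>W. f w = x \<and> R w y) \<or> (\<exists>w\<in>W. f w = y \<and> R w x))"

lemma graph_rel_merge: "graph_rel V R \<Longrightarrow> B \<subseteq> V \<Longrightarrow> graph_rel B (merge W f R)"
  unfolding graph_rel_def merge_def symp_def irreflp_def using finite_subset by fast

text \<open>Each vertex of \<open>B\<close> absorbs the star of those vertices of \<open>W\<close>
  that are sent to it; the other vertices outside \<open>B\<close> are deleted.\<close>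

lemma no_model_merge:
  assumes "no_model t V R" "symp R" "B \<subseteq> V" "W \<subseteq> V - B" "\<forall>w\<in>W. f w \<in> B \<and> R w (f w)"
  shows "no_model t B (merge W f R)"
proof (rule no_model_retract[where V = "B \<union> W" and R = R and f = "\<lambda>x. if x \<in> W then f x else x"])
  show "no_model t (B \<union> W) R" using assms no_model_subset[of t V R "B \<union> W"] by blast
  fix x y assume xy: "x \<in> B" "y \<in> B" "merge W f R x y"
  have nW: "x \<notin> W" "y \<notin> W" using xy assms(4) by auto
  let ?f = "\<lambda>x. if x \<in> W then f x else x"
  consider "R x y" | w where "w \<in> W" "f w = x" "R w y" | w where "w \<in> W" "f w = y" "R x w"
    using xy(3) assms(2) unfolding merge_def by (blast dest: sympD)
  then show "\<exists>a\<in>B \<union> W. \<exists>b\<in>B \<union> W. ?f a = x \<and> ?f b = y \<and> R a b"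
  proof cases
    case 1
    then show ?thesis using xy nW by (intro bexI[of _ x] bexI[of _ y]) auto
  next
    case (2 w)
    then show ?thesis using xy nW by (intro bexI[of _ w] bexI[of _ y]) auto
  next
    case (3 w)
    then show ?thesis using xy nW by (intro bexI[of _ x] bexI[of _ w]) auto
  qed
qed (use assms in \<open>auto dest: sympD\<close>)

text \<open>\<open>W\<close> is as large as possible while its size is paid for by arcs of the
  merged graph. If the \<open>B\<close>-neighbours of a further \<open>w\<close> contained a
  non-adjacent pair \<open>x\<close>, \<open>y\<close>, merging \<open>w\<close> into
  \<open>x\<close> would create the arc from \<open>x\<close> to \<open>y\<close> and pay for
  \<open>w\<close>.\<close>

lemma exists_maximal_merge:
  assumes G: "graph_rel V R" and B: "B \<subseteq> V"
  obtains W f where "W \<subseteq> V - B" "\<forall>w\<in>W. f w \<in> B \<and> R w (f w)" "card W \<le> card (arcs B (merge W f R))"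
    "\<forall>w\<in>V - B - W. {b \<in> B. R w b} \<in> cliques B (merge W f R)"
proof -
  define P where "P m \<longleftrightarrow> (\<exists>W f. card W = m \<and> W \<subseteq> V - B \<and> (\<forall>w\<in>W. f w \<in> B \<and> R w (f w)) \<and>
    card W \<le> card (arcs B (merge W f R)))" for m
  note G' = graph_relD[OF G]
  have "P 0" unfolding P_def by (intro exI[of _ "{}"]) auto
  moreover have "\<forall>m. P m \<longrightarrow> m \<le> card V"
    unfolding P_def using G'(1) card_mono by (metis Diff_subset subset_trans)
  ultimately obtain m where m: "P m" "\<And>m'. P m' \<Longrightarrow> m' \<le> m"
    using GreatestI_nat[of P 0 "card V"] Greatest_le_nat[of P _ "card V"] by blast
  then obtain W f where W: "card W = m" "W \<subseteq> V - B" "\<forall>w\<in>W. f w \<in> B \<and> R w (f w)"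
    "card W \<le> card (arcs B (merge W f R))" unfolding P_def by blast
  have "{b \<in> B. R w b} \<in> cliques B (merge W f R)" if w: "w \<in> V - B - W" for w
  proof (rule ccontr)
    assume "{b \<in> B. R w b} \<notin> cliques B (merge W f R)"
    then obtain x y where xy: "x \<in> B" "y \<in> B" "R w x" "R w y" "x \<noteq> y" "\<not> merge W f R x y"
      unfolding cliques_def by blast
    define f' where "f' = f(w := x)"
    have wW: "w \<notin> W" using w by blast
    have sub: "arcs B (merge W f R) \<subset> arcs B (merge (insert w W) f' R)"
    proof
      show "arcs B (merge W f R) \<subseteq> arcs B (merge (insert w W) f' R)"
        using wW unfolding arcs_def merge_def f'_def by auto
      have "(x, y) \<in> arcs B (merge (insert w W) f' R)"
        using xy unfolding arcs_def merge_def f'_def by auto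
      moreover have "(x, y) \<notin> arcs B (merge W f R)" using xy unfolding arcs_def by auto
      ultimately show "arcs B (merge W f R) \<noteq> arcs B (merge (insert w W) f' R)" by blast
    qed
    have finB: "finite B" using B G'(1) finite_subset by blast
    have "card (arcs B (merge W f R)) < card (arcs B (merge (insert w W) f' R))"
      using psubset_card_mono[OF finite_arcs[OF finB] sub] .
    moreover have finW: "finite W" using W(2) G'(1) finite_subset by blast
    ultimately have "card (insert w W) \<le> card (arcs B (merge (insert w W) f' R))"
      using W(4) wW by simp
    moreover have "card (insert w W) = Suc m" using W(1) finW wW by simp
    moreover have "insert w W \<subseteq> V - B" using W(2) w by blast
    moreover have "\<forall>u\<in>insert w W. f' u \<in> B \<and> R u (f' u)" using W(3) xy wW unfolding f'_def by auto
    ultimately have "P (Suc m)" unfolding P_def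
      by (intro exI[of _ "insert w W"] exI[of _ f'] conjI)
    then show False using m(2) by fastforce
  qed
  then show thesis using that W by blast
qed

text \<open>The vertices of \<open>B\<close> settled by choosing \<open>w\<close>. Vertices with
  equal sets are interchangeable, so the number of such sets containing \<open>b\<close> is the
  branching number at \<open>b\<close>.\<close>

definition dominated_by :: "('a \<Rightarrow> 'a \<Rightarrow> bool) \<Rightarrow> 'a set \<Rightarrow> 'a \<Rightarrow> 'a set" where
  "dominated_by R B w = {b \<in> B. b = w \<or> R w b}"

lemma sum_card_swap:
  assumes "finite A" "finite B"
  shows "(\<Sum>a\<in>A. card {b \<in> B. P a b}) = (\<Sum>b\<in>B. card {a \<in> A. P a b})"
  by (rule sum_multicount_gen) (use assms in auto)

text \<open>An average over \<open>b\<close>. The sets containing \<open>b\<close> come from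
  vertices of \<open>B\<close>, from vertices of \<open>W\<close>, or are cliques of the merged
  graph. The first two kinds are counted by edges, the third by cliques, each with fewer than
  \<open>t\<close> vertices. Per vertex this is \<open>e + 1 + (e + e^2) + t (1 + F)\<close>, where
  the terms in \<open>e\<close> make up \<open>(e + 1)^2\<close>.\<close>

lemma exists_few_candidates:
  fixes F :: real and V B :: "'a set"
  assumes G: "graph_rel V R" and nm: "no_model t V R" and B: "B \<subseteq> V" "B \<noteq> {}"
    and arcs: "\<And>A R'. graph_rel (A :: 'a set) R' \<Longrightarrow> no_model t A R' \<Longrightarrow> card (arcs A R') \<le> e * card A"
    and F: "\<And>A R'. graph_rel (A :: 'a set) R' \<Longrightarrow> no_model t A R' \<Longrightarrow> card A \<le> e \<Longrightarrow> real (card (cliques A R')) \<le> F"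
  shows "\<exists>b\<in>B. real (card {S \<in> dominated_by R B ` V. b \<in> S}) \<le> (real e + 1)^2 + real t * (1 + F)"
proof -
  let ?cnt = "\<lambda>b. card {S \<in> dominated_by R B ` V. b \<in> S}"
  note G' = graph_relD[OF G]
  obtain W f where W: "W \<subseteq> V - B" "\<forall>w\<in>W. f w \<in> B \<and> R w (f w)" "card W \<le> card (arcs B (merge W f R))"
    "\<forall>w\<in>V - B - W. {b \<in> B. R w b} \<in> cliques B (merge W f R)"
    by (rule exists_maximal_merge[OF G B(1)])
  define R' where "R' = merge W f R"
  have GR': "graph_rel B R'" "no_model t B R'"
    unfolding R'_def using graph_rel_merge[OF G B(1)] no_model_merge[OF nm G'(2) B(1) W(1,2)] by auto
  have fin: "finite B" "finite W" using B W G'(1) finite_subset by blast+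
  have cB: "0 < card B" using fin B by (simp add: card_gt_0_iff)
  define C where "C = cliques B R'"
  have finC: "finite C" unfolding C_def using fin finite_cliques by blast
  have cC: "real (card C) \<le> 1 + real (card B) * F"
    unfolding C_def
  proof (rule card_cliques_linear[OF _ _ GR'(1)])
    fix A assume "A \<subseteq> B"
    then have A: "graph_rel A R'" "no_model t A R'" using GR' graph_rel_subset no_model_subset by blast+
    show "card (arcs A R') \<le> e * card A" using arcs[OF A] .
    show "real (card (cliques A R')) \<le> F" if "card A \<le> e" using F[OF A that] .
  qed
  have cW: "card W \<le> e * card B" using W(3) arcs[OF GR'] unfolding R'_def by linarith
  have bound: "?cnt b \<le>
      rdeg R B b + 1 + card {w \<in> W. R b w} + card {S \<in> C. b \<in> S}" if b: "b \<in> B" for b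
  proof -
    let ?B = "insert b {w \<in> B. R b w}"
    have "{S \<in> dominated_by R B ` V. b \<in> S} \<subseteq>
        dominated_by R B ` ?B \<union> dominated_by R B ` {w \<in> W. R b w} \<union> {S \<in> C. b \<in> S}"
    proof
      fix S assume "S \<in> {S \<in> dominated_by R B ` V. b \<in> S}"
      then obtain w where w: "w \<in> V" "b \<in> S" "S = dominated_by R B w" by blast
      have bw: "b = w \<or> R b w" using w(2,3) G'(2) unfolding dominated_by_def by (auto dest: sympD)
      consider "w \<in> B" | "w \<notin> B" "w \<in> W" | "w \<in> V - B - W" using w(1) by blast
      then show "S \<in> dominated_by R B ` ?B \<union> dominated_by R B ` {w \<in> W. R b w} \<union> {S \<in> C. b \<in> S}"
      proof cases
        case 1
        then show ?thesis using bw w(3) by blast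
      next
        case 2
        then show ?thesis using bw b w(3) by blast
      next
        case 3
        then have "S = {b \<in> B. R w b}" unfolding w(3) dominated_by_def by auto
        then have "S \<in> C" using W(4) 3 unfolding C_def R'_def by blast
        then show ?thesis using w(2) by blast
      qed
    qed
    then have "?cnt b \<le>
        card (dominated_by R B ` ?B \<union> dominated_by R B ` {w \<in> W. R b w} \<union> {S \<in> C. b \<in> S})"
      using fin finC by (intro card_mono) auto
    also have "\<dots> \<le> card (dominated_by R B ` ?B) + card (dominated_by R B ` {w \<in> W. R b w}) + card {S \<in> C. b \<in> S}"
      by (meson card_Un_le le_trans add_le_mono1)
    also have "card (dominated_by R B ` ?B) \<le> rdeg R B b + 1"
    proof -
      have "card (dominated_by R B ` ?B) \<le> card ?B" using fin by (intro card_image_le) auto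
      also have "\<dots> \<le> card {w \<in> B. R b w} + 1" using fin by (simp add: card_insert_if)
      finally show ?thesis unfolding rdeg_def .
    qed
    also have "card (dominated_by R B ` {w \<in> W. R b w}) \<le> card {w \<in> W. R b w}"
      using fin by (intro card_image_le) auto
    finally show ?thesis by simp
  qed
  have s1: "(\<Sum>b\<in>B. rdeg R B b) \<le> e * card B"
    using sum_rdeg[OF fin(1), of R] arcs[of B R] graph_rel_subset[OF G B(1)] no_model_subset[OF nm B(1)] by simp
  \<comment> \<open>Since \<open>W\<close> is paid for by arcs of the merged graph,
    \<open>card W \<le> e * card B\<close>; the edges between \<open>B\<close> and \<open>W\<close>
    are then counted in the sparse graph on \<open>B \<union> W\<close>.\<close>
  have s2: "(\<Sum>b\<in>B. card {w \<in> W. R b w}) \<le> e * card B + e * (e * card B)"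
  proof -
    have "(\<Sum>b\<in>B. card {w \<in> W. R b w}) \<le> (\<Sum>b\<in>B. rdeg R (B \<union> W) b)"
      unfolding rdeg_def using fin by (intro sum_mono card_mono) auto
    also have "\<dots> \<le> (\<Sum>b\<in>B \<union> W. rdeg R (B \<union> W) b)" using fin by (intro sum_mono2) auto
    also have "\<dots> = card (arcs (B \<union> W) R)" using fin by (intro sum_rdeg) auto
    also have "\<dots> \<le> e * card (B \<union> W)"
    proof -
      have "B \<union> W \<subseteq> V" using B(1) W(1) by blast
      then show ?thesis using arcs[of "B \<union> W" R] graph_rel_subset[OF G] no_model_subset[OF nm] by blast
    qed
    also have "\<dots> \<le> e * (card B + card W)" using card_Un_le by (intro mult_left_mono) auto
    also have "\<dots> \<le> e * (card B + e * card B)" using cW by (intro mult_left_mono) auto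
    finally show ?thesis by (simp add: algebra_simps)
  qed
  have "(\<Sum>b\<in>B. card {S \<in> C. b \<in> S}) = (\<Sum>S\<in>C. card {b \<in> B. b \<in> S})"
    by (rule sum_card_swap[OF fin(1) finC])
  also have "\<dots> \<le> (\<Sum>S\<in>C. t)"
  proof (rule sum_mono)
    fix S assume S: "S \<in> C"
    then have "{b \<in> B. b \<in> S} = S" unfolding C_def cliques_def by auto
    then show "card {b \<in> B. b \<in> S} \<le> t"
      using clique_card_less[OF GR'(2) _ fin(1)] S unfolding C_def by fastforce
  qed
  finally have s3: "(\<Sum>b\<in>B. card {S \<in> C. b \<in> S}) \<le> t * card C" by (simp add: mult.commute)
  have cC': "real (t * card C) \<le> real t * (real (card B) * (1 + F))"
  proof -
    have "real (card C) \<le> real (card B) * (1 + F)" using cC cB by (simp add: algebra_simps)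
    then show ?thesis unfolding of_nat_mult by (rule mult_left_mono) simp
  qed
  obtain b where b: "b \<in> B" "?cnt b * card B \<le>
      (\<Sum>b\<in>B. ?cnt b)"
    using exists_le_average[OF fin(1) B(2), of ?cnt] by blast
  have "?cnt b * card B \<le>
      (\<Sum>b\<in>B. rdeg R B b + 1 + card {w \<in> W. R b w} + card {S \<in> C. b \<in> S})"
    by (rule order_trans[OF b(2) sum_mono]) (rule bound)
  also have "\<dots> \<le> e * card B + card B + (e * card B + e * (e * card B)) + t * card C"
    unfolding sum.distrib using s1 s2 s3 by simp
  finally have "real (?cnt b * card B) \<le>
      real (e * card B + card B + (e * card B + e * (e * card B)) + t * card C)"
    by (rule of_nat_mono)
  also have "\<dots> \<le> ((real e + 1)^2 + real t * (1 + F)) * real (card B)"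
    using cC' by (simp add: power2_eq_square algebra_simps)
  finally have "real (?cnt b) \<le> (real e + 1)^2 + real t * (1 + F)"
    using cB by simp
  then show ?thesis using b(1) by blast
qed

section \<open>Choice of the parameters\<close>

lemma fourth_power_between:
  fixes h :: nat
  assumes "1 \<le> h"
  obtains p where "1 \<le> p" "h \<le> p ^ 4" "p ^ 4 \<le> 16 * h"
proof -
  define p where "p = (LEAST p. h \<le> p ^ 4)"
  have "h \<le> h ^ 4" using power_increasing[of 1 4 h] assms by simp
  then have p: "h \<le> p ^ 4" unfolding p_def by (rule LeastI)
  have "p \<noteq> 0" using p assms by (cases "p = 0") auto
  then have "p - 1 < p" by simp
  then have "\<not> h \<le> (p - 1) ^ 4" unfolding p_def by (rule not_less_Least)
  then have less: "(p - 1) ^ 4 < h" by simp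
  have "p ^ 4 \<le> 16 * h"
  proof (cases "p = 1")
    case True
    then show ?thesis using assms by simp
  next
    case False
    \<comment> \<open>The factor \<open>16\<close> is \<open>2 ^ 4\<close>: doubling
      \<open>p - 1\<close>, whose fourth power is below \<open>h\<close>, reaches
      \<open>p\<close>.\<close>
    then have "p \<le> 2 * (p - 1)" using \<open>p \<noteq> 0\<close> by simp
    then have "p ^ 4 \<le> (2 * (p - 1)) ^ 4" by (rule power_mono) simp
    also have "\<dots> = 16 * (p - 1) ^ 4" by (simp add: power_mult_distrib)
    finally show ?thesis using less by simp
  qed
  then show thesis using that[of p] p \<open>p \<noteq> 0\<close> by simp
qed

text \<open>The claim amounts to \<open>6 g < (7 / 6) ^ i\<close>. Since
  \<open>2 * 6 ^ 5 \<le> 7 ^ 5\<close>, five steps at least double the right-hand side, so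
  \<open>70 p\<close> steps reach \<open>2 ^ (14 p)\<close>. On the left,
  \<open>6 g \<le> 426 p ^ 5\<close> with \<open>426 \<le> 2 ^ (9 p)\<close> and
  \<open>p < 2 ^ p\<close>.\<close>

lemma star_parameters:
  fixes p :: nat
  assumes "1 \<le> p"
  defines "i \<equiv> 70 * p" and "g \<equiv> p ^ 4 * (70 * p + 1)"
  shows "(6 * g) ^ Suc i < (7 * g) ^ i"
proof -
  have "p ^ 4 * (70 * p + 1) \<le> p ^ 4 * (71 * p)" using assms(1) by (intro mult_left_mono) auto
  also have "\<dots> = 71 * p ^ 5" using power_add[of p 4 1] by simp
  finally have g: "0 < g" "g \<le> 71 * p ^ 5" using assms(1) unfolding g_def by auto
  have "(426::nat) \<le> 2 ^ (9 * p)" using power_increasing[of 9 "9 * p" "2::nat"] assms(1) by simp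
  moreover have "p ^ 5 < (2 ^ p) ^ 5" using less_exp[of p] by (intro power_strict_mono) auto
  ultimately have "426 * p ^ 5 < 2 ^ (9 * p) * (2 ^ p) ^ 5" by (intro mult_le_less_imp_less) auto
  also have "\<dots> = 2 ^ (14 * p)" by (simp flip: power_mult power_add add: algebra_simps)
  finally have "6 * g < 2 ^ (14 * p)" using g(2) by linarith
  then have "6 * g * 6 ^ i < 2 ^ (14 * p) * 6 ^ i" by simp
  also have "\<dots> = (2 * 6 ^ 5) ^ (14 * p)" unfolding i_def power_mult_distrib power_mult[symmetric] by simp
  also have "\<dots> \<le> (7 ^ 5) ^ (14 * p)" by (rule power_mono) auto
  also have "\<dots> = 7 ^ i" unfolding i_def power_mult[symmetric] by simp
  finally have "6 * g * 6 ^ i * g ^ i < 7 ^ i * g ^ i" using g by simp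
  then show ?thesis by (simp add: power_mult_distrib algebra_simps)
qed

text \<open>Bernoulli's inequality gives \<open>(1 + 1/p) ^ p \<ge> 2\<close>, and a further power
  \<open>p\<close> gives \<open>2 ^ p \<ge> p\<close>, which cancels the factor \<open>1/p\<close>.
  Hence \<open>s = p * p\<close> is enough for the growth rate \<open>1 + 1/p\<close>.\<close>

lemma growth_rate:
  assumes "1 \<le> p"
  shows "1 \<le> (1 + 1 / real p) ^ (p * p) * ((1 + 1 / real p) - 1)"
proof -
  have "2 = 1 + real p * (1 / real p)" using assms by simp
  also have "\<dots> \<le> (1 + 1 / real p) ^ p" by (intro Bernoulli_inequality order_trans[of "-1" 0 "1 / real p"]) simp_all
  finally have "2 ^ p \<le> ((1 + 1 / real p) ^ p) ^ p" by (intro power_mono) auto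
  moreover have "real p \<le> 2 ^ p" using less_exp[of p] by (metis less_imp_le of_nat_le_iff of_nat_numeral of_nat_power)
  ultimately have "real p \<le> (1 + 1 / real p) ^ (p * p)" unfolding power_mult by linarith
  then show ?thesis using assms by (simp add: field_simps)
qed

text \<open>One constant for two purposes: the bound on arcs makes the size of the input linear in
  \<open>n\<close>, and the second bound limits the branching of the search.\<close>

lemma exists_sparsity_constant:
  "\<exists>c::nat. 2 \<le> c \<and> (\<forall>h (V :: 'a set) R. 1 \<le> h \<longrightarrow> graph_rel V R \<longrightarrow> no_model h V R \<longrightarrow>
    card (arcs V R) \<le> c ^ h * card V \<and>
    (\<forall>B\<subseteq>V. B \<noteq> {} \<longrightarrow> (\<exists>b\<in>B. card {S \<in> dominated_by R B ` V. b \<in> S} \<le> c ^ h)))"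
proof -
  \<comment> \<open>The summands are the bases of bounds for \<open>(e + 1)^2\<close> and
    \<open>t (1 + F)\<close> by \<open>t\<close>-th powers: \<open>1988 = 28 * 71\<close> comes from
    \<open>e \<le> 1988 p ^ 5\<close>, and \<open>128 = 2 * 2 * 2 ^ 5\<close> from \<open>t\<close>,
    from \<open>1 + F\<close> and from the \<open>2 ^ (5 t)\<close> in \<open>F\<close>. The
    exponent \<open>16\<close> in \<open>c\<close> is the loss in
    \<open>t \<le> 16 h\<close>.\<close>
  define M :: real where "M = 1989 ^ 2 * 16 + 128 * exp 1988"
  define c where "c = nat \<lceil>M ^ 16\<rceil>"
  have M: "2 \<le> M" unfolding M_def using exp_ge_zero[of "1988::real"] by (simp add: power2_eq_square)
  have cM: "M ^ 16 \<le> real c" unfolding c_def by linarith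
  moreover have "M ^ 1 \<le> M ^ 16" using M by (intro power_increasing) auto
  ultimately have c2: "2 \<le> c" using M by simp
  have "card (arcs V R) \<le> c ^ h * card V \<and>
    (\<forall>B\<subseteq>V. B \<noteq> {} \<longrightarrow> (\<exists>b\<in>B. card {S \<in> dominated_by R B ` V. b \<in> S} \<le> c ^ h))"
    if h: "1 \<le> h" and G: "graph_rel V R" and nm: "no_model h V R" for h and V :: "'a set" and R
  proof -
    obtain p where p: "1 \<le> p" "h \<le> p ^ 4" "p ^ 4 \<le> 16 * h" using fourth_power_between[OF h] .
    define t where "t = p ^ 4"
    define g where "g = p ^ 4 * (70 * p + 1)"
    define e where "e = 28 * g"
    define x where "x = 1 + 1 / real p"
    define F where "F = 2 ^ (5 * t) * exp (1988 * real t)"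
    have t1: "1 \<le> t" using p(1) unfolding t_def by simp
    have g0: "0 < g" "t * Suc (70 * p) \<le> g" using p(1) unfolding g_def t_def by auto
    have nmt: "no_model t V R" by (rule no_model_mono[OF nm]) (use p(2) in \<open>auto simp: t_def\<close>)
    have arcs: "card (arcs A R') \<le> e * card A" if "graph_rel A R'" "no_model t A R'" for A :: "'a set" and R'
    proof (cases "A = {}")
      case True
      then show ?thesis unfolding arcs_def by simp
    next
      case False
      then show ?thesis
        using card_arcs_less[OF that False g0] star_parameters[OF p(1)] unfolding e_def g_def by simp
    qed
    have x1: "1 \<le> x" unfolding x_def by simp
    have e_le: "e \<le> 1988 * p ^ 5"
    proof -
      have "p ^ 4 * (70 * p + 1) \<le> p ^ 4 * (71 * p)" using p(1) by (intro mult_left_mono) auto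
      also have "\<dots> = 71 * p ^ 5" using power_add[of p 4 1] by simp
      finally show ?thesis unfolding e_def g_def by simp
    qed
    \<comment> \<open>The growth rate absorbs the surplus factor \<open>p\<close> of the degree
      bound: \<open>e / p\<close> is of order \<open>p ^ 4 = t\<close>.\<close>
    have "x \<le> exp (1 / real p)" unfolding x_def by (rule exp_ge_add_one_self)
    then have "x ^ e \<le> exp (1 / real p) ^ e" using x1 by (intro power_mono) auto
    also have "\<dots> = exp (real e / real p)" by (simp flip: exp_of_nat_mult)
    also have "\<dots> \<le> exp (1988 * real t)"
    proof -
      have "real e \<le> real (1988 * p ^ 5)" using e_le by (rule of_nat_mono)
      also have "\<dots> = 1988 * real t * real p" unfolding t_def using power_add[of "real p" 4 1] by simp
      finally show ?thesis using p(1) by (simp add: field_simps)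
    qed
    finally have xe: "x ^ e \<le> exp (1988 * real t)" .
    have F: "real (card (cliques A R')) \<le> F"
      if A: "graph_rel A R'" "no_model t A R'" "card A \<le> e" for A :: "'a set" and R'
    proof -
      have "p * p * (p * p) \<le> t" unfolding t_def by (simp add: eval_nat_numeral)
      then have "real (card (cliques A R')) \<le> 2 ^ (5 * t) * x ^ card A"
        using card_cliques_le_power[of x "p * p" t A R'] x1 growth_rate[OF p(1)] t1 A(1,2) unfolding x_def by simp
      also have "\<dots> \<le> 2 ^ (5 * t) * x ^ e" using x1 A(3) by (intro mult_left_mono power_increasing) auto
      also have "\<dots> \<le> F" using xe unfolding F_def by simp
      finally show ?thesis .
    qed
    have t2: "real t \<le> 2 ^ t" using less_exp[of t] by (metis less_imp_le of_nat_le_iff of_nat_numeral of_nat_power)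
    have "p ^ 5 \<le> p ^ 8" using p(1) by (intro power_increasing) auto
    also have "\<dots> = t * t" unfolding t_def using power_add[of p 4 4] by simp
    finally have "e + 1 \<le> 1989 * (t * t)" using e_le t1 mult_le_mono[OF t1 t1] by linarith
    then have "real (e + 1) \<le> real (1989 * (t * t))" by (rule of_nat_mono)
    also have "\<dots> \<le> 1989 * (2 ^ t * 2 ^ t)" using t2 by (simp add: mult_mono)
    finally have e1: "real e + 1 \<le> 1989 * 4 ^ t" by (simp flip: power_mult_distrib)
    then have "(real e + 1) ^ 2 \<le> (1989 * 4 ^ t) ^ 2" by (intro power_mono) auto
    also have "\<dots> = 1989 ^ 2 * 16 ^ t" unfolding power_mult_distrib by (simp add: power_mult[symmetric] mult.commute[of t 2]) (simp add: power_mult)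
    also have "\<dots> \<le> (1989 ^ 2) ^ t * 16 ^ t" using self_le_power[of "1989 ^ 2 :: real" t] t1 by (intro mult_right_mono) auto
    finally have e2: "(real e + 1) ^ 2 \<le> (1989 ^ 2 * 16) ^ t" by (simp only: power_mult_distrib)
    have F1: "1 \<le> F" unfolding F_def using mult_mono[of 1 "2 ^ (5 * t)" 1 "exp (1988 * real t)"] by simp
    have "real t * (1 + F) \<le> 2 ^ t * (2 ^ t * F)"
    proof (rule mult_mono[OF t2])
      have "(2::real) \<le> 2 ^ t" using self_le_power[of "2::real" t] t1 by simp
      then have "2 * F \<le> 2 ^ t * F" using F1 by (intro mult_right_mono) auto
      then show "1 + F \<le> 2 ^ t * F" using F1 by linarith
    qed (use F1 in auto)
    also have "2 ^ t * (2 ^ t * F) = (2 * (2 * (2 ^ 5 * exp 1988))) ^ t"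
      unfolding F_def exp_of_nat2_mult power_mult power_mult_distrib ..
    also have "2 * (2 * (2 ^ 5 * exp 1988)) = 128 * exp (1988::real)" by simp
    finally have F2: "real t * (1 + F) \<le> (128 * exp 1988) ^ t" .
    have sum_le: "a ^ t + b ^ t \<le> (a + b) ^ t" if "0 \<le> a" "0 \<le> b" for a b :: real
    proof -
      obtain m where m: "t = Suc m" using t1 by (cases t) auto
      have "a * a ^ m + b * b ^ m \<le> a * (a + b) ^ m + b * (a + b) ^ m"
        using that by (intro add_mono mult_left_mono power_mono) auto
      then show ?thesis unfolding m power_Suc distrib_right .
    qed
    have "(real e + 1) ^ 2 + real t * (1 + F) \<le> M ^ t"
      unfolding M_def by (rule order_trans[OF add_mono[OF e2 F2] sum_le]) simp_all
    also have "\<dots> \<le> M ^ (16 * h)" using M p(3) unfolding t_def by (intro power_increasing) auto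
    also have "\<dots> = (M ^ 16) ^ h" by (simp add: power_mult)
    also have "\<dots> \<le> real c ^ h" using cM M by (intro power_mono) auto
    finally have D: "(real e + 1) ^ 2 + real t * (1 + F) \<le> real (c ^ h)" by simp
    have "real e \<le> (real e + 1) ^ 2" by (simp add: power2_eq_square algebra_simps)
    moreover have "0 \<le> real t * (1 + F)" using F1 by simp
    ultimately have "e \<le> c ^ h" using D by linarith
    then have "e * card V \<le> c ^ h * card V" by simp
    then have "card (arcs V R) \<le> c ^ h * card V" using arcs[OF G nmt] by linarith
    moreover have "\<exists>b\<in>B. card {S \<in> dominated_by R B ` V. b \<in> S} \<le> c ^ h" if B: "B \<subseteq> V" "B \<noteq> {}" for B
    proof -
      obtain b where "b \<in> B" "real (card {S \<in> dominated_by R B ` V. b \<in> S}) \<le> (real e + 1) ^ 2 + real t * (1 + F)"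
        using exists_few_candidates[OF G nmt B arcs F] by blast
      then show ?thesis using D by (intro bexI[of _ b]) linarith+
    qed
    ultimately show ?thesis by blast
  qed
  then show ?thesis using c2 by blast
qed

section \<open>Program logic\<close>

text \<open>Total correctness with running time. As \<open>exec\<close> is deterministic, the
  existential quantifier denotes the only run. The equations \<open>runs_simps\<close> act as
  weakest preconditions, so that the simplifier executes straight-line code.\<close>

definition runs :: "nat \<Rightarrow> com \<Rightarrow> state \<Rightarrow> (nat \<Rightarrow> state \<Rightarrow> bool) \<Rightarrow> bool" where
  "runs w P s Q \<longleftrightarrow> (\<exists>T s'. exec w P s T s' \<and> Q T s')"

lemma runs_mono: "runs w P s Q \<Longrightarrow> (\<And>T s'. Q T s' \<Longrightarrow> Q' T s') \<Longrightarrow> runs w P s Q'"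
  unfolding runs_def by blast

inductive_simps exec_iff:
  "exec w Skip s T s'"
  "exec w (Const r a) s T s'"
  "exec w (Copy r x) s T s'"
  "exec w (Add r x y) s T s'"
  "exec w (Sub r x y) s T s'"
  "exec w (Load r x) s T s'"
  "exec w (Store x y) s T s'"
  "exec w (Seq P R) s T s'"
  "exec w (IfLess x y P R) s T s'"

lemma runs_simps:
  "runs w Skip s Q = Q 1 s"
  "runs w (Const r a) s Q = Q 1 (set_reg r (a mod 2 ^ w) s)"
  "runs w (Copy r x) s Q = Q 1 (set_reg r (regs s x) s)"
  "runs w (Add r x y) s Q = Q 1 (set_reg r ((regs s x + regs s y) mod 2 ^ w) s)"
  "runs w (Sub r x y) s Q = Q 1 (set_reg r (regs s x - regs s y) s)"
  "runs w (Load r x) s Q = Q 1 (set_reg r (mem s (regs s x)) s)"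
  "runs w (Store x y) s Q = Q 1 (s\<lparr>mem := (mem s)(regs s x := regs s y)\<rparr>)"
  "runs w (Seq P R) s Q = runs w P s (\<lambda>T s'. runs w R s' (\<lambda>T'. Q (T + T')))"
  "runs w (IfLess x y P R) s Q =
    (if regs s x < regs s y then runs w P s (\<lambda>T. Q (1 + T)) else runs w R s (\<lambda>T. Q (1 + T)))"
  unfolding runs_def exec_iff by (auto, blast)

fun writes :: "com \<Rightarrow> nat set" where
  "writes Skip = {}"
| "writes (Const r a) = {r}"
| "writes (Copy r x) = {r}"
| "writes (Add r x y) = {r}"
| "writes (Sub r x y) = {r}"
| "writes (Load r x) = {r}"
| "writes (Store x y) = {}"
| "writes (Seq P R) = writes P \<union> writes R"
| "writes (IfLess x y P R) = writes P \<union> writes R"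
| "writes (WhileLess x y P) = writes P"

lemma exec_writes: "exec w P s T s' \<Longrightarrow> r \<notin> writes P \<Longrightarrow> regs s' r = regs s r"
  by (induction rule: exec.induct) (auto simp: set_reg_def)

text \<open>A frame rule: registers that a program does not write need not be carried through its
  invariant.\<close>

lemma runs_writes:
  assumes "runs w P s Q"
  shows "runs w P s (\<lambda>T s'. Q T s' \<and> (\<forall>r. r \<notin> writes P \<longrightarrow> regs s' r = regs s r))"
  using assms exec_writes unfolding runs_def by blast

text \<open>The cost may depend on the round; this is what lets a loop over all closed
  neighbourhoods add up to time linear in the size of the graph.\<close>

lemma runs_while_count:
  assumes step: "\<And>i s. i < N \<Longrightarrow> I i s \<Longrightarrow> regs s x < regs s y \<and> runs w P s (\<lambda>T s'. T \<le> t i \<and> I (Suc i) s')"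
    and stop: "\<And>s. I N s \<Longrightarrow> \<not> regs s x < regs s y"
    and init: "I 0 s"
  shows "runs w (WhileLess x y P) s (\<lambda>T s'. T \<le> (\<Sum>i<N. t i + 1) + 1 \<and> I N s')"
proof -
  have "runs w (WhileLess x y P) s (\<lambda>T s'. T \<le> (\<Sum>i\<in>{i..<N}. t i + 1) + 1 \<and> I N s')"
    if "i \<le> N" "I i s" for i s
    using that
  proof (induction arbitrary: s rule: inc_induct)
    case base
    then have "exec w (WhileLess x y P) s 1 s" by (intro exec.WhileFalse stop)
    then show ?case using base unfolding runs_def by (intro exI[of _ 1] exI[of _ s]) simp
  next
    case (step i)
    obtain T s' where 1: "regs s x < regs s y" "exec w P s T s'" "T \<le> t i" "I (Suc i) s'"
      using assms(1)[of i s] step unfolding runs_def by blast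
    obtain T' s'' where 2: "exec w (WhileLess x y P) s' T' s''"
      "T' \<le> (\<Sum>i\<in>{Suc i..<N}. t i + 1) + 1" "I N s''"
      using step.IH[OF 1(4)] unfolding runs_def by blast
    have "(\<Sum>i\<in>{i..<N}. t i + 1) = t i + 1 + (\<Sum>i\<in>{Suc i..<N}. t i + 1)"
      using step by (simp add: sum.atLeast_Suc_lessThan)
    then have "1 + T + T' \<le> (\<Sum>i\<in>{i..<N}. t i + 1) + 1" using 1 2 by linarith
    then show ?case using exec.WhileTrue[OF 1(1,2) 2(1)] 2(3) unfolding runs_def by blast
  qed
  from this[of 0 s] init show ?thesis by (simp add: atLeast0LessThan)
qed

text \<open>Meant for the search loop, whose number of rounds is only bounded by a measure that may
  fall by more than one.\<close>

lemma runs_while_measure: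
  assumes step: "\<And>s. I s \<Longrightarrow> regs s x < regs s y \<Longrightarrow> runs w P s (\<lambda>T s'. T \<le> t \<and> I s' \<and> m s' < (m s :: nat))"
    and init: "I s"
  shows "runs w (WhileLess x y P) s (\<lambda>T s'. T \<le> (t + 1) * m s + 1 \<and> I s' \<and> \<not> regs s' x < regs s' y)"
  using init
proof (induction "m s" arbitrary: s rule: less_induct)
  case less
  show ?case
  proof (cases "regs s x < regs s y")
    case False
    then have "exec w (WhileLess x y P) s 1 s" by (rule exec.WhileFalse)
    then show ?thesis using False less.prems unfolding runs_def by (intro exI[of _ 1] exI[of _ s]) simp
  next
    case True
    obtain T s' where 1: "exec w P s T s'" "T \<le> t" "I s'" "m s' < m s"
      using step[OF less.prems True] unfolding runs_def by blast
    obtain T' s'' where 2: "exec w (WhileLess x y P) s' T' s''"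
      "T' \<le> (t + 1) * m s' + 1" "I s''" "\<not> regs s'' x < regs s'' y"
      using less.hyps[OF 1(4,3)] unfolding runs_def by blast
    have "(t + 1) * m s' + (t + 1) \<le> (t + 1) * m s"
      using 1(4) mult_le_mono2[of "Suc (m s')" "m s" "t + 1"] by simp
    then have "1 + T + T' \<le> (t + 1) * m s + 1" using 1 2 by linarith
    then show ?thesis using exec.WhileTrue[OF True 1(1) 2(1)] 2(3,4) unfolding runs_def by blast
  qed
qed

lemma set_reg_simps [simp]:
  "regs (set_reg r a s) = (regs s)(r := a)" "mem (set_reg r a s) = mem s"
  unfolding set_reg_def by simp_all

section \<open>Memory layout\<close>

locale ram =
  fixes w k n :: nat and B :: "nat set" and E :: "nat set set" and adj :: "nat list list"
  assumes graph: "simple_graph ({..<n}, E)" and B: "B \<subseteq> {..<n}" and adj: "adjacency_lists n E adj"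
begin

text \<open>The input ends before \<open>L\<close>, the current path occupies the addresses from
  \<open>L\<close> to \<open>Q - 1\<close>, and the arrays start at \<open>Q\<close>.
  \<open>limit\<close> bounds all array indices: vertices, class numbers (fewer than
  \<open>size\<close>) and heights of the stack (at most \<open>n * (k + 1)\<close>).\<close>

definition L :: nat where "L = 2 * n + 1 + length (concat adj)"
definition Q :: nat where "Q = L + k"
definition size :: nat where "size = n + length (concat adj) + 1"
definition limit :: nat where "limit = size + n * (k + 1)"

definition start :: "nat \<Rightarrow> nat" where
  "start v = 2 * n + 1 + length (concat (take v adj))"

definition closed :: "nat \<Rightarrow> nat list" where "closed v = v # adj ! v"

lemma length_adj: "length adj = n"
  using adj unfolding adjacency_lists_def by simp

lemma start_Suc: "v < n \<Longrightarrow> start (Suc v) = start v + length (adj ! v)"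
  unfolding start_def by (simp add: take_Suc_conv_app_nth length_adj)

lemma start_le: "v \<le> n \<Longrightarrow> start v \<le> L"
proof -
  assume "v \<le> n"
  have "length (concat (take v adj)) + length (concat (drop v adj)) = length (concat adj)"
    by (metis append_take_drop_id concat_append length_append)
  then show ?thesis unfolding start_def L_def by linarith
qed


lemma closed: "v < n \<Longrightarrow> distinct (closed v)" "v < n \<Longrightarrow> set (closed v) \<subseteq> {..<n}"
  "v < n \<Longrightarrow> set (closed v) = {u. u = v \<or> {u, v} \<in> E}"
proof -
  assume v: "v < n"
  have a: "distinct (adj ! v)" "set (adj ! v) = nbrs E v" using adj v unfolding adjacency_lists_def by auto
  have e: "u < n" "u \<noteq> v" if "{u, v} \<in> E" for u
  proof -
    have "{u, v} \<subseteq> {..<n} \<and> card {u, v} = 2" using graph that unfolding simple_graph_def by blast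
    then show "u < n" "u \<noteq> v" by auto
  qed
  show "distinct (closed v)" "set (closed v) \<subseteq> {..<n}" "set (closed v) = {u. u = v \<or> {u, v} \<in> E}"
    using a e v unfolding closed_def nbrs_def by auto
qed

lemma closed_sym: "u < n \<Longrightarrow> v < n \<Longrightarrow> u \<in> set (closed v) \<longleftrightarrow> v \<in> set (closed u)"
  by (auto simp: closed(3) insert_commute)

lemma sum_length_closed: "(\<Sum>v<n. length (closed v)) = n + length (concat adj)"
proof -
  have "length (concat adj) = (\<Sum>v<n. length (adj ! v))"
    by (simp add: length_concat sum_list_sum_nth length_adj atLeast0LessThan)
  then show ?thesis unfolding closed_def by (simp add: sum_Suc)
qed

lemma length_closed_le: "v < n \<Longrightarrow> length (closed v) \<le> n"
  using closed[of v] distinct_card[of "closed v"] card_mono[of "{..<n}" "set (closed v)"] by simp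

lemma size_ge: "n < size" "v < n \<Longrightarrow> length (closed v) \<le> size"
  using length_closed_le[of v] unfolding size_def by auto

definition input :: "nat \<Rightarrow> nat" where
  "input a = (if a < length (input_words n B adj) then input_words n B adj ! a else 0)"

lemma input_colour: "v < n \<Longrightarrow> input v = (if v \<in> B then 1 else 0)"
  unfolding input_def input_words_def by (simp add: nth_append)

lemma input_start: "v \<le> n \<Longrightarrow> input (n + v) = start v"
  unfolding input_def input_words_def start_def by (simp add: nth_append del: upt_Suc)

lemma input_neighbour:
  assumes "v < n" "j < length (adj ! v)"
  shows "input (start v + j) = adj ! v ! j"
proof -
  have *: "concat adj = concat (take v adj) @ adj ! v @ concat (drop (Suc v) adj)"
    using assms by (metis concat.simps(2) concat_append id_take_nth_drop length_adj)
  then have "concat adj ! (length (concat (take v adj)) + j) = adj ! v ! j"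
    using assms by (simp add: nth_append)
  moreover have "length (concat (take v adj)) + j < length (concat adj)"
    using arg_cong[OF *, of length] assms by simp
  ultimately show ?thesis
    unfolding input_def input_words_def start_def by (simp add: nth_append)
qed

end

(* Register 9 is scratch, register 10 + j holds the base address of array j; the eight arrays are
   interleaved, so that none of them needs a size. *)
definition ld :: "nat \<Rightarrow> nat \<Rightarrow> nat \<Rightarrow> com" where
  "ld r j i = Seq (Add 9 i i) (Seq (Add 9 9 9) (Seq (Add 9 9 9) (Seq (Add 9 9 (10 + j)) (Load r 9))))"

definition st :: "nat \<Rightarrow> nat \<Rightarrow> nat \<Rightarrow> com" where
  "st j i r = Seq (Add 9 i i) (Seq (Add 9 9 9) (Seq (Add 9 9 9) (Seq (Add 9 9 (10 + j)) (Store 9 r))))"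

(* Runs P for every vertex, held in register 7. *)
definition for_vertices :: "com \<Rightarrow> com" where
  "for_vertices P = Seq (Const 7 0) (WhileLess 7 0 (Seq P (Add 7 7 3)))"

(* Runs P for every x in the closed neighbourhood of the vertex in register 7, x in register 8. *)
definition for_closed :: "com \<Rightarrow> com" where
  "for_closed P = Seq (Add 9 0 7) (Seq (Load 18 9) (Seq (Add 9 9 3) (Seq (Load 19 9)
    (Seq (Copy 8 7) (Seq P (WhileLess 18 19 (Seq (Load 8 18) (Seq P (Add 18 18 3)))))))))"

lemma writes_macros [simp]:
  "writes (ld r j i) = {9, r}" "writes (st j i r) = {9}"
  "writes (for_vertices P) = insert 7 (writes P)"
  "writes (for_closed P) = {8, 9, 18, 19} \<union> writes P"
  unfolding ld_def st_def for_vertices_def for_closed_def by auto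

text \<open>Keeps address arithmetic below the modulus. The factor \<open>8\<close> is the stride of
  the interleaved arrays, obtained by three doublings because the machine has no
  multiplication.\<close>

locale ram_large = ram +
  assumes large: "Q + 8 * limit + 8 < 2 ^ w"
begin

definition arr :: "state \<Rightarrow> nat \<Rightarrow> nat \<Rightarrow> nat" where
  "arr s j = (\<lambda>i. mem s (Q + 8 * i + j))"

definition put :: "nat \<Rightarrow> nat \<Rightarrow> nat \<Rightarrow> state \<Rightarrow> state" where
  "put j i v s = s\<lparr>mem := (mem s)(Q + 8 * i + j := v)\<rparr>"

text \<open>Cut off at \<open>k\<close>, so that writing into an array leaves the whole function
  unchanged.\<close>

definition path :: "state \<Rightarrow> nat \<Rightarrow> nat" where
  "path s = (\<lambda>i. if i < k then mem s (L + i) else 0)"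

definition put_path :: "nat \<Rightarrow> nat \<Rightarrow> state \<Rightarrow> state" where
  "put_path i v s = s\<lparr>mem := (mem s)(L + i := v)\<rparr>"

text \<open>Registers 3 and 28 serve as the constants 1 and 0, since additions and tests take
  registers only.\<close>

definition base :: "state \<Rightarrow> bool" where
  "base s \<longleftrightarrow> regs s 0 = n \<and> regs s 1 = k \<and> regs s 3 = 1 \<and> regs s 4 = L \<and> regs s 28 = 0 \<and>
    (\<forall>j<7. regs s (10 + j) = Q + j) \<and> (\<forall>a<L. mem s a = input a)"

lemma arr_simps [simp]:
  "arr (set_reg r a s) = arr s"
  "j < 8 \<Longrightarrow> j' < 8 \<Longrightarrow> arr (put j i v s) j' = (if j = j' then (arr s j)(i := v) else arr s j')"
  "i < k \<Longrightarrow> arr (put_path i v s) = arr s"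
  unfolding arr_def put_def put_path_def Q_def by (auto simp: fun_eq_iff) presburger+

lemma path_simps [simp]:
  "path (set_reg r a s) = path s"
  "path (put j i v s) = path s"
  "i < k \<Longrightarrow> path (put_path i v s) = (path s)(i := v)"
  unfolding path_def put_def put_path_def Q_def by (auto simp: fun_eq_iff)

lemma regs_simps [simp]:
  "regs (put j i v s) = regs s" "regs (put_path i v s) = regs s"
  unfolding put_def put_path_def by simp_all

lemma base_simps [simp]:
  "r \<noteq> 0 \<Longrightarrow> r \<noteq> 1 \<Longrightarrow> r \<noteq> 3 \<Longrightarrow> r \<noteq> 4 \<Longrightarrow> r \<noteq> 28 \<Longrightarrow> r < 10 \<or> 17 \<le> r \<Longrightarrow> base (set_reg r a s) = base s"
  "base (put j i v s) = base s"
  "base (put_path i v s) = base s"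
  unfolding base_def put_def put_path_def Q_def by auto

lemma baseD:
  assumes "base s"
  shows "regs s 0 = n" "regs s (Suc 0) = k" "regs s 3 = Suc 0" "regs s 4 = L" "regs s 28 = 0"
  using assms unfolding base_def by auto

lemma set_reg_set_reg [simp]: "set_reg r a (set_reg r b s) = set_reg r a s"
  unfolding set_reg_def by simp

lemma runs_ld:
  assumes "base s" "j < 7" "i \<noteq> 9" "regs s i \<le> limit"
  shows "runs w (ld r j i) s P = P 5 (set_reg r (arr s j (regs s i)) (set_reg 9 (Q + 8 * regs s i + j) s))"
proof -
  let ?x = "regs s i"
  have b: "regs s (10 + j) = Q + j" using assms unfolding base_def by blast
  have m: "(?x + ?x) mod 2 ^ w = 2 * ?x" "(2 * ?x + 2 * ?x) mod 2 ^ w = 4 * ?x"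
    "(4 * ?x + 4 * ?x) mod 2 ^ w = 8 * ?x" "(8 * ?x + (Q + j)) mod 2 ^ w = Q + 8 * ?x + j"
    using large assms by simp_all
  have neq: "10 + j \<noteq> 9" by simp
  have five: "(5::nat) = 1 + (1 + (1 + (1 + 1)))" by simp
  show ?thesis
    unfolding ld_def runs_simps arr_def five using assms by (simp only: set_reg_simps fun_upd_apply if_True if_False neq b m set_reg_set_reg refl simp_thms fun_upd_same)
qed

lemma runs_st:
  assumes "base s" "j < 7" "i \<noteq> 9" "r \<noteq> 9" "regs s i \<le> limit"
  shows "runs w (st j i r) s P = P 5 (put j (regs s i) (regs s r) (set_reg 9 (Q + 8 * regs s i + j) s))"
proof -
  let ?x = "regs s i"
  have b: "regs s (10 + j) = Q + j" using assms unfolding base_def by blast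
  have m: "(?x + ?x) mod 2 ^ w = 2 * ?x" "(2 * ?x + 2 * ?x) mod 2 ^ w = 4 * ?x"
    "(4 * ?x + 4 * ?x) mod 2 ^ w = 8 * ?x" "(8 * ?x + (Q + j)) mod 2 ^ w = Q + 8 * ?x + j"
    using large assms by simp_all
  have neq: "10 + j \<noteq> 9" by simp
  have five: "(5::nat) = 1 + (1 + (1 + (1 + 1)))" by simp
  show ?thesis
    unfolding st_def runs_simps put_def five using assms by (simp only: set_reg_simps fun_upd_apply if_True if_False neq b m set_reg_set_reg refl simp_thms fun_upd_same)
qed

lemma L_le: "n < L" "2 * n < L" "L \<le> Q" "n < 2 ^ w" "n + n < 2 ^ w" "L < 2 ^ w" "k < 2 ^ w" "(1::nat) < 2 ^ w"
  "L + k < 2 ^ w"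
  using large unfolding Q_def L_def by simp_all

lemma w_nonzero: "w \<noteq> 0"
  using L_le(8) by (cases "w = 0") auto

lemma runs_for_vertices:
  assumes base: "base s" and I0: "I 0 s"
    and stable: "\<And>i a s. I i (set_reg 7 a s) = I i s"
    and body: "\<And>v s. v < n \<Longrightarrow> base s \<Longrightarrow> regs s 7 = v \<Longrightarrow> I v s \<Longrightarrow>
      runs w P s (\<lambda>T s'. T \<le> t v \<and> base s' \<and> regs s' 7 = v \<and> I (Suc v) s')"
  shows "runs w (for_vertices P) s (\<lambda>T s'. T \<le> (\<Sum>v<n. t v + 2) + 2 \<and> base s' \<and> I n s')"
proof -
  have "runs w (WhileLess 7 0 (Seq P (Add 7 7 3))) (set_reg 7 0 s)
    (\<lambda>T s'. T \<le> (\<Sum>v<n. (t v + 1) + 1) + 1 \<and> base s' \<and> regs s' 7 = n \<and> I n s')"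
  proof (rule runs_while_count[where I = "\<lambda>i s. base s \<and> regs s 7 = i \<and> I i s"])
    fix i s assume "i < n" and s': "base s \<and> regs s 7 = i \<and> I i s"
    from s' have s: "base s" "regs s 7 = i" "I i s" by blast+
    have i: "Suc i < 2 ^ w" using \<open>i < n\<close> L_le(4) by linarith
    have "runs w (Seq P (Add 7 7 3)) s (\<lambda>T s'. T \<le> t i + 1 \<and> base s' \<and> regs s' 7 = Suc i \<and> I (Suc i) s')"
      unfolding runs_simps
      by (rule runs_mono[OF body[OF \<open>i < n\<close> s]]) (auto simp: stable baseD i)
    then show "regs s 7 < regs s 0 \<and> runs w (Seq P (Add 7 7 3)) s
        (\<lambda>T s'. T \<le> t i + 1 \<and> base s' \<and> regs s' 7 = Suc i \<and> I (Suc i) s')"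
      using s \<open>i < n\<close> by (simp add: baseD)
  qed (use base I0 stable in \<open>simp_all add: baseD\<close>)
  then show ?thesis
    unfolding for_vertices_def runs_simps mod_0
    by (rule runs_mono) simp
qed

lemma runs_for_closed:
  fixes I :: "nat list \<Rightarrow> state \<Rightarrow> bool"
  assumes base: "base s" and b: "regs s 7 = b" "b < n" and I0: "I [] s"
    and stable: "\<And>xs r a s. r \<in> {8, 9, 18, 19} \<Longrightarrow> I xs (set_reg r a s) = I xs s"
    and body: "\<And>xs x ys s. closed b = xs @ x # ys \<Longrightarrow> x < n \<Longrightarrow> base s \<Longrightarrow> regs s 7 = b \<Longrightarrow> regs s 8 = x \<Longrightarrow>
      I xs s \<Longrightarrow> runs w P s (\<lambda>T s'. T \<le> t \<and> base s' \<and> I (xs @ [x]) s')"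
    and writes: "writes P \<inter> {7, 18, 19} = {}"
  shows "runs w (for_closed P) s (\<lambda>T s'. T \<le> (t + 4) * length (closed b) + 10 \<and> base s' \<and>
    regs s' 7 = b \<and> I (closed b) s')"
proof -
  let ?N = "length (adj ! b)"
  \<comment> \<open>After \<open>i\<close> rounds \<open>Suc i\<close> vertices are done:
    \<open>P\<close> has been run on \<open>b\<close> itself before the loop over its
    neighbours.\<close>
  define J where "J i s \<longleftrightarrow> base s \<and> regs s 7 = b \<and> regs s 18 = start b + i \<and> regs s 19 = start b + ?N \<and>
    I (take (Suc i) (closed b)) s" for i s
  have xn: "x < n" if "closed b = xs @ x # ys" for xs x ys
    using closed(2)[OF b(2)] that by auto
  have body': "runs w P s (\<lambda>T s'. T \<le> t \<and> base s' \<and> regs s' 7 = b \<and> regs s' 18 = regs s 18 \<and>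
      regs s' 19 = regs s 19 \<and> I (xs @ [x]) s')"
    if "closed b = xs @ x # ys" "base s" "regs s 7 = b" "regs s 8 = x" "I xs s" for xs x ys s
    using runs_writes[OF body[OF that(1) xn[OF that(1)] that(2-5)]]
    by (rule runs_mono) (use writes that(3) in auto)
  have le: "start b + ?N \<le> L" using start_le[of "Suc b"] start_Suc[OF b(2)] b(2) by simp
  have loop: "runs w (WhileLess 18 19 (Seq (Load 8 18) (Seq P (Add 18 18 3)))) s
    (\<lambda>T s'. T \<le> (\<Sum>i<?N. (t + 2) + 1) + 1 \<and> J ?N s')" if "J 0 s" for s
  proof (rule runs_while_count)
    fix i s assume i: "i < ?N" and J: "J i s"
    have cl: "closed b = take (Suc i) (closed b) @ adj ! b ! i # drop (Suc (Suc i)) (closed b)"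
      using i id_take_nth_drop[of "Suc i" "closed b"] unfolding closed_def by simp
    have x: "mem s (start b + i) = adj ! b ! i"
      using J input_neighbour[OF b(2) i] le i unfolding J_def base_def by simp
    have J': "J i (set_reg 8 (mem s (start b + i)) s)" using J stable unfolding J_def by simp
    have "runs w (Seq (Load 8 18) (Seq P (Add 18 18 3))) s (\<lambda>T s'. T \<le> t + 2 \<and> J (Suc i) s')"
      unfolding runs_simps
      using J unfolding J_def
      by (simp, intro runs_mono[OF body'[OF cl]])
        (use J' x i le L_le in \<open>simp_all add: J_def stable baseD take_Suc_conv_app_nth closed_def\<close>)
    then show "regs s 18 < regs s 19 \<and>
        runs w (Seq (Load 8 18) (Seq P (Add 18 18 3))) s (\<lambda>T s'. T \<le> t + 2 \<and> J (Suc i) s')"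
      using J i unfolding J_def by simp
  qed (use that in \<open>simp_all add: J_def\<close>)
  define s1 where "s1 = set_reg 8 b (set_reg 19 (start b + ?N) (set_reg 9 (Suc (n + b))
    (set_reg 18 (start b) (set_reg 9 (n + b) s))))"
  have m: "mem s (n + b) = start b" "mem s (Suc (n + b)) = start b + ?N"
    using base input_start[of b] input_start[of "Suc b"] start_Suc[OF b(2)] b(2) L_le unfolding base_def by auto
  have s1: "base s1" "regs s1 7 = b" "regs s1 8 = b" "I [] s1" "regs s1 18 = start b" "regs s1 19 = start b + ?N"
    unfolding s1_def using base b I0 stable by simp_all
  have "runs w (Seq P (WhileLess 18 19 (Seq (Load 8 18) (Seq P (Add 18 18 3))))) s1
    (\<lambda>T s'. T \<le> t + ((\<Sum>i<?N. (t + 2) + 1) + 1) \<and> J ?N s')"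
    unfolding runs_simps(8)
  proof (rule runs_mono[OF body'[of "[]" b "adj ! b" s1]], goal_cases)
    case (6 T s')
    then have "J 0 s'" unfolding J_def using s1 by (simp add: closed_def)
    then show ?case by (rule runs_mono[OF loop]) (use 6 in auto)
  qed (use s1 in \<open>simp_all add: closed_def\<close>)
  moreover have "runs w (for_closed P) s Q' = runs w (Seq P (WhileLess 18 19 (Seq (Load 8 18) (Seq P (Add 18 18 3))))) s1
    (\<lambda>T. Q' (Suc (Suc (Suc (Suc (Suc T))))))" for Q'
    unfolding for_closed_def runs_simps(2-7) runs_simps(8)[of w "Add _ _ _"] runs_simps(8)[of w "Load _ _"]
      runs_simps(8)[of w "Copy _ _"] s1_def
    using base b L_le m by (simp add: baseD)
  ultimately show ?thesis
    by (simp, elim runs_mono) (simp add: J_def closed_def algebra_simps)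
qed

end

section \<open>The search program\<close>

(* Registers: 5 length of the current path, 6 height of the stack, 20 next unused class,
   23 and 24 minimum and minimiser of the number of candidates, 27 and 30 flags for "halted" and
   "found".  Arrays: 0 alive, 1 class, 2 mark, 3 successor class, 4 representative,
   5 and 6 depth and vertex of the entries of the stack. *)
definition init_prog :: com where
  "init_prog = for_vertices (Seq (Load 22 7) (Seq (st 0 7 22) (st 1 7 28)))"

definition colour_prog :: com where
  "colour_prog = Seq (Const 26 0) (WhileLess 26 5 (Seq (Add 9 4 26) (Seq (Load 7 9)
    (Seq (for_closed (st 0 8 28)) (Add 26 26 3)))))"

text \<open>One step of partition refinement. The mark \<open>b + 1\<close> says that the class of
  \<open>x\<close> has already been split by \<open>b\<close>; its successor class takes the members
  adjacent or equal to \<open>b\<close>. Vertices \<open>b\<close> come in increasing order, so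
  older marks are smaller and never have to be cleared.\<close>

definition split_prog :: com where
  "split_prog = Seq (ld 21 1 8) (Seq (ld 22 2 21) (Seq (Add 29 7 3)
    (Seq (IfLess 22 29 (Seq (st 2 21 29) (Seq (st 3 21 20) (Seq (st 2 20 28) (Add 20 20 3)))) Skip)
    (Seq (ld 22 3 21) (st 1 8 22)))))"

definition refine_prog :: com where
  "refine_prog = Seq (Const 20 1) (Seq (st 2 28 28)
    (for_vertices (Seq (ld 22 0 7) (IfLess 28 22 (for_closed split_prog) Skip))))"

definition rep_prog :: com where
  "rep_prog = for_vertices (Seq (ld 21 1 7) (st 4 21 7))"

text \<open>Two strict comparisons stand for a test of equality.\<close>

definition if_rep :: "com \<Rightarrow> com" where
  "if_rep P = Seq (ld 21 1 8) (Seq (ld 22 4 21) (IfLess 22 8 Skip (IfLess 8 22 Skip P)))"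

text \<open>The initial minimum \<open>n + 1\<close> exceeds every number of candidates, so its
  survival signals that no black vertex is left undominated.\<close>

definition best_prog :: com where
  "best_prog = Seq (Add 23 0 3) (for_vertices (Seq (ld 22 0 7) (IfLess 28 22
    (Seq (Const 25 0) (Seq (for_closed (if_rep (Add 25 25 3)))
      (IfLess 25 23 (Seq (Copy 23 25) (Copy 24 7)) Skip))) Skip)))"

definition push_prog :: com where
  "push_prog = Seq (Copy 7 24) (for_closed (if_rep (Seq (st 5 6 5) (Seq (st 6 6 8) (Add 6 6 3)))))"

definition pop_prog :: com where
  "pop_prog = IfLess 28 6 (Seq (Sub 6 6 3) (Seq (ld 5 5 6) (Seq (ld 22 6 6) (Seq (Add 9 4 5)
    (Seq (Store 9 22) (Add 5 5 3)))))) (Const 27 1)"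

context ram_large
begin

text \<open>What the analysis of a search node must leave intact: the path, the stack and the two
  flags.\<close>

definition keep :: "state \<Rightarrow> state \<Rightarrow> bool" where
  "keep s s' \<longleftrightarrow> path s' = path s \<and> arr s' 5 = arr s 5 \<and> arr s' 6 = arr s 6 \<and>
    (\<forall>r\<in>{5, 6, 27, 30}. regs s' r = regs s r)"

lemma keep_refl: "keep s s"
  unfolding keep_def by simp

lemma keep_trans: "keep s s' \<Longrightarrow> keep s' s'' \<Longrightarrow> keep s s''"
  unfolding keep_def by simp

lemma keep_simps [simp]:
  "r \<notin> {5, 6, 27, 30} \<Longrightarrow> keep s (set_reg r a s') = keep s s'"
  "j < 5 \<Longrightarrow> keep s (put j i v s') = keep s s'"
  unfolding keep_def by auto

lemma limit_ge: "v < n \<Longrightarrow> v \<le> limit" "0 \<le> limit" "size \<le> limit"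
  using size_ge unfolding limit_def by simp_all

lemma sum_closed_le: "(\<Sum>v<n. a * length (closed v) + c) \<le> (a + c) * size"
proof -
  have "(\<Sum>v<n. a * length (closed v) + c) = a * (n + length (concat adj)) + n * c"
    by (simp add: sum.distrib sum_length_closed flip: sum_distrib_left)
  then show ?thesis unfolding size_def by (simp add: algebra_simps)
qed

lemma runs_init:
  assumes "base s"
  shows "runs w init_prog s (\<lambda>T s'. T \<le> 15 * size \<and> base s' \<and> keep s s' \<and>
    (\<forall>v<n. arr s' 0 v = (if v \<in> B then 1 else 0)) \<and> (\<forall>v<n. arr s' 1 v = 0))"
proof -
  let ?I = "\<lambda>i s'. keep s s' \<and> (\<forall>v<i. arr s' 0 v = (if v \<in> B then 1 else 0)) \<and> (\<forall>v<i. arr s' 1 v = 0)"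
  have "runs w init_prog s (\<lambda>T s'. T \<le> (\<Sum>v<n. 11 + 2) + 2 \<and> base s' \<and> ?I n s')"
    unfolding init_prog_def
  proof (rule runs_for_vertices[OF assms, where I = ?I])
    fix v s' assume v: "v < n" and s': "base s'" "regs s' 7 = v" "?I v s'"
    have m: "mem s' v = (if v \<in> B then 1 else 0)"
      using s'(1) v input_colour[OF v] L_le unfolding base_def by simp
    show "runs w (Seq (Load 22 7) (Seq (st 0 7 22) (st 1 7 28))) s'
      (\<lambda>T s''. T \<le> 11 \<and> base s'' \<and> regs s'' 7 = v \<and> ?I (Suc v) s'')"
      using v s' limit_ge m by (simp add: runs_simps runs_st less_Suc_eq baseD)
  qed (simp_all add: keep_refl)
  then show ?thesis by (rule runs_mono) (use size_ge in auto)
qed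

definition alive :: "nat list \<Rightarrow> nat \<Rightarrow> bool" where
  "alive p b \<longleftrightarrow> b \<in> B \<and> (\<forall>u\<in>set p. b \<notin> set (closed u))"

definition on_path :: "nat list \<Rightarrow> state \<Rightarrow> bool" where
  "on_path p s \<longleftrightarrow> regs s 5 = length p \<and> length p \<le> k \<and> set p \<subseteq> {..<n} \<and> (\<forall>i<length p. path s i = p ! i)"

lemma on_path_keep: "keep s s' \<Longrightarrow> on_path p s \<Longrightarrow> on_path p s'"
  unfolding on_path_def keep_def by simp

text \<open>Each of the at most \<open>k\<close> path vertices clears its closed neighbourhood,
  whose length is bounded by \<open>size\<close>; this is the source of the factor
  \<open>k + 1\<close> in the time per search node.\<close>

lemma runs_colour:
  assumes s: "base s" "on_path p s" "\<forall>v<n. arr s 0 v = (if v \<in> B then 1 else 0)"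
  shows "runs w colour_prog s (\<lambda>T s'. T \<le> 30 * (k + 1) * size \<and> base s' \<and> keep s s' \<and>
    (\<forall>v<n. arr s' 0 v = (if alive p v then 1 else 0)) \<and> arr s' 1 = arr s 1)"
proof -
  let ?d = "length p"
  let ?t = "9 * size + 13"
  let ?I = "\<lambda>i s'. base s' \<and> keep s s' \<and> regs s' 26 = i \<and> arr s' 1 = arr s 1 \<and>
    (\<forall>v<n. arr s' 0 v = (if alive (take i p) v then 1 else 0))"
  let ?P = "Seq (Add 9 4 26) (Seq (Load 7 9) (Seq (for_closed (st 0 8 28)) (Add 26 26 3)))"
  have d: "?d \<le> k" using s(2) unfolding on_path_def by simp
  have "runs w (WhileLess 26 5 ?P) (set_reg 26 0 s) (\<lambda>T s'. T \<le> (\<Sum>i<?d. ?t + 1) + 1 \<and> ?I ?d s')"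
  proof (rule runs_while_count[where I = ?I])
    fix i s' assume i: "i < ?d" and I: "?I i s'"
    have k26: "keep s s'" "base s'" "regs s' 26 = i" using I by auto
    have p': "on_path p s'" using on_path_keep[OF k26(1) s(2)] .
    define u where "u = p ! i"
    have u: "u < n" using p' i unfolding u_def on_path_def by (auto simp: subset_iff)
    have m: "mem s' (L + i) = u" "regs s' 5 = ?d"
      using p' i d unfolding on_path_def path_def u_def by auto
    have tk: "take (Suc i) p = take i p @ [u]" unfolding u_def using i by (simp add: take_Suc_conv_app_nth)
    have al: "alive (take (Suc i) p) v \<longleftrightarrow> alive (take i p) v \<and> v \<notin> set (closed u)" for v
      unfolding alive_def tk by auto
    have mod: "(L + i) mod 2 ^ w = L + i" "Suc i mod 2 ^ w = Suc i" using i d L_le by simp_all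
    let ?s = "set_reg 7 u (set_reg 9 (L + i) s')"
    let ?J = "\<lambda>xs s''. keep s s'' \<and> regs s'' 26 = i \<and> arr s'' 1 = arr s 1 \<and>
      (\<forall>v<n. arr s'' 0 v = (if alive (take i p) v \<and> v \<notin> set xs then 1 else 0))"
    have "runs w (for_closed (st 0 8 28)) ?s (\<lambda>T s''. T \<le> (5 + 4) * length (closed u) + 10 \<and> base s'' \<and>
        regs s'' 7 = u \<and> ?J (closed u) s'')"
    proof (rule runs_for_closed[where I = ?J])
      fix xs x ys s'' assume x: "x < n" "base s''" "regs s'' 8 = x" "?J xs s''"
      then show "runs w (st 0 8 28) s'' (\<lambda>T s'''. T \<le> 5 \<and> base s''' \<and> ?J (xs @ [x]) s''')"
        using limit_ge by (simp add: runs_st baseD)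
    qed (use I u in auto)
    then have "runs w ?P s' (\<lambda>T s''. T \<le> ?t \<and> ?I (Suc i) s'')"
      unfolding runs_simps(8)[of w "Add _ _ _"] runs_simps(8)[of w "Load _ _"] runs_simps(4,6)
      unfolding runs_simps(8)[of w "for_closed _"] runs_simps(4)
      using k26 m mod
      by (simp add: baseD, elim runs_mono) (use size_ge(2)[OF u] in \<open>simp add: al baseD\<close>)
    then show "regs s' 26 < regs s' 5 \<and> runs w ?P s' (\<lambda>T s''. T \<le> ?t \<and> ?I (Suc i) s'')"
      using i m k26 by simp
  next
    fix s' assume "?I ?d s'"
    then show "\<not> regs s' 26 < regs s' 5" using s(2) unfolding keep_def on_path_def by simp
  qed (use s keep_refl in \<open>auto simp: alive_def\<close>)
  moreover have "Suc ((\<Sum>i<?d. ?t + 1) + 1) \<le> 30 * (k + 1) * size"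
  proof -
    have "1 \<le> size" unfolding size_def by simp
    then have "?t + 1 \<le> 23 * size" by linarith
    then have "?d * (?t + 1) \<le> k * (23 * size)" using d by (rule mult_le_mono[rotated])
    then show ?thesis using \<open>1 \<le> size\<close> by (simp add: algebra_simps)
  qed
  ultimately show ?thesis
    unfolding colour_prog_def runs_simps(8)[of w "Const _ _"] runs_simps(2) mod_0
    by (elim runs_mono) auto
qed

text \<open>The last vertex written for a class stays its representative. Overwriting preserves the
  invariant, which only asks for some member of the class.\<close>

lemma runs_rep:
  assumes s: "base s" "\<forall>v<n. arr s 1 v \<le> limit"
  shows "runs w rep_prog s (\<lambda>T s'. T \<le> 14 * size \<and> base s' \<and> keep s s' \<and> arr s' 0 = arr s 0 \<and> arr s' 1 = arr s 1 \<and>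
    (\<forall>v<n. arr s' 4 (arr s 1 v) < n \<and> arr s 1 (arr s' 4 (arr s 1 v)) = arr s 1 v))"
proof -
  let ?I = "\<lambda>i s'. keep s s' \<and> arr s' 0 = arr s 0 \<and> arr s' 1 = arr s 1 \<and>
    (\<forall>v<i. arr s' 4 (arr s 1 v) < n \<and> arr s 1 (arr s' 4 (arr s 1 v)) = arr s 1 v)"
  have "runs w rep_prog s (\<lambda>T s'. T \<le> (\<Sum>v<n. 10 + 2) + 2 \<and> base s' \<and> ?I n s')"
    unfolding rep_prog_def
  proof (rule runs_for_vertices[OF s(1), where I = ?I])
    fix v s' assume v: "v < n" and s': "base s'" "regs s' 7 = v" "?I v s'"
    show "runs w (Seq (ld 21 1 7) (st 4 21 7)) s' (\<lambda>T s''. T \<le> 10 \<and> base s'' \<and> regs s'' 7 = v \<and> ?I (Suc v) s'')"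
      using v s' limit_ge s(2) by (simp add: runs_simps runs_st runs_ld less_Suc_eq)
  qed (simp_all add: keep_refl)
  then show ?thesis by (rule runs_mono) (use size_ge in auto)
qed

definition reps :: "state \<Rightarrow> nat list \<Rightarrow> nat list" where
  "reps s xs = filter (\<lambda>x. arr s 4 (arr s 1 x) = x) xs"

end

section \<open>Partition refinement by signatures\<close>

context ram_large
begin

definition sig :: "nat list \<Rightarrow> nat \<Rightarrow> nat set" where
  "sig p v = {b. alive p b \<and> v \<in> set (closed b)}"

(* While the closed neighbourhood of b is processed, cl and fr are the classes and the number of
   classes at the start; xs is the part processed so far. *)
definition split_inv :: "state \<Rightarrow> (nat \<Rightarrow> nat) \<Rightarrow> nat \<Rightarrow> nat \<Rightarrow> nat list \<Rightarrow> state \<Rightarrow> bool" where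
  "split_inv s0 cl fr b xs s \<longleftrightarrow> keep s0 s \<and> arr s 0 = arr s0 0 \<and>
    fr \<le> regs s 20 \<and> regs s 20 \<le> fr + length xs \<and>
    (\<forall>v<n. v \<notin> set xs \<longrightarrow> arr s 1 v = cl v) \<and>
    (\<forall>v\<in>set xs. arr s 2 (cl v) = b + 1 \<and> arr s 1 v = arr s 3 (cl v)) \<and>
    (\<forall>c<regs s 20. arr s 2 c \<le> b + 1) \<and>
    (\<forall>c<fr. arr s 2 c = b + 1 \<longrightarrow> fr \<le> arr s 3 c \<and> arr s 3 c < regs s 20) \<and>
    (\<forall>c<fr. \<forall>c'<fr. arr s 2 c = b + 1 \<longrightarrow> arr s 2 c' = b + 1 \<longrightarrow> arr s 3 c = arr s 3 c' \<longrightarrow> c = c')"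

lemma split_inv_set_reg: "r \<notin> {5, 6, 20, 27, 30} \<Longrightarrow> split_inv s0 cl fr b xs (set_reg r a s) = split_inv s0 cl fr b xs s"
  unfolding split_inv_def by simp

lemma split_inv_transfer:
  assumes "split_inv s0 cl fr b xs s" "arr s' 0 = arr s 0" "arr s' 1 = arr s 1" "arr s' 2 = arr s 2"
    "arr s' 3 = arr s 3" "regs s' 20 = regs s 20" "keep s0 s \<longrightarrow> keep s0 s'"
  shows "split_inv s0 cl fr b xs s'"
  using assms unfolding split_inv_def by simp

text \<open>A stale mark means that \<open>x\<close> is the first member of its class met by
  \<open>b\<close>, and a new class is opened; otherwise the class opened before is reused.\<close>

lemma runs_split:
  assumes s: "base s" "regs s 7 = b" "regs s 8 = x" "split_inv s0 cl fr b xs s"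
    and x: "x < n" "b < n" "x \<notin> set xs" "set xs \<subseteq> {..<n}" and cl: "\<forall>v<n. cl v < fr"
    and fr: "regs s 20 < limit"
  shows "runs w split_prog s (\<lambda>T s'. T \<le> 38 \<and> base s' \<and> split_inv s0 cl fr b (xs @ [x]) s')"
proof -
  define c where "c = cl x"
  have c: "arr s 1 x = c" "c < fr" using s(4) x cl unfolding split_inv_def c_def by auto
  have clx: "cl v < fr" if "v \<in> set xs" for v using cl that x(4) by blast
  have lim: "x \<le> limit" "c \<le> limit" "regs s 20 \<le> limit" using x limit_ge c fr s(4) unfolding split_inv_def by auto
  have mod: "Suc b mod 2 ^ w = Suc b" using x L_le(4) by (intro mod_less) linarith
  have mod': "Suc (regs s 20) mod 2 ^ w = Suc (regs s 20)" using fr large by (intro mod_less) linarith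
  have le: "arr s 2 c \<le> Suc b" using s(4) c(2) unfolding split_inv_def by auto
  note I = s(4)[unfolded split_inv_def]
  show ?thesis
  proof (cases "arr s 2 c < Suc b")
    case True
    let ?f = "regs s 20"
    have cf: "c \<noteq> ?f" "fr \<le> ?f" using I c(2) by auto
    have F: "split_inv s0 cl fr b (xs @ [x])
      (put 1 x ?f (set_reg 20 (Suc ?f) (put 2 ?f 0 (put 3 c ?f (put 2 c (Suc b) s)))))"
      unfolding split_inv_def
    proof (intro conjI)
      let ?s = "put 1 x ?f (set_reg 20 (Suc ?f) (put 2 ?f 0 (put 3 c ?f (put 2 c (Suc b) s))))"
      have a1: "arr ?s 1 = (arr s 1)(x := ?f)" by simp
      have a2: "arr ?s 2 = (arr s 2)(c := Suc b, ?f := 0)" by simp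
      have a3: "arr ?s 3 = (arr s 3)(c := ?f)" by simp
      have r: "regs ?s 20 = Suc ?f" by simp
      show "\<forall>v<n. v \<notin> set (xs @ [x]) \<longrightarrow> arr ?s 1 v = cl v" unfolding a1 using I by auto
      show "\<forall>v\<in>set (xs @ [x]). arr ?s 2 (cl v) = b + 1 \<and> arr ?s 1 v = arr ?s 3 (cl v)"
      proof
        fix v assume v: "v \<in> set (xs @ [x])"
        show "arr ?s 2 (cl v) = b + 1 \<and> arr ?s 1 v = arr ?s 3 (cl v)"
        proof (cases "v = x")
          case True
          then show ?thesis unfolding a1 a2 a3 using c(1,2) cf c_def by simp
        next
          case False
          then have "v \<in> set xs" using v by simp
          then have "arr s 2 (cl v) = b + 1" "arr s 1 v = arr s 3 (cl v)" "cl v < fr" using I clx by auto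
          moreover from this have "cl v \<noteq> c" "cl v \<noteq> ?f" using \<open>arr s 2 c < Suc b\<close> cf by auto
          ultimately show ?thesis unfolding a1 a2 a3 using False by simp
        qed
      qed
      show "\<forall>c<regs ?s 20. arr ?s 2 c \<le> b + 1" unfolding a2 r using I by (auto simp: less_Suc_eq)
      show "\<forall>c<fr. arr ?s 2 c = b + 1 \<longrightarrow> fr \<le> arr ?s 3 c \<and> arr ?s 3 c < regs ?s 20"
        unfolding a2 a3 r using I cf by (auto simp: less_Suc_eq)
      show "\<forall>c<fr. \<forall>c'<fr. arr ?s 2 c = b + 1 \<longrightarrow> arr ?s 2 c' = b + 1 \<longrightarrow> arr ?s 3 c = arr ?s 3 c' \<longrightarrow> c = c'"
      proof (intro allI impI)
        fix c1 c2 assume c12: "c1 < fr" "c2 < fr" "arr ?s 2 c1 = b + 1" "arr ?s 2 c2 = b + 1" "arr ?s 3 c1 = arr ?s 3 c2"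
        \<comment> \<open>The new number \<open>?f\<close> exceeds all successors assigned by
          \<open>b\<close> before, which keeps the successor map injective.\<close>
        have old: "arr s 2 d = b + 1 \<and> arr s 3 d < ?f" if "d < fr" "d \<noteq> c" "arr ?s 2 d = b + 1" for d
        proof -
          have "arr s 2 d = b + 1" using that cf unfolding a2 by (simp split: if_splits)
          then show ?thesis using I that(1) by blast
        qed
        show "c1 = c2"
        proof (cases "c1 = c \<or> c2 = c")
          case True
          then show ?thesis using old[of c1] old[of c2] c12 unfolding a3 by (auto split: if_splits)
        next
          case False
          then have "arr s 2 c1 = b + 1" "arr s 2 c2 = b + 1" "arr s 3 c1 = arr s 3 c2"
            using old[of c1] old[of c2] c12 unfolding a3 by auto
          then show ?thesis using I c12(1,2) by blast
        qed
      qed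
    qed (use I in auto)
    show ?thesis
      unfolding split_prog_def using True s(1-3) c lim mod mod' cf(1)
      by (simp add: runs_simps runs_ld runs_st baseD split_inv_set_reg)
        (rule split_inv_transfer[OF F], simp_all)
  next
    case False
    then have eq: "arr s 2 c = Suc b" using le by simp
    have F: "split_inv s0 cl fr b (xs @ [x]) (put 1 x (arr s 3 c) s)"
      unfolding split_inv_def
    proof (intro conjI)
      let ?s = "put 1 x (arr s 3 c) s"
      have a1: "arr ?s 1 = (arr s 1)(x := arr s 3 c)" by simp
      show "\<forall>v<n. v \<notin> set (xs @ [x]) \<longrightarrow> arr ?s 1 v = cl v" unfolding a1 using I by auto
      show "\<forall>v\<in>set (xs @ [x]). arr ?s 2 (cl v) = b + 1 \<and> arr ?s 1 v = arr ?s 3 (cl v)"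
        unfolding a1 using I eq c_def x(3) by auto
    qed (use I in auto)
    show ?thesis
      unfolding split_prog_def using False s(1-3) c lim mod
      by (simp add: runs_simps runs_ld runs_st baseD split_inv_set_reg)
        (rule split_inv_transfer[OF F], simp_all)
  qed
qed

text \<open>Classes are the sets of equal signature below \<open>i\<close>. Numbers are never
  reused, even when a class becomes empty, so they are bounded by the total length of the lists
  scanned rather than by \<open>n\<close>.\<close>

definition refine_inv :: "state \<Rightarrow> nat list \<Rightarrow> nat \<Rightarrow> state \<Rightarrow> bool" where
  "refine_inv s0 p i s \<longleftrightarrow> keep s0 s \<and> arr s 0 = arr s0 0 \<and>
    1 \<le> regs s 20 \<and> regs s 20 \<le> 1 + (\<Sum>v<i. length (closed v)) \<and>
    (\<forall>v<n. arr s 1 v < regs s 20) \<and> (\<forall>c<regs s 20. arr s 2 c \<le> i) \<and>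
    (\<forall>u<n. \<forall>v<n. arr s 1 u = arr s 1 v \<longleftrightarrow> sig p u \<inter> {..<i} = sig p v \<inter> {..<i})"

text \<open>Vertices moved by \<open>b\<close> have class numbers from \<open>regs s 20\<close> on
  and the others smaller ones, which separates the two kinds. Among the moved vertices the injective
  successor map preserves the old partition.\<close>

lemma refine_inv_split:
  assumes s: "refine_inv s0 p b s" and b: "b < n" "alive p b"
    and s': "split_inv s0 (arr s 1) (regs s 20) b (closed b) s'"
  shows "refine_inv s0 p (Suc b) s'"
proof -
  define cl where "cl = arr s 1"
  define fr where "fr = regs s 20"
  note I = s'[folded cl_def fr_def, unfolded split_inv_def]
  note R = s[unfolded refine_inv_def, folded cl_def fr_def]
  have sub: "u < n" if "u \<in> set (closed b)" for u using closed(2)[OF b(1)] that by auto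
  have new: "fr \<le> arr s' 1 v \<and> arr s' 1 v < regs s' 20" if "v \<in> set (closed b)" for v
    using I R sub[OF that] that by simp
  have old: "arr s' 1 v = cl v \<and> cl v < fr" if "v < n" "v \<notin> set (closed b)" for v
    using I R that by simp
  have Suc: "sig p v \<inter> {..<Suc b} = (if v \<in> set (closed b) then insert b (sig p v \<inter> {..<b}) else sig p v \<inter> {..<b})" for v
    using b(2) unfolding sig_def by (auto simp: less_Suc_eq)
  have nb: "b \<notin> sig p v \<inter> {..<b}" for v by simp
  have "arr s' 1 u = arr s' 1 v \<longleftrightarrow> sig p u \<inter> {..<Suc b} = sig p v \<inter> {..<Suc b}" if "u < n" "v < n" for u v
  proof -
    have R': "cl u = cl v \<longleftrightarrow> sig p u \<inter> {..<b} = sig p v \<inter> {..<b}" using R that by blast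
    consider "u \<in> set (closed b)" "v \<in> set (closed b)" | "u \<in> set (closed b)" "v \<notin> set (closed b)"
      | "u \<notin> set (closed b)" "v \<in> set (closed b)" | "u \<notin> set (closed b)" "v \<notin> set (closed b)" by blast
    then show ?thesis
    proof cases
      case 1
      then have e: "arr s' 2 (cl u) = b + 1" "arr s' 2 (cl v) = b + 1" "arr s' 1 u = arr s' 3 (cl u)" "arr s' 1 v = arr s' 3 (cl v)"
        using I by blast+
      have lt: "cl u < fr" "cl v < fr" using R that by blast+
      have inj: "arr s' 3 c = arr s' 3 c' \<longrightarrow> c = c'" if "c < fr" "c' < fr" "arr s' 2 c = b + 1" "arr s' 2 c' = b + 1" for c c'
        using I that by blast
      have "arr s' 1 u = arr s' 1 v \<longleftrightarrow> cl u = cl v" using inj[OF lt e(1,2)] e(3,4) by auto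
      moreover have "sig p u \<inter> {..<Suc b} = sig p v \<inter> {..<Suc b} \<longleftrightarrow> sig p u \<inter> {..<b} = sig p v \<inter> {..<b}"
        using Suc[of u] Suc[of v] nb[of u] nb[of v] 1 insert_ident[of b] by simp
      ultimately show ?thesis using R' by simp
    next
      case 2
      then have "arr s' 1 u \<noteq> arr s' 1 v" using new[of u] old[of v] that by fastforce
      moreover have "b \<in> sig p u \<inter> {..<Suc b}" "b \<notin> sig p v \<inter> {..<Suc b}" using 2 Suc[of u] Suc[of v] nb by auto
      ultimately show ?thesis by metis
    next
      case 3
      then have "arr s' 1 u \<noteq> arr s' 1 v" using new[of v] old[of u] that by fastforce
      moreover have "b \<notin> sig p u \<inter> {..<Suc b}" "b \<in> sig p v \<inter> {..<Suc b}" using 3 Suc[of u] Suc[of v] nb by auto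
      ultimately show ?thesis by metis
    next
      case 4
      then show ?thesis using old[of u] old[of v] that R' Suc[of u] Suc[of v] by simp
    qed
  qed
  moreover have "arr s' 1 v < regs s' 20" if "v < n" for v
    using new[of v] old[OF that] I by fastforce
  moreover have "keep s0 s'" "arr s' 0 = arr s0 0" "fr \<le> regs s' 20" "regs s' 20 \<le> fr + length (closed b)"
    "\<forall>c<regs s' 20. arr s' 2 c \<le> Suc b" using I by auto
  ultimately show ?thesis unfolding refine_inv_def using R by auto
qed

lemma runs_refine:
  assumes s: "base s" "\<forall>v<n. arr s 0 v = (if alive p v then 1 else 0)" "\<forall>v<n. arr s 1 v = 0"
  shows "runs w refine_prog s (\<lambda>T s'. T \<le> 70 * size \<and> base s' \<and> keep s s' \<and> arr s' 0 = arr s 0 \<and>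
    (\<forall>v<n. arr s' 1 v \<le> limit) \<and>
    (\<forall>u<n. \<forall>v<n. arr s' 1 u = arr s' 1 v \<longleftrightarrow> sig p u = sig p v))"
proof -
  have sums: "1 + (\<Sum>v<i. length (closed v)) \<le> size" if "i \<le> n" for i
  proof -
    have "(\<Sum>v<i. length (closed v)) \<le> (\<Sum>v<n. length (closed v))" using that by (intro sum_mono2) auto
    then show ?thesis unfolding size_def sum_length_closed by simp
  qed
  define s1 where "s1 = put 2 0 0 (set_reg 9 (Q + 2) (set_reg 20 1 s))"
  have s1: "base s1" "refine_inv s p 0 s1"
    using s unfolding s1_def refine_inv_def by (simp_all add: keep_refl)
  have "runs w (for_vertices (Seq (ld 22 0 7) (IfLess 28 22 (for_closed split_prog) Skip))) s1
    (\<lambda>T s'. T \<le> (\<Sum>v<n. (42 * length (closed v) + 16) + 2) + 2 \<and> base s' \<and> refine_inv s p n s')"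
  proof (rule runs_for_vertices[where I = "refine_inv s p", OF s1])
    fix b s' assume b: "b < n" and s': "base s'" "regs s' 7 = b" "refine_inv s p b s'"
    have a0: "arr s' 0 b = (if alive p b then 1 else 0)" using s'(3) s(2) b unfolding refine_inv_def by simp
    show "runs w (Seq (ld 22 0 7) (IfLess 28 22 (for_closed split_prog) Skip)) s'
      (\<lambda>T s''. T \<le> 42 * length (closed b) + 16 \<and> base s'' \<and> regs s'' 7 = b \<and> refine_inv s p (Suc b) s'')"
    proof (cases "alive p b")
      case True
      let ?s = "set_reg 22 1 (set_reg 9 (Q + 8 * b) s')"
      have "runs w (for_closed split_prog) ?s (\<lambda>T s''. T \<le> (38 + 4) * length (closed b) + 10 \<and> base s'' \<and>
        regs s'' 7 = b \<and> split_inv s (arr s' 1) (regs s' 20) b (closed b) s'')"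
      proof (rule runs_for_closed[where I = "split_inv s (arr s' 1) (regs s' 20) b"])
        show "split_inv s (arr s' 1) (regs s' 20) b [] ?s"
          using s'(3) unfolding split_inv_def refine_inv_def by (auto simp: le_Suc_eq)
        fix xs x ys s'' assume cl: "closed b = xs @ x # ys" and x: "x < n" "base s''" "regs s'' 7 = b" "regs s'' 8 = x"
          "split_inv s (arr s' 1) (regs s' 20) b xs s''"
        have sub: "set xs \<subseteq> {..<n}" "x \<notin> set xs" using closed(1,2)[OF b] unfolding cl by auto
        have "regs s'' 20 \<le> regs s' 20 + length xs" using x(5) unfolding split_inv_def by blast
        also have "\<dots> < regs s' 20 + length (closed b)" unfolding cl by simp
        also have "\<dots> \<le> 1 + (\<Sum>v<Suc b. length (closed v))" using s'(3) unfolding refine_inv_def by simp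
        also have "\<dots> \<le> limit" using sums[of "Suc b"] b limit_ge(3) by linarith
        finally have "regs s'' 20 < limit" .
        moreover have "\<forall>v<n. arr s' 1 v < regs s' 20" using s'(3) unfolding refine_inv_def by blast
        ultimately show "runs w split_prog s'' (\<lambda>T s'''. T \<le> 38 \<and> base s''' \<and>
            split_inv s (arr s' 1) (regs s' 20) b (xs @ [x]) s''')"
          using x b sub by (intro runs_split) auto
      qed (use s' b in \<open>auto simp: split_inv_set_reg split_prog_def\<close>)
      then have "runs w (for_closed split_prog) ?s (\<lambda>T s''. T \<le> 42 * length (closed b) + 10 \<and> base s'' \<and>
          regs s'' 7 = b \<and> refine_inv s p (Suc b) s'')"
        by (rule runs_mono) (use refine_inv_split[OF s'(3) b True] in auto)
      then show ?thesis
        using s' b a0 True limit_ge(1)[OF b]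
        by (simp add: runs_simps(8,9) runs_ld baseD, elim runs_mono) simp
    next
      case False
      \<comment> \<open>A vertex that is not alive belongs to no signature, so it may be
        skipped.\<close>
      have "sig p v \<inter> {..<Suc b} = sig p v \<inter> {..<b}" for v using False unfolding sig_def by (auto simp: less_Suc_eq)
      moreover have "regs s' 20 \<le> 1 + (\<Sum>v<Suc b. length (closed v))" "\<forall>c<regs s' 20. arr s' 2 c \<le> Suc b"
        using s'(3) unfolding refine_inv_def by auto
      ultimately have "refine_inv s p (Suc b) s'" using s'(3) unfolding refine_inv_def by metis
      then show ?thesis
        using s' b a0 False limit_ge(1)[OF b]
        by (simp add: runs_simps runs_ld baseD) (simp add: refine_inv_def)
    qed
  next
    show "refine_inv s p i (set_reg 7 a s') = refine_inv s p i s'" for i a s'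
      unfolding refine_inv_def by simp
  qed
  moreover have "(\<Sum>v<n. (42 * length (closed v) + 16) + 2) + 2 + 6 \<le> 70 * size"
  proof -
    have eq: "(42 * x + 16) + 2 = 42 * x + (18::nat)" for x by simp
    have "(\<Sum>v<n. 42 * length (closed v) + 18) \<le> 60 * size" using sum_closed_le[of 42 18] by simp
    then show ?thesis unfolding eq using size_ge(1) by linarith
  qed
  moreover have "runs w refine_prog s P = runs w (for_vertices (Seq (ld 22 0 7) (IfLess 28 22 (for_closed split_prog) Skip))) s1
    (\<lambda>T. P (6 + T))" for P
    unfolding refine_prog_def runs_simps(8)[of w "Const _ _"] runs_simps(8)[of w "st _ _ _"] runs_simps(2) s1_def
    using s(1) w_nonzero by (simp add: runs_st baseD)
  moreover have "sig p v \<inter> {..<n} = sig p v" for v unfolding sig_def alive_def using B by auto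
  moreover have "arr s' 1 v \<le> limit" if "refine_inv s p n s'" "v < n" for s' v
  proof -
    have "arr s' 1 v < regs s' 20" "regs s' 20 \<le> 1 + (\<Sum>v<n. length (closed v))"
      using that unfolding refine_inv_def by blast+
    then show ?thesis using sums[of n] limit_ge(3) by linarith
  qed
  moreover have "keep s s' \<and> arr s' 0 = arr s 0 \<and>
      (\<forall>u<n. \<forall>v<n. arr s' 1 u = arr s' 1 v \<longleftrightarrow> sig p u \<inter> {..<n} = sig p v \<inter> {..<n})"
    if "refine_inv s p n s'" for s'
    using that unfolding refine_inv_def by blast
  ultimately show ?thesis
    by (simp, elim runs_mono) auto
qed

end

lemma runs_SeqI:
  "runs w P s Q1 \<Longrightarrow> (\<And>T s'. Q1 T s' \<Longrightarrow> runs w R s' (\<lambda>T'. Q (T + T'))) \<Longrightarrow> runs w (Seq P R) s Q"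
  unfolding runs_simps by (rule runs_mono)

section \<open>Choice of the branching vertex and the stack\<close>

context ram_large
begin

definition candidates :: "state \<Rightarrow> nat \<Rightarrow> nat list" where
  "candidates s b = reps s (closed b)"

lemma length_candidates: "b < n \<Longrightarrow> length (candidates s b) \<le> n"
  using length_closed_le[of b] length_filter_le[of _ "closed b"]
  unfolding candidates_def reps_def by (meson le_trans)

lemma reps_snoc:
  "reps s (xs @ [x]) = (if arr s 4 (arr s 1 x) = x then reps s xs @ [x] else reps s xs)"
  unfolding reps_def by simp

lemma runs_count:
  assumes s: "base s" "regs s 7 = b" "b < n" "regs s 25 = 0" "\<forall>v<n. arr s 1 v \<le> limit"
  shows "runs w (for_closed (if_rep (Add 25 25 3))) s (\<lambda>T s'. T \<le> 17 * length (closed b) + 10 \<and> base s' \<and>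
    regs s' 7 = b \<and> keep s s' \<and> arr s' = arr s \<and> regs s' 23 = regs s 23 \<and> regs s' 24 = regs s 24 \<and>
    regs s' 25 = length (candidates s b))"
proof -
  let ?I = "\<lambda>xs s'. keep s s' \<and> arr s' = arr s \<and> regs s' 23 = regs s 23 \<and> regs s' 24 = regs s 24 \<and>
    regs s' 25 = length (reps s xs) \<and> length xs \<le> n"
  have "runs w (for_closed (if_rep (Add 25 25 3))) s (\<lambda>T s'. T \<le> (13 + 4) * length (closed b) + 10 \<and> base s' \<and>
    regs s' 7 = b \<and> ?I (closed b) s')"
  proof (rule runs_for_closed[where I = ?I])
    fix xs x ys s' assume cl: "closed b = xs @ x # ys" and x: "x < n" and s': "base s'" "regs s' 7 = b" "regs s' 8 = x" "?I xs s'"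
    have len: "length (xs @ [x]) \<le> n" using length_closed_le[OF s(3)] unfolding cl by simp
    have "length (reps s xs) \<le> length xs" unfolding reps_def by simp
    then have mod: "Suc (length (reps s xs)) mod 2 ^ w = Suc (length (reps s xs))"
      using len L_le(4) by (intro mod_less) simp
    have lim: "x \<le> limit" "arr s 1 x \<le> limit" using x limit_ge s(5) by auto
    show "runs w (if_rep (Add 25 25 3)) s' (\<lambda>T s''. T \<le> 13 \<and> base s'' \<and> ?I (xs @ [x]) s'')"
    proof (cases "arr s 4 (arr s 1 x) = x")
      case True
      then show ?thesis using s' lim len mod unfolding if_rep_def reps_snoc
        by (simp add: runs_simps runs_ld baseD)
    next
      case False
      then show ?thesis using s' lim len unfolding if_rep_def reps_snoc
        by (simp add: runs_simps runs_ld baseD)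
    qed
  qed (use s in \<open>auto simp: reps_def keep_refl if_rep_def\<close>)
  then show ?thesis by (rule runs_mono) (simp add: candidates_def)
qed

lemma runs_best:
  assumes s: "base s" "\<forall>v<n. arr s 1 v \<le> limit"
  shows "runs w best_prog s (\<lambda>T s'. T \<le> 50 * size \<and> base s' \<and> keep s s' \<and> arr s' = arr s \<and>
    (regs s' 23 = n + 1 \<and> (\<forall>b<n. arr s 0 b = 0) \<or>
     regs s' 24 < n \<and> arr s 0 (regs s' 24) \<noteq> 0 \<and> regs s' 23 \<le> n \<and>
     (\<forall>b<n. arr s 0 b \<noteq> 0 \<longrightarrow> length (candidates s (regs s' 24)) \<le> length (candidates s b))))"
proof -
  let ?I = "\<lambda>i s'. keep s s' \<and> arr s' = arr s \<and>
    (regs s' 23 = n + 1 \<and> (\<forall>b<i. arr s 0 b = 0) \<or>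
     regs s' 24 < n \<and> arr s 0 (regs s' 24) \<noteq> 0 \<and> regs s' 23 = length (candidates s (regs s' 24)) \<and>
     (\<forall>b<i. arr s 0 b \<noteq> 0 \<longrightarrow> length (candidates s (regs s' 24)) \<le> length (candidates s b)))"
  let ?C = "Seq (Const 25 0) (Seq (for_closed (if_rep (Add 25 25 3))) (IfLess 25 23 (Seq (Copy 23 25) (Copy 24 7)) Skip))"
  let ?s = "set_reg 23 (n + 1) s"
  have "runs w (for_vertices (Seq (ld 22 0 7) (IfLess 28 22 ?C Skip))) ?s
    (\<lambda>T s'. T \<le> (\<Sum>v<n. (17 * length (closed v) + 20) + 2) + 2 \<and> base s' \<and> ?I n s')"
  proof (rule runs_for_vertices[where I = ?I])
    fix b s' assume b: "b < n" and s': "base s'" "regs s' 7 = b" "?I b s'"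
    have a: "arr s' = arr s" "keep s s'" using s'(3) by auto
    show "runs w (Seq (ld 22 0 7) (IfLess 28 22 ?C Skip)) s'
      (\<lambda>T s''. T \<le> 17 * length (closed b) + 20 \<and> base s'' \<and> regs s'' 7 = b \<and> ?I (Suc b) s'')"
    proof (cases "arr s 0 b = 0")
      case True
      then show ?thesis using s' b limit_ge(1)[OF b] by (simp add: runs_simps runs_ld baseD) (auto simp: less_Suc_eq)
    next
      case False
      let ?s = "set_reg 25 0 (set_reg 22 (arr s 0 b) (set_reg 9 (Q + 8 * b) s'))"
      have "runs w (Seq (for_closed (if_rep (Add 25 25 3))) (IfLess 25 23 (Seq (Copy 23 25) (Copy 24 7)) Skip)) ?s
        (\<lambda>T s''. T \<le> 17 * length (closed b) + 13 \<and> base s'' \<and> regs s'' 7 = b \<and> ?I (Suc b) s'')"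
      proof (rule runs_SeqI[OF runs_count[of ?s b]])
        fix T s'' assume "T \<le> 17 * length (closed b) + 10 \<and> base s'' \<and> regs s'' 7 = b \<and> keep ?s s'' \<and> arr s'' = arr ?s \<and>
          regs s'' 23 = regs ?s 23 \<and> regs s'' 24 = regs ?s 24 \<and> regs s'' 25 = length (candidates ?s b)"
        moreover have "candidates ?s b = candidates s b" unfolding candidates_def reps_def using a by simp
        ultimately have s'': "T \<le> 17 * length (closed b) + 10" "base s''" "regs s'' 7 = b" "keep s s''" "arr s'' = arr s"
          "regs s'' 23 = regs s' 23" "regs s'' 24 = regs s' 24" "regs s'' 25 = length (candidates s b)"
          using a keep_trans[of s ?s s''] by auto
        have le: "length (candidates s b) < n + 1" using length_candidates[OF b, of s] by simp
        show "runs w (IfLess 25 23 (Seq (Copy 23 25) (Copy 24 7)) Skip) s''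
          (\<lambda>T'. (\<lambda>T s''. T \<le> 17 * length (closed b) + 13 \<and> base s'' \<and> regs s'' 7 = b \<and> ?I (Suc b) s'') (T + T'))"
        proof (cases "regs s' 23 = n + 1 \<and> (\<forall>c<b. arr s 0 c = 0)")
          case True
          then show ?thesis using s'' le b False by (simp add: runs_simps less_Suc_eq)
        next
          case no: False
          then have *: "regs s' 24 < n" "arr s 0 (regs s' 24) \<noteq> 0" "regs s' 23 = length (candidates s (regs s' 24))"
            "\<forall>c<b. arr s 0 c \<noteq> 0 \<longrightarrow> length (candidates s (regs s' 24)) \<le> length (candidates s c)"
            using s'(3) by blast+
          show ?thesis
          proof (cases "length (candidates s b) < length (candidates s (regs s' 24))")
            case True
            then have "\<forall>c<b. arr s 0 c \<noteq> 0 \<longrightarrow> length (candidates s b) \<le> length (candidates s c)"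
              using *(4) by (meson less_imp_le less_le_trans)
            then show ?thesis using s'' True * b False by (simp add: runs_simps less_Suc_eq)
          next
            case ge: False
            then show ?thesis using s'' * b by (auto simp: runs_simps less_Suc_eq)
          qed
        qed
      qed (use s' b a s(2) in auto)
      then show ?thesis
        using s' b a False limit_ge(1)[OF b]
        unfolding runs_simps(8)[of w "ld _ _ _"] runs_simps(8)[of w "Const _ _"] runs_simps(9) runs_simps(1,2)
        by (simp add: runs_ld baseD, elim runs_mono) simp
    qed
  next
    show "?I i (set_reg 7 a s') = ?I i s'" for i a s' by simp
  qed (use s in \<open>simp_all add: keep_refl\<close>)
  moreover have "(\<Sum>v<n. (17 * length (closed v) + 20) + 2) + 2 + 1 \<le> 50 * size"
  proof -
    have eq: "(17 * x + 20) + 2 = 17 * x + (22::nat)" for x by simp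
    have "(\<Sum>v<n. 17 * length (closed v) + 22) \<le> 39 * size" using sum_closed_le[of 17 22] by simp
    then show ?thesis unfolding eq using size_ge(1) by (simp add: size_def)
  qed
  moreover have "runs w best_prog s P = runs w (for_vertices (Seq (ld 22 0 7) (IfLess 28 22 ?C Skip))) ?s (\<lambda>T. P (Suc T))" for P
    unfolding best_prog_def runs_simps(8)[of w "Add _ _ _"] runs_simps(4)
    using s L_le(4) large by (simp add: baseD L_def Q_def)
  ultimately show ?thesis
    by (simp, elim runs_mono) (auto dest: length_candidates[of _ s])
qed

definition stack :: "state \<Rightarrow> (nat \<times> nat) list" where
  "stack s = map (\<lambda>i. (arr s 5 i, arr s 6 i)) [0..<regs s 6]"

definition path_list :: "state \<Rightarrow> nat list" where
  "path_list s = map (path s) [0..<regs s 5]"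

lemma stack_push:
  "regs s' 6 = Suc (regs s 6) \<Longrightarrow> arr s' 5 = (arr s 5)(regs s 6 := d) \<Longrightarrow> arr s' 6 = (arr s 6)(regs s 6 := v) \<Longrightarrow>
    stack s' = stack s @ [(d, v)]"
  unfolding stack_def by simp

lemma length_stack [simp]: "length (stack s) = regs s 6"
  unfolding stack_def by simp

lemma runs_push:
  assumes s: "base s" "regs s 24 = b" "b < n" "\<forall>v<n. arr s 1 v \<le> limit" "regs s 6 + n \<le> limit"
  shows "runs w push_prog s (\<lambda>T s'. T \<le> 40 * size \<and> base s' \<and> path s' = path s \<and>
    (\<forall>r\<in>{5, 27, 30}. regs s' r = regs s r) \<and>
    stack s' = stack s @ map (Pair (regs s 5)) (candidates s b))"
proof -
  let ?I = "\<lambda>xs s'. path s' = path s \<and> regs s' 5 = regs s 5 \<and> regs s' 27 = regs s 27 \<and> regs s' 30 = regs s 30 \<and>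
    arr s' 1 = arr s 1 \<and> arr s' 4 = arr s 4 \<and> stack s' = stack s @ map (Pair (regs s 5)) (reps s xs)"
  let ?P = "if_rep (Seq (st 5 6 5) (Seq (st 6 6 8) (Add 6 6 3)))"
  have st_reg: "stack (set_reg r a s') = stack s'" if "r \<noteq> 6" for r a s'
    using that unfolding stack_def by simp
  have "runs w (for_closed ?P) (set_reg 7 b s) (\<lambda>T s'. T \<le> (23 + 4) * length (closed b) + 10 \<and> base s' \<and>
    regs s' 7 = b \<and> ?I (closed b) s')"
  proof (rule runs_for_closed[where I = ?I])
    fix xs x ys s' assume cl: "closed b = xs @ x # ys" and x: "x < n" and s': "base s'" "regs s' 7 = b" "regs s' 8 = x" "?I xs s'"
    have "length (reps s xs) \<le> length xs" unfolding reps_def by simp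
    also have "\<dots> < n" using length_closed_le[OF s(3)] unfolding cl by simp
    finally have len: "length (reps s xs) < n" .
    have "length (stack s') = length (stack s) + length (reps s xs)" using s'(4) by simp
    then have lt: "regs s' 6 < limit" using len s(5) by simp
    then have mod: "Suc (regs s' 6) mod 2 ^ w = Suc (regs s' 6)" using large by (intro mod_less) linarith
    have lim: "x \<le> limit" "arr s 1 x \<le> limit" "regs s' 6 \<le> limit" using x limit_ge s(4) lt by auto
    show "runs w ?P s' (\<lambda>T s''. T \<le> 23 \<and> base s'' \<and> ?I (xs @ [x]) s'')"
    proof (cases "arr s 4 (arr s 1 x) = x")
      case True
      let ?d = "regs s 5" and ?n = "regs s' 6"
      have "runs w ?P s' (\<lambda>T s''. T = 23 \<and> base s'' \<and> path s'' = path s \<and> regs s'' 5 = regs s 5 \<and>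
        regs s'' 27 = regs s 27 \<and> regs s'' 30 = regs s 30 \<and> arr s'' 1 = arr s 1 \<and> arr s'' 4 = arr s 4 \<and>
        regs s'' 6 = Suc ?n \<and> arr s'' 5 = (arr s' 5)(?n := ?d) \<and> arr s'' 6 = (arr s' 6)(?n := x))"
        using True s' lim mod unfolding if_rep_def by (simp add: runs_simps runs_ld runs_st baseD)
      then show ?thesis
        by (rule runs_mono) (use s'(4) True in \<open>auto simp: reps_snoc dest!: stack_push\<close>)
    next
      case False
      then show ?thesis using s' lim unfolding if_rep_def reps_snoc
        by (simp add: runs_simps runs_ld baseD st_reg)
    qed
  next
    show "?I xs (set_reg r a s') = ?I xs s'" if "r \<in> {8, 9, 18, 19}" for xs r a s'
      using that by (auto simp: st_reg)
  qed (use s in \<open>auto simp: reps_def if_rep_def st_reg\<close>)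
  moreover have "27 * length (closed b) + 10 + 1 \<le> 40 * size" using size_ge(1) size_ge(2)[OF s(3)] by linarith
  ultimately show ?thesis
    unfolding push_prog_def runs_simps(8)[of w "Copy _ _"] runs_simps(3) s(2)
    by (elim runs_mono) (auto simp: candidates_def)
qed

lemma runs_pop_empty:
  "base s \<Longrightarrow> stack s = [] \<Longrightarrow> runs w pop_prog s (\<lambda>T s'. T = 2 \<and> s' = set_reg 27 1 s)"
  using w_nonzero unfolding pop_prog_def stack_def by (simp add: runs_simps baseD)

text \<open>Only the path cell at depth \<open>d\<close> is written: the cells below it are kept,
  and the new length \<open>Suc d\<close> cuts off the rest.\<close>

lemma runs_pop:
  assumes s: "base s" "stack s = st' @ [(d, v)]" "d < k" "regs s 6 \<le> limit"
  shows "runs w pop_prog s (\<lambda>T s'. T \<le> 20 \<and> base s' \<and> stack s' = st' \<and> regs s' 5 = Suc d \<and>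
    path s' = (path s)(d := v) \<and> (\<forall>r\<in>{27, 30}. regs s' r = regs s r))"
proof -
  have sp: "regs s 6 = Suc (length st')" using arg_cong[OF s(2), of length] by simp
  have "stack s = map (\<lambda>i. (arr s 5 i, arr s 6 i)) [0..<length st'] @ [(arr s 5 (length st'), arr s 6 (length st'))]"
    unfolding stack_def sp by simp
  then have st: "map (\<lambda>i. (arr s 5 i, arr s 6 i)) [0..<length st'] = st'"
    "arr s 5 (length st') = d" "arr s 6 (length st') = v" using s(2) by auto
  have mod: "(L + d) mod 2 ^ w = L + d" "Suc d mod 2 ^ w = Suc d" using s(3) L_le(9) by simp_all
  let ?l = "length st'"
  let ?s1 = "set_reg 9 (L + d) (set_reg 22 v (set_reg 9 (Q + 8 * ?l + 6) (set_reg 5 d (set_reg 9 (Q + 8 * ?l + 5) (set_reg 6 ?l s)))))"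
  have "runs w pop_prog s (\<lambda>T s'. T \<le> 20 \<and> s' = set_reg 5 (Suc d) (put_path d v ?s1))"
    unfolding pop_prog_def using s(1,3,4) sp st(2,3) mod
    by (simp add: runs_simps runs_ld baseD) (simp add: put_path_def)
  then show ?thesis
    by (rule runs_mono) (use s(1,3) st(1) in \<open>simp add: stack_def\<close>)
qed

end

section \<open>Correctness of the search\<close>

text \<open>Everything is recomputed from the path at each search node, so backtracking has nothing
  else to restore.\<close>

definition analyse_prog :: com where
  "analyse_prog = Seq init_prog (Seq colour_prog (Seq refine_prog (Seq rep_prog best_prog)))"

definition step_prog :: com where
  "step_prog = Seq analyse_prog (Seq (Add 29 0 3) (IfLess 23 29 (Seq (IfLess 5 1 push_prog Skip) pop_prog)
    (Seq (Const 30 1) (Const 27 1))))"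

definition setup_prog :: com where
  "setup_prog = Seq (Const 3 1) (Seq (Add 4 0 0) (Seq (Load 4 4) (Seq (Add 10 4 1) (Seq (Add 11 10 3)
    (Seq (Add 12 11 3) (Seq (Add 13 12 3) (Seq (Add 14 13 3) (Seq (Add 15 14 3) (Add 16 15 3)))))))))"

definition finish_prog :: com where
  "finish_prog = IfLess 28 30 (Seq (Copy 1 4) (Seq (Copy 2 5) (Const 0 1))) (Const 0 0)"

definition search_prog :: com where
  "search_prog = Seq setup_prog (Seq (WhileLess 27 3 step_prog) finish_prog)"

(* Size of the tree of depth r in which every inner vertex has D children. *)
fun nodes :: "nat \<Rightarrow> nat \<Rightarrow> nat" where
  "nodes D 0 = 1"
| "nodes D (Suc r) = 1 + D * nodes D r"

text \<open>The interface to the graph theory. \<open>few\<close> speaks of all sets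
  \<open>A\<close> because the set of undominated black vertices changes along the search.\<close>

locale ram_search = ram_large +
  fixes D :: nat
  assumes few: "\<And>A. A \<subseteq> {..<n} \<Longrightarrow> A \<noteq> {} \<Longrightarrow>
    \<exists>b\<in>A. card {S \<in> (\<lambda>v. {b \<in> A. v \<in> set (closed b)}) ` {..<n}. b \<in> S} \<le> D"
begin

definition solves :: "nat set \<Rightarrow> bool" where
  "solves U \<longleftrightarrow> U \<subseteq> {..<n} \<and> card U \<le> k \<and> (\<forall>v\<in>B. \<exists>u\<in>U. v \<in> set (closed u))"

definition extends :: "nat list \<Rightarrow> bool" where
  "extends p \<longleftrightarrow> (\<exists>U. solves U \<and> set p \<subseteq> U)"

lemma solves_path:
  "distinct p \<Longrightarrow> set p \<subseteq> {..<n} \<Longrightarrow> length p \<le> k \<Longrightarrow> \<forall>b. \<not> alive p b \<Longrightarrow> solves (set p)"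
  unfolding solves_def alive_def by (auto simp: distinct_card)

text \<open>A solution containing \<open>k\<close> distinct path vertices consists of them alone,
  but they leave \<open>b\<close> undominated.\<close>

lemma not_extends_full:
  assumes "distinct p" "length p = k" "alive p b"
  shows "\<not> extends p"
proof
  assume "extends p"
  then obtain U where U: "solves U" "set p \<subseteq> U" unfolding extends_def by blast
  have fin: "finite U" using U(1) finite_subset unfolding solves_def by blast
  have "card U \<le> card (set p)" using U(1) assms unfolding solves_def by (simp add: distinct_card)
  then have "set p = U" using card_seteq[OF fin U(2)] by simp
  then show False using U(1) assms(3) unfolding solves_def alive_def by blast
qed

lemma closed_self: "b \<in> set (closed b)"
  unfolding closed_def by simp

text \<open>Exchange argument: some \<open>x\<close> in the solution dominates \<open>b\<close>, and
  \<open>x\<close> is not on the path because \<open>b\<close> is alive. Replacing \<open>x\<close>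
  by \<open>y\<close> of equal signature keeps all alive vertices dominated, and the others are
  dominated by the path, which is untouched.\<close>

lemma extends_branch:
  assumes p: "extends p" "alive p b"
    and cover: "\<forall>x\<in>set (closed b). \<exists>y\<in>C. sig p y = sig p x" and C: "C \<subseteq> {..<n}"
  shows "\<exists>y\<in>C. extends (p @ [y])"
proof -
  obtain U where U: "solves U" "set p \<subseteq> U" using p(1) unfolding extends_def by blast
  have Un: "U \<subseteq> {..<n}" "card U \<le> k" "finite U"
    using U(1) finite_subset[of U "{..<n}"] unfolding solves_def by auto
  have b: "b \<in> B" "b < n" using p(2) B unfolding alive_def by auto
  obtain x where x: "x \<in> U" "b \<in> set (closed x)" using U(1) b(1) unfolding solves_def by blast
  have xn: "x < n" using x Un by auto
  have xp: "x \<notin> set p" using x(2) p(2) unfolding alive_def by blast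
  have "x \<in> set (closed b)" using closed_sym[OF xn b(2)] x(2) by blast
  then obtain y where y: "y \<in> C" "sig p y = sig p x" using cover by blast
  have yn: "y < n" using y C by auto
  define U' where "U' = insert y (U - {x})"
  have "card U' \<le> Suc (card (U - {x}))" unfolding U'_def by (rule card_insert_le_m1) simp_all
  also have "\<dots> = card U" by (rule card.remove[OF Un(3) x(1), symmetric])
  finally have "card U' \<le> k" using Un(2) by simp
  moreover have "U' \<subseteq> {..<n}" unfolding U'_def using Un yn by auto
  moreover have "\<exists>u\<in>U'. v \<in> set (closed u)" if v: "v \<in> B" for v
  proof (cases "alive p v")
    case False
    then obtain u where "u \<in> set p" "v \<in> set (closed u)" using v unfolding alive_def by blast
    then show ?thesis using U(2) xp unfolding U'_def by blast
  next
    case True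
    have vn: "v < n" using v B by auto
    obtain u where u: "u \<in> U" "v \<in> set (closed u)" using U(1) v unfolding solves_def by blast
    show ?thesis
    proof (cases "u = x")
      case True
      then have "x \<in> set (closed v)" using closed_sym[OF xn vn] u(2) by blast
      then have "v \<in> sig p x" using \<open>alive p v\<close> unfolding sig_def by simp
      then have "y \<in> set (closed v)" using y(2) unfolding sig_def by blast
      then show ?thesis using closed_sym[OF yn vn] unfolding U'_def by blast
    next
      case False
      then show ?thesis using u unfolding U'_def by blast
    qed
  qed
  ultimately have "solves U'" unfolding solves_def by blast
  moreover have "set (p @ [y]) \<subseteq> U'" using U(2) xp unfolding U'_def by auto
  ultimately show ?thesis using y(1) unfolding extends_def by blast
qed

text \<open>An entry \<open>(d, v)\<close> stands for the path \<open>take d p @ [v]\<close>. Depths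
  do not decrease towards the top, so cutting the path for the top entry spares the prefixes of
  those below. The last clause allows at most \<open>n\<close> entries per depth on average and
  thereby bounds the memory of the stack.\<close>

definition stack_ok :: "nat list \<Rightarrow> (nat \<times> nat) list \<Rightarrow> bool" where
  "stack_ok p stk \<longleftrightarrow> distinct p \<and> set p \<subseteq> {..<n} \<and> length p \<le> k \<and>
    (\<forall>(d, v)\<in>set stk. d < k \<and> d \<le> length p \<and> v < n \<and> v \<notin> set (take d p)) \<and>
    sorted (map fst stk) \<and> (\<forall>i<length stk. i < n * (fst (stk ! i) + 1))"

definition pending :: "nat list \<Rightarrow> (nat \<times> nat) list \<Rightarrow> bool" where
  "pending p stk \<longleftrightarrow> (\<exists>(d, v)\<in>set stk. extends (take d p @ [v]))"

text \<open>An entry of depth \<open>d\<close> leads to a path of length \<open>Suc d\<close>, below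
  which \<open>k - Suc d\<close> further levels are possible.\<close>

definition weight :: "(nat \<times> nat) list \<Rightarrow> nat" where
  "weight stk = (\<Sum>(d, v)\<leftarrow>stk. nodes D (k - Suc d))"

lemma stack_ok_push:
  assumes ok: "stack_ok p stk" "length stk \<le> n * length p" and p: "length p < k"
    and xs: "set xs \<subseteq> {..<n}" "set xs \<inter> set p = {}" "length xs \<le> n"
  shows "stack_ok p (stk @ map (Pair (length p)) xs)"
proof -
  let ?stk = "stk @ map (Pair (length p)) xs"
  have "i < n * (fst (?stk ! i) + 1)" if "i < length ?stk" for i
  proof (cases "i < length stk")
    case True
    then show ?thesis using ok(1) unfolding stack_ok_def by (simp add: nth_append)
  next
    case False
    then have "fst (?stk ! i) = length p" using that by (auto simp: nth_append)
    moreover have "i < n * length p + n" using that ok(2) xs(3) by simp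
    ultimately show ?thesis by (simp add: algebra_simps)
  qed
  moreover have "sorted (map fst ?stk)"
  proof -
    have "map fst ?stk = map fst stk @ replicate (length xs) (length p)" by (simp add: o_def map_replicate_const)
    moreover have "d \<le> length p" if "d \<in> set (map fst stk)" for d
      using ok(1) that unfolding stack_ok_def by auto
    ultimately show ?thesis using ok(1) unfolding stack_ok_def by (simp add: sorted_append)
  qed
  moreover have "\<forall>(d, v)\<in>set ?stk. d < k \<and> d \<le> length p \<and> v < n \<and> v \<notin> set (take d p)"
    using ok(1) p xs unfolding stack_ok_def by auto
  ultimately show ?thesis using ok(1) unfolding stack_ok_def by blast
qed

text \<open>The remaining entries have depth at most \<open>d\<close>, so they see the same prefix
  before and after the path is cut at \<open>d\<close>.\<close>

lemma stack_ok_pop: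
  assumes ok: "stack_ok p (stk @ [(d, v)])"
  shows "stack_ok (take d p @ [v]) stk" "length stk \<le> n * Suc d" "pending (take d p @ [v]) stk = pending p stk"
    "length (take d p @ [v]) = Suc d"
proof -
  have dv: "d < k" "d \<le> length p" "v < n" "v \<notin> set (take d p)" using ok unfolding stack_ok_def by auto
  have le: "d' \<le> d" "take d' (take d p @ [v]) = take d' p" if "(d', v') \<in> set stk" for d' v'
  proof -
    show "d' \<le> d" using ok that unfolding stack_ok_def by (auto simp: sorted_append)
    then show "take d' (take d p @ [v]) = take d' p" using dv(2) by (simp add: min_def)
  qed
  show len: "length (take d p @ [v]) = Suc d" using dv by simp
  have "(case x of (d', v') \<Rightarrow> extends (take d' (take d p @ [v]) @ [v'])) =
      (case x of (d', v') \<Rightarrow> extends (take d' p @ [v']))" if "x \<in> set stk" for x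
    using that le(2)[of "fst x" "snd x"] by (simp only: case_prod_beta prod.collapse)
  then show "pending (take d p @ [v]) stk = pending p stk" unfolding pending_def by (intro bex_cong refl)
  have "length stk < n * (d + 1)" using ok unfolding stack_ok_def
    by (metis (no_types, lifting) fst_conv length_append_singleton lessI nth_append_length)
  then show "length stk \<le> n * Suc d" by simp
  have "i < n * (fst (stk ! i) + 1)" if "i < length stk" for i
    using ok that unfolding stack_ok_def by (auto simp: nth_append dest: spec[of _ i])
  moreover have "\<forall>(d', v')\<in>set stk. d' < k \<and> d' \<le> Suc d \<and> v' < n \<and> v' \<notin> set (take d' (take d p @ [v]))"
  proof clarify
    fix d' v' assume stk: "(d', v') \<in> set stk"
    then have "d' < k \<and> d' \<le> length p \<and> v' < n \<and> v' \<notin> set (take d' p)" using ok unfolding stack_ok_def by auto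
    then show "d' < k \<and> d' \<le> Suc d \<and> v' < n \<and> v' \<notin> set (take d' (take d p @ [v]))"
      using le[OF stk] by simp
  qed
  moreover have "distinct (take d p @ [v])" "set (take d p @ [v]) \<subseteq> {..<n}"
    using ok dv unfolding stack_ok_def by (auto dest: in_set_takeD)
  moreover have "sorted (map fst stk)" using ok unfolding stack_ok_def by (auto simp: sorted_append)
  ultimately show "stack_ok (take d p @ [v]) stk" unfolding stack_ok_def len using dv(1) by simp
qed

lemma weight_append: "weight (stk @ stk') = weight stk + weight stk'"
  unfolding weight_def by simp

lemma weight_push: "weight (map (Pair d) xs) = length xs * nodes D (k - Suc d)"
  unfolding weight_def by (induction xs) auto

lemma nodes_pos: "0 < nodes D r"
  by (cases r) auto

text \<open>Replacing a node by its children saves at least the node itself.\<close>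

lemma weight_children:
  assumes "length xs \<le> D" "d < k"
  shows "weight (map (Pair d) xs) < nodes D (k - d)"
proof -
  have "k - d = Suc (k - Suc d)" using assms(2) by simp
  then show ?thesis using assms(1) by (simp add: weight_push mult_le_mono1 less_Suc_eq_le)
qed

text \<open>\<open>few\<close> supplies an alive \<open>c\<close> lying in few signatures; distinct
  candidates of \<open>c\<close> have distinct signatures, and \<open>b\<close> has no more
  candidates than \<open>c\<close>. For the covering, a vertex of \<open>closed b\<close> has
  \<open>b\<close> in its signature, hence so does its representative, which therefore lies in
  \<open>closed b\<close> as well.\<close>

lemma candidates_few_and_covering:
  assumes classes: "\<And>u v. u < n \<Longrightarrow> v < n \<Longrightarrow> arr s 1 u = arr s 1 v \<longleftrightarrow> sig p u = sig p v"
    and rep: "\<And>v. v < n \<Longrightarrow> arr s 4 (arr s 1 v) < n" "\<And>v. v < n \<Longrightarrow> arr s 1 (arr s 4 (arr s 1 v)) = arr s 1 v"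
    and b: "alive p b"
    and min: "\<And>c. alive p c \<Longrightarrow> length (candidates s b) \<le> length (candidates s c)"
  shows "length (candidates s b) \<le> D" "set (candidates s b) \<subseteq> set (closed b)"
    "\<forall>x\<in>set (closed b). \<exists>y\<in>set (candidates s b). sig p y = sig p x"
proof -
  have alive_n: "c < n" if "alive p c" for c using that B unfolding alive_def by auto
  have cand: "x \<in> set (candidates s c) \<longleftrightarrow> x \<in> set (closed c) \<and> arr s 4 (arr s 1 x) = x" for x c
    unfolding candidates_def reps_def by auto
  show "set (candidates s b) \<subseteq> set (closed b)" using cand by blast
  have "{b. alive p b} \<subseteq> {..<n}" "{b. alive p b} \<noteq> {}" using alive_n b by auto
  from few[OF this] obtain c where c: "alive p c" "card {S \<in> sig p ` {..<n}. c \<in> S} \<le> D"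
    by (auto simp: sig_def[abs_def])
  have cn: "c < n" using alive_n c(1) .
  have dist: "distinct (candidates s c)"
    using closed(1)[OF cn] unfolding candidates_def reps_def by simp
  have sub: "x < n" if "x \<in> set (candidates s c)" for x
    using that closed(2)[OF cn] unfolding cand by auto
  have "inj_on (sig p) (set (candidates s c))"
  proof (rule inj_onI)
    fix x y assume xy: "x \<in> set (candidates s c)" "y \<in> set (candidates s c)" "sig p x = sig p y"
    then have "arr s 1 x = arr s 1 y" using classes sub by blast
    then show "x = y" using xy(1,2) unfolding cand by metis
  qed
  then have "length (candidates s c) = card (sig p ` set (candidates s c))"
    using dist by (simp add: card_image distinct_card)
  also have "\<dots> \<le> card {S \<in> sig p ` {..<n}. c \<in> S}"
  proof (rule card_mono)
    show "sig p ` set (candidates s c) \<subseteq> {S \<in> sig p ` {..<n}. c \<in> S}"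
    proof
      fix S assume "S \<in> sig p ` set (candidates s c)"
      then obtain x where x: "x \<in> set (candidates s c)" "S = sig p x" by blast
      then have "x \<in> set (closed c)" unfolding cand by blast
      then have "c \<in> S" using c(1) x(2) unfolding sig_def by blast
      then show "S \<in> {S \<in> sig p ` {..<n}. c \<in> S}" using x sub by blast
    qed
  qed simp
  finally show "length (candidates s b) \<le> D" using c min[OF c(1)] by simp
  show "\<forall>x\<in>set (closed b). \<exists>y\<in>set (candidates s b). sig p y = sig p x"
  proof
    fix x assume x: "x \<in> set (closed b)"
    have xn: "x < n" using x closed(2)[OF alive_n[OF b]] by auto
    define y where "y = arr s 4 (arr s 1 x)"
    have y: "y < n" "arr s 1 y = arr s 1 x" using rep[OF xn] unfolding y_def by auto
    then have sg: "sig p y = sig p x" using classes xn by blast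
    moreover have "b \<in> sig p x" using x b unfolding sig_def by simp
    ultimately have "y \<in> set (closed b)" unfolding sig_def by blast
    then have "y \<in> set (candidates s b)" unfolding cand using y(2) unfolding y_def by simp
    then show "\<exists>y\<in>set (candidates s b). sig p y = sig p x" using sg by blast
  qed
qed

definition analysed :: "nat list \<Rightarrow> state \<Rightarrow> bool" where
  "analysed p s \<longleftrightarrow> regs s 23 = n + 1 \<and> (\<forall>b. \<not> alive p b) \<or>
    regs s 23 \<le> n \<and> regs s 24 < n \<and> alive p (regs s 24) \<and> (\<forall>v<n. arr s 1 v \<le> limit) \<and>
    length (candidates s (regs s 24)) \<le> D \<and> set (candidates s (regs s 24)) \<subseteq> set (closed (regs s 24)) \<and>
    (\<forall>x\<in>set (closed (regs s 24)). \<exists>y\<in>set (candidates s (regs s 24)). sig p y = sig p x)"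

lemma runs_analyse:
  assumes s: "base s" "on_path p s"
  shows "runs w analyse_prog s (\<lambda>T s'. T \<le> 180 * (k + 1) * size \<and> base s' \<and> keep s s' \<and> analysed p s')"
    (is "runs w analyse_prog s ?R")
proof -
  let ?k = "(k + 1) * size"
  have alive_n: "b < n" if "alive p b" for b using that B unfolding alive_def by auto
  show ?thesis
    unfolding analyse_prog_def
  proof (rule runs_SeqI[OF runs_init[OF s(1)]], elim conjE)
    fix T1 s1 assume 1: "T1 \<le> 15 * size" "base s1" "keep s s1" "\<forall>v<n. arr s1 0 v = (if v \<in> B then 1 else 0)" "\<forall>v<n. arr s1 1 v = 0"
    show "runs w (Seq colour_prog (Seq refine_prog (Seq rep_prog best_prog))) s1 (\<lambda>T'. ?R (T1 + T'))"
    proof (rule runs_SeqI[OF runs_colour[OF 1(2) on_path_keep[OF 1(3) s(2)] 1(4)]], elim conjE)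
      fix T2 s2 assume 2: "T2 \<le> 30 * (k + 1) * size" "base s2" "keep s1 s2"
        "\<forall>v<n. arr s2 0 v = (if alive p v then 1 else 0)" "arr s2 1 = arr s1 1"
      have z: "\<forall>v<n. arr s2 1 v = 0" using 1(5) 2(5) by simp
      show "runs w (Seq refine_prog (Seq rep_prog best_prog)) s2 (\<lambda>T'. ?R (T1 + (T2 + T')))"
      proof (rule runs_SeqI[OF runs_refine[OF 2(2,4) z]], elim conjE)
        fix T3 s3 assume 3: "T3 \<le> 70 * size" "base s3" "keep s2 s3" "arr s3 0 = arr s2 0" "\<forall>v<n. arr s3 1 v \<le> limit"
          "\<forall>u<n. \<forall>v<n. (arr s3 1 u = arr s3 1 v) = (sig p u = sig p v)"
        show "runs w (Seq rep_prog best_prog) s3 (\<lambda>T'. ?R (T1 + (T2 + (T3 + T'))))"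
        proof (rule runs_SeqI[OF runs_rep[OF 3(2,5)]], elim conjE)
          fix T4 s4 assume 4: "T4 \<le> 14 * size" "base s4" "keep s3 s4" "arr s4 0 = arr s3 0" "arr s4 1 = arr s3 1"
            "\<forall>v<n. arr s4 4 (arr s3 1 v) < n \<and> arr s3 1 (arr s4 4 (arr s3 1 v)) = arr s3 1 v"
          have lim: "\<forall>v<n. arr s4 1 v \<le> limit" using 3(5) 4(5) by simp
          show "runs w best_prog s4 (\<lambda>T'. ?R (T1 + (T2 + (T3 + (T4 + T')))))"
          proof (rule runs_mono[OF runs_best[OF 4(2) lim]], elim conjE)
            fix T5 s5 assume 5: "T5 \<le> 50 * size" "base s5" "keep s4 s5" "arr s5 = arr s4"
              "regs s5 23 = n + 1 \<and> (\<forall>b<n. arr s4 0 b = 0) \<or>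
               regs s5 24 < n \<and> arr s4 0 (regs s5 24) \<noteq> 0 \<and> regs s5 23 \<le> n \<and>
               (\<forall>b<n. arr s4 0 b \<noteq> 0 \<longrightarrow> length (candidates s4 (regs s5 24)) \<le> length (candidates s4 b))"
            have "size \<le> ?k" by simp
            then have T: "T1 + (T2 + (T3 + (T4 + T5))) \<le> 180 * (k + 1) * size"
              using 1(1) 2(1) 3(1) 4(1) 5(1) by (simp only: mult.assoc)
            have K: "keep s s5" using 1(3) 2(3) 3(3) 4(3) 5(3) keep_trans by blast
            have a0: "arr s4 0 v = (if alive p v then 1 else 0)" if "v < n" for v
              using 2(4) 3(4) 4(4) that by simp
            have cl: "arr s4 1 u = arr s4 1 v \<longleftrightarrow> sig p u = sig p v" if "u < n" "v < n" for u v
              using 3(6) 4(5) that by simp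
            have rep: "arr s4 4 (arr s4 1 v) < n" "arr s4 1 (arr s4 4 (arr s4 1 v)) = arr s4 1 v" if "v < n" for v
              using 4(5,6) that by auto
            have eqc: "candidates s5 b = candidates s4 b" for b unfolding candidates_def reps_def 5(4) ..
            show "?R (T1 + (T2 + (T3 + (T4 + T5)))) s5"
            proof (cases "\<exists>b. alive p b")
              case False
              then have "regs s5 23 = n + 1" using 5(5) a0 by auto
              then show ?thesis using T 5(2) K False unfolding analysed_def by blast
            next
              case True
              then obtain b0 where "alive p b0" by blast
              then have "arr s4 0 b0 \<noteq> 0" "b0 < n" using a0 alive_n by auto
              then have 6: "regs s5 24 < n" "arr s4 0 (regs s5 24) \<noteq> 0" "regs s5 23 \<le> n"
                "\<forall>b<n. arr s4 0 b \<noteq> 0 \<longrightarrow> length (candidates s4 (regs s5 24)) \<le> length (candidates s4 b)"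
                using 5(5) by auto
              define b where "b = regs s5 24"
              have b: "b < n" "alive p b" using 6 a0 unfolding b_def by (auto split: if_splits)
              have min: "length (candidates s4 b) \<le> length (candidates s4 c)" if "alive p c" for c
                using 6(4) a0[OF alive_n[OF that]] alive_n[OF that] that unfolding b_def by simp
              have "\<forall>v<n. arr s5 1 v \<le> limit" using lim 5(4) by simp
              then have "analysed p s5"
                unfolding analysed_def eqc b_def[symmetric]
                using candidates_few_and_covering[OF cl rep b(2) min] b 6(3) by blast
              then show ?thesis using T 5(2) K by blast
            qed
          qed
        qed
      qed
    qed
  qed
qed

end

lemma runs_instr:
  "a mod 2 ^ w = v \<Longrightarrow> runs w P (set_reg r v s) (\<lambda>T. Q (Suc T)) \<Longrightarrow> runs w (Seq (Const r a) P) s Q"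
  "(regs s x + regs s y) mod 2 ^ w = v \<Longrightarrow> runs w P (set_reg r v s) (\<lambda>T. Q (Suc T)) \<Longrightarrow>
    runs w (Seq (Add r x y) P) s Q"
  "mem s (regs s x) = v \<Longrightarrow> runs w P (set_reg r v s) (\<lambda>T. Q (Suc T)) \<Longrightarrow> runs w (Seq (Load r x) P) s Q"
  unfolding runs_simps by simp_all

section \<open>The search loop\<close>

context ram_search
begin

text \<open>Only the existence of a solution is tracked, not a fixed one, since branching over
  representatives may exchange it for another.\<close>

definition running :: "state \<Rightarrow> bool" where
  "running s \<longleftrightarrow> regs s 27 = 0 \<and> regs s 30 = 0 \<and> base s \<and> stack_ok (path_list s) (stack s) \<and>
    regs s 6 \<le> n * regs s 5 \<and>
    ((\<exists>U. solves U) \<longrightarrow> extends (path_list s) \<or> pending (path_list s) (stack s))"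

definition success :: "state \<Rightarrow> bool" where
  "success s \<longleftrightarrow> regs s 27 = 1 \<and> regs s 30 = 1 \<and> base s \<and> regs s 5 \<le> k \<and> distinct (path_list s) \<and>
    solves (set (path_list s))"

definition failure :: "state \<Rightarrow> bool" where
  "failure s \<longleftrightarrow> regs s 27 = 1 \<and> regs s 30 = 0 \<and> base s \<and> (\<nexists>U. solves U)"

text \<open>Bounds the search nodes still to be visited, including the current one.\<close>

definition remaining :: "state \<Rightarrow> nat" where
  "remaining s = (if regs s 27 = 0 then nodes D (k - regs s 5) + weight (stack s) else 0)"

lemma length_path_list [simp]: "length (path_list s) = regs s 5"
  unfolding path_list_def by simp

lemma on_path_list: "stack_ok (path_list s) stk \<Longrightarrow> on_path (path_list s) s"
  unfolding stack_ok_def on_path_def by (simp add: path_list_def)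

text \<open>Applied when the current path is refuted or already expanded, so that only stack entries
  can lead to a solution. The popped entry becomes the current path and its subtree moves to the
  other summand of \<open>remaining\<close>, hence the equality with the old weight.\<close>

lemma runs_backtrack:
  assumes s: "base s" "stack_ok (path_list s) (stack s)" "(\<exists>U. solves U) \<longrightarrow> pending (path_list s) (stack s)"
    and flags: "regs s 27 = 0" "regs s 30 = 0" and lim: "regs s 6 \<le> limit"
  shows "runs w pop_prog s (\<lambda>T s'. T \<le> 20 \<and> (running s' \<and> remaining s' = weight (stack s) \<or> failure s'))"
proof (cases "stack s" rule: rev_cases)
  case Nil
  then have "failure (set_reg 27 1 s)" using s flags unfolding failure_def pending_def by simp
  then show ?thesis by (intro runs_mono[OF runs_pop_empty[OF s(1) Nil]]) auto
next
  case (snoc stk x)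
  obtain d v where x: "x = (d, v)" by fastforce
  note stk = snoc[unfolded x]
  note ok = s(2)[unfolded stk]
  have d: "d < k" "d \<le> regs s 5" using ok unfolding stack_ok_def by auto
  show ?thesis
  proof (rule runs_mono[OF runs_pop[OF s(1) stk d(1) lim]], elim conjE)
    fix T s' assume s': "T \<le> 20" "base s'" "stack s' = stk" "regs s' 5 = Suc d" "path s' = (path s)(d := v)"
      "\<forall>r\<in>{27, 30}. regs s' r = regs s r"
    have pl: "path_list s' = take d (path_list s) @ [v]"
      using d(2) unfolding path_list_def s'(4,5) by (simp add: take_map)
    have "regs s' 6 = length stk" using arg_cong[OF s'(3), of length] by simp
    then have "regs s' 6 \<le> n * regs s' 5" using stack_ok_pop(2)[OF ok] s'(4) by simp
    moreover have "extends (path_list s') \<or> pending (path_list s') stk" if "\<exists>U. solves U"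
    proof -
      have "pending (path_list s) (stk @ [(d, v)])" using s(3) that stk by simp
      then have "extends (take d (path_list s) @ [v]) \<or> pending (path_list s) stk" unfolding pending_def by auto
      then show ?thesis using stack_ok_pop(3)[OF ok] pl by simp
    qed
    ultimately have "running s'"
      unfolding running_def using s' flags stack_ok_pop(1)[OF ok] pl by simp
    moreover have "remaining s' = weight (stack s)"
      unfolding remaining_def using s' flags stk by (simp add: weight_append) (simp add: weight_def)
    ultimately show "T \<le> 20 \<and> (running s' \<and> remaining s' = weight (stack s) \<or> failure s')" using s'(1) by blast
  qed
qed

lemma runs_step:
  assumes s: "running s"
  shows "runs w step_prog s (\<lambda>T s'. T \<le> 260 * (k + 1) * size \<and>
    (running s' \<and> remaining s' < remaining s \<or> success s' \<or> failure s'))"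
    (is "runs w step_prog s ?R")
proof -
  let ?next = "\<lambda>s'. running s' \<and> remaining s' < remaining s \<or> success s' \<or> failure s'"
  let ?p = "path_list s"
  have ok: "stack_ok ?p (stack s)" and flags: "regs s 27 = 0" "regs s 30 = 0" and bs: "base s"
    and height: "regs s 6 \<le> n * regs s 5"
    and complete: "(\<exists>U. solves U) \<longrightarrow> extends ?p \<or> pending ?p (stack s)"
    using s unfolding running_def by auto
  have p: "distinct ?p" "set ?p \<subseteq> {..<n}" "regs s 5 \<le> k" using ok unfolding stack_ok_def by auto
  have op: "on_path ?p s" using on_path_list[OF ok] .
  have size1: "1 \<le> (k + 1) * size" "size \<le> (k + 1) * size" unfolding size_def by simp_all
  show ?thesis
    unfolding step_prog_def
  proof (rule runs_SeqI[OF runs_analyse[OF bs op]], elim conjE)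
    fix T1 s1 assume 1: "T1 \<le> 180 * (k + 1) * size" "base s1" "keep s s1" "analysed ?p s1"
    define s2 where "s2 = set_reg 29 (Suc n) s1"
    have mod: "Suc n mod 2 ^ w = Suc n" using L_le(4) large by (intro mod_less) (simp add: Q_def L_def)
    have s2: "base s2" "regs s2 5 = regs s 5" "regs s2 6 = regs s 6" "path_list s2 = ?p" "stack s2 = stack s"
      "regs s2 27 = 0" "regs s2 30 = 0" "regs s2 24 = regs s1 24" "regs s2 23 = regs s1 23" "regs s2 29 = Suc n" "arr s2 = arr s1"
      using 1(2,3) flags unfolding s2_def keep_def path_list_def stack_def by auto
    have cands: "candidates s2 b = candidates s1 b" for b using s2(11) unfolding candidates_def reps_def by simp
    let ?C = "IfLess 23 29 (Seq (IfLess 5 1 push_prog Skip) pop_prog) (Seq (Const 30 1) (Const 27 1))"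
    have "runs w ?C s2 (\<lambda>T. ?R (T1 + (1 + T)))"
    proof (cases "\<exists>b. alive ?p b")
      case False
      then have eq: "regs s2 23 = Suc n" using 1(4) s2 unfolding analysed_def by auto
      have "path_list (set_reg 27 1 (set_reg 30 1 s2)) = ?p" using s2(4) unfolding path_list_def by simp
      then have "success (set_reg 27 1 (set_reg 30 1 s2))"
        unfolding success_def using s2 p solves_path[of ?p] False by simp
      moreover have "T1 + 4 \<le> 260 * (k + 1) * size" using 1(1) size1 by (simp only: mult.assoc; linarith)
      ultimately show ?thesis using eq s2(10) w_nonzero by (simp add: runs_simps numeral_eq_Suc)
    next
      case True
      define b where "b = regs s1 24"
      have 2: "regs s1 23 \<le> n" "b < n" "alive ?p b" "\<forall>v<n. arr s1 1 v \<le> limit" "length (candidates s1 b) \<le> D"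
        "set (candidates s1 b) \<subseteq> set (closed b)" "\<forall>x\<in>set (closed b). \<exists>y\<in>set (candidates s1 b). sig ?p y = sig ?p x"
        using 1(4) True unfolding analysed_def b_def by auto
      have lt: "regs s2 23 < regs s2 29" using 2(1) s2 by simp
      have cn: "set (candidates s1 b) \<subseteq> {..<n}" using 2(6) closed(2)[OF 2(2)] by blast
      \<comment> \<open>A candidate dominates the alive vertex \<open>b\<close>, which no vertex on
        the path does; so paths stay free of repetitions.\<close>
      have cp: "set (candidates s1 b) \<inter> set ?p = {}"
      proof -
        have "b \<in> set (closed x)" if "x \<in> set (candidates s1 b)" for x
          using closed_sym[of x b] cn 2(2,6) that by blast
        then show ?thesis using 2(3) unfolding alive_def by blast
      qed
      have weight_le: "weight (stack s) < remaining s" unfolding remaining_def using flags nodes_pos by simp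
      have bound: "T1 + (1 + (1 + T)) \<le> 260 * (k + 1) * size" if "T \<le> 40 * size + 22" for T
        using 1(1) size1 that by (simp only: mult.assoc; linarith)
      show ?thesis
      proof (cases "regs s 5 < k")
        case True
        \<comment> \<open>Before the push the height is at most \<open>n\<close> times the depth, so
          there is room for \<open>n\<close> more entries.\<close>
        have lim: "regs s2 6 + n \<le> limit"
        proof -
          have "n * regs s 5 \<le> n * k" using True by (intro mult_left_mono) auto
          then have "regs s2 6 \<le> n * k" using height s2(3) by linarith
          then show ?thesis unfolding limit_def by simp
        qed
        have "runs w push_prog s2 (\<lambda>T s'. T \<le> 40 * size \<and> base s' \<and> path s' = path s2 \<and>
          (\<forall>r\<in>{5, 27, 30}. regs s' r = regs s2 r) \<and> stack s' = stack s2 @ map (Pair (regs s2 5)) (candidates s2 b))"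
          using runs_push[of s2 b] s2 2(2,4) lim b_def by simp
        then have "runs w (Seq push_prog pop_prog) s2 (\<lambda>T s'. T \<le> 40 * size + 20 \<and> ?next s')"
        proof (rule runs_SeqI, elim conjE)
          fix T3 s3 assume 3: "T3 \<le> 40 * size" "base s3" "path s3 = path s2" "\<forall>r\<in>{5, 27, 30}. regs s3 r = regs s2 r"
            "stack s3 = stack s2 @ map (Pair (regs s2 5)) (candidates s2 b)"
          let ?stk = "stack s @ map (Pair (length ?p)) (candidates s1 b)"
          have pl: "path_list s3 = ?p" using 3(3,4) s2(4) unfolding path_list_def by simp
          have stk: "stack s3 = ?stk" using 3(5) s2 cands by simp
          have ok3: "stack_ok (path_list s3) (stack s3)"
            unfolding pl stk using stack_ok_push[OF ok] height True cn cp length_candidates[OF 2(2)] by simp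
          have pend: "(\<exists>U. solves U) \<longrightarrow> pending (path_list s3) (stack s3)"
          proof
            assume "\<exists>U. solves U"
            then consider "extends ?p" | "pending ?p (stack s)" using complete by blast
            then show "pending (path_list s3) (stack s3)"
            proof cases
              case 1
              then obtain y where "y \<in> set (candidates s1 b)" "extends (?p @ [y])"
                using extends_branch[OF 1 2(3,7) cn] by blast
              then show ?thesis unfolding pl stk pending_def by force
            next
              case 2
              then show ?thesis unfolding pl stk pending_def by auto
            qed
          qed
          have "regs s3 6 = length (stack s3)" by simp
          also have "\<dots> \<le> limit" unfolding stk using lim s2(3) length_candidates[OF 2(2), of s1] by simp
          finally have lim3: "regs s3 6 \<le> limit" .
          have w3: "weight (stack s3) < remaining s"
            unfolding stk remaining_def weight_append using flags weight_children[OF 2(5) True] by simp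
          show "runs w pop_prog s3 (\<lambda>T'. (\<lambda>T s'. T \<le> 40 * size + 20 \<and> ?next s') (T3 + T'))"
            by (rule runs_mono[OF runs_backtrack[OF 3(2) ok3 pend _ _ lim3]]) (use 3 s2 w3 in auto)
        qed
        then have "runs w (Seq (IfLess 5 1 push_prog Skip) pop_prog) s2 (\<lambda>T s'. T \<le> 40 * size + 21 \<and> ?next s')"
          unfolding runs_simps(8,9) using True s2 by (simp add: baseD, elim runs_mono) auto
        then show ?thesis
          unfolding runs_simps(9)[of w 23] if_P[OF lt] by (rule runs_mono) (use bound in force)
      next
        case False
        then have full: "length ?p = k" using p(3) by simp
        have pend: "(\<exists>U. solves U) \<longrightarrow> pending (path_list s2) (stack s2)"
          using complete not_extends_full[OF p(1) full 2(3)] s2 by simp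
        have "regs s2 6 \<le> n * k" using height s2(3) full by simp
        then have "regs s2 6 \<le> limit" unfolding limit_def by simp
        then have "runs w pop_prog s2 (\<lambda>T s'. T \<le> 20 \<and> (running s' \<and> remaining s' = weight (stack s2) \<or> failure s'))"
          using runs_backtrack[OF s2(1) _ pend s2(6,7)] ok s2(4,5) by simp
        then have "runs w pop_prog s2 (\<lambda>T s'. T \<le> 20 \<and> ?next s')"
          by (rule runs_mono) (use weight_le s2(5) in auto)
        moreover have "\<not> regs s2 5 < regs s2 1" using False s2 by (simp add: baseD)
        ultimately have "runs w (Seq (IfLess 5 1 push_prog Skip) pop_prog) s2 (\<lambda>T s'. T \<le> 22 \<and> ?next s')"
          by (simp add: runs_simps)
        then show ?thesis
          unfolding runs_simps(9)[of w 23] if_P[OF lt] by (rule runs_mono) (use bound in force)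
      qed
    qed
    then show "runs w (Seq (Add 29 0 3) ?C) s1 (\<lambda>T'. ?R (T1 + T'))"
      unfolding runs_simps(8)[of w "Add _ _ _"] runs_simps(4) s2_def using 1(2) mod by (simp add: baseD)
  qed
qed

lemma runs_search_loop:
  assumes "running s"
  shows "runs w (WhileLess 27 3 step_prog) s (\<lambda>T s'. T \<le> (260 * (k + 1) * size + 1) * remaining s + 1 \<and>
    (success s' \<or> failure s'))"
proof -
  have "runs w (WhileLess 27 3 step_prog) s (\<lambda>T s'. T \<le> (260 * (k + 1) * size + 1) * remaining s + 1 \<and>
    (running s' \<or> success s' \<or> failure s') \<and> \<not> regs s' 27 < regs s' 3)"
  proof (rule runs_while_measure[where I = "\<lambda>s. running s \<or> success s \<or> failure s"])
    fix s assume "running s \<or> success s \<or> failure s" "regs s 27 < regs s 3"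
    then have run: "running s" by (auto simp: success_def failure_def baseD)
    have "0 < remaining s" using run nodes_pos unfolding running_def remaining_def by simp
    moreover have "remaining s' = 0" if "success s' \<or> failure s'" for s'
      using that unfolding success_def failure_def remaining_def by auto
    ultimately show "runs w step_prog s (\<lambda>T s'. T \<le> 260 * (k + 1) * size \<and>
        (running s' \<or> success s' \<or> failure s') \<and> remaining s' < remaining s)"
      by (intro runs_mono[OF runs_step[OF run]]) auto
  qed (use assms in simp)
  then show ?thesis by (rule runs_mono) (auto simp: running_def baseD)
qed

lemma runs_setup:
  "runs w setup_prog (init_state k h n B adj) (\<lambda>T s. T \<le> 10 \<and> running s \<and> remaining s = nodes D k)"
proof -
  let ?s0 = "init_state k h n B adj"
  have mem: "mem ?s0 = input" unfolding init_state_def input_def fun_eq_iff by simp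
  \<comment> \<open>The last offset cell, at address \<open>2 n\<close>, holds the first address
    after the input.\<close>
  have L: "input (n + n) = L" using input_start[of n] unfolding start_def L_def by (simp add: length_adj)
  have q: "Q + 8 < 2 ^ w" using large by simp
  have mods: "(n + n) mod 2 ^ w = n + n" "(L + k) mod 2 ^ w = Q" "Suc 0 mod 2 ^ w = Suc 0"
    "Suc Q mod 2 ^ w = Suc Q" "Suc (Suc Q) mod 2 ^ w = Suc (Suc Q)" "Suc (Suc (Suc Q)) mod 2 ^ w = Suc (Suc (Suc Q))"
    "Suc (Suc (Suc (Suc Q))) mod 2 ^ w = Suc (Suc (Suc (Suc Q)))"
    "Suc (Suc (Suc (Suc (Suc Q)))) mod 2 ^ w = Suc (Suc (Suc (Suc (Suc Q))))"
    "Suc (Suc (Suc (Suc (Suc (Suc Q))))) mod 2 ^ w = Suc (Suc (Suc (Suc (Suc (Suc Q)))))"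
    using L_le q w_nonzero unfolding Q_def by simp_all
  have regs0: "regs ?s0 = (\<lambda>_. 0)(0 := n, 1 := k, 2 := h)" unfolding init_state_def by simp
  define s where "s = set_reg 16 (Suc (Suc (Suc (Suc (Suc (Suc Q)))))) (set_reg 15 (Suc (Suc (Suc (Suc (Suc Q))))) (set_reg 14 (Suc (Suc (Suc (Suc Q)))) (set_reg 13 (Suc (Suc (Suc Q))) (set_reg 12 (Suc (Suc Q))
    (set_reg 11 (Suc Q) (set_reg 10 Q (set_reg 4 L (set_reg 3 1 ?s0))))))))"
  have runs: "runs w setup_prog ?s0 (\<lambda>T s'. T \<le> 10 \<and> s' = s)"
    unfolding setup_prog_def s_def
    apply (rule runs_instr(1)[where v = 1], simp add: w_nonzero)
    apply (rule runs_instr(2)[where v = "n + n"], simp add: mods regs0)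
    apply (rule runs_instr(3)[where v = L], simp add: L mem)
    apply (rule runs_instr(2)[where v = Q], simp add: mods regs0)
    apply (rule runs_instr(2)[where v = "Suc Q"], simp add: mods)
    apply (rule runs_instr(2)[where v = "Suc (Suc Q)"], simp add: mods)
    apply (rule runs_instr(2)[where v = "Suc (Suc (Suc Q))"], simp add: mods)
    apply (rule runs_instr(2)[where v = "Suc (Suc (Suc (Suc Q)))"], simp add: mods)
    apply (rule runs_instr(2)[where v = "Suc (Suc (Suc (Suc (Suc Q))))"], simp add: mods)
    apply (simp add: runs_simps mods)
    done
  have "regs s (10 + j) = Q + j" if "j < 7" for j
  proof -
    have "j \<in> {0, 1, 2, 3, 4, 5, 6}" using that by auto
    then show ?thesis unfolding s_def by auto
  qed
  then have base: "base s" unfolding base_def unfolding s_def using regs0 mem by simp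
  have r: "regs s 5 = 0" "regs s 6 = 0" "regs s 27 = 0" "regs s 30 = 0" unfolding s_def using regs0 by simp_all
  have pl: "path_list s = []" "stack s = []" using r unfolding path_list_def stack_def by simp_all
  have "running s" unfolding running_def pl using r base by (auto simp: stack_ok_def extends_def)
  moreover have "remaining s = nodes D k" unfolding remaining_def pl using r by (simp add: weight_def)
  ultimately show ?thesis by (intro runs_mono[OF runs]) auto
qed

lemma runs_finish:
  assumes "success s \<or> failure s"
  shows "runs w finish_prog s (\<lambda>T s'. T \<le> 4 \<and>
    ((\<exists>U. solves U) \<longrightarrow> (\<exists>xs. result s' = Some xs \<and> distinct xs \<and> solves (set xs))) \<and>
    ((\<nexists>U. solves U) \<longrightarrow> result s' = None))"
  using assms
proof
  assume s: "success s"
  then have "regs s 28 = 0" "regs s 30 = 1" "regs s 4 = L" "regs s 5 \<le> k" unfolding success_def by (auto simp: baseD)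
  then have "runs w finish_prog s (\<lambda>T s'. T = 4 \<and> result s' = Some (path_list s))"
    unfolding finish_prog_def using w_nonzero
    by (simp add: runs_simps result_def path_list_def path_def numeral_eq_Suc)
  then show ?thesis by (rule runs_mono) (use s in \<open>auto simp: success_def\<close>)
next
  assume s: "failure s"
  then have "regs s 28 = 0" "regs s 30 = 0" unfolding failure_def by (auto simp: baseD)
  then have "runs w finish_prog s (\<lambda>T s'. T = 2 \<and> result s' = None)"
    unfolding finish_prog_def by (simp add: runs_simps result_def numeral_eq_Suc)
  then show ?thesis by (rule runs_mono) (use s in \<open>auto simp: failure_def\<close>)
qed

lemma runs_search:
  "runs w search_prog (init_state k h n B adj) (\<lambda>T s. T \<le> 300 * (k + 1) * size * nodes D k \<and>
    ((\<exists>U. solves U) \<longrightarrow> (\<exists>xs. result s = Some xs \<and> distinct xs \<and> solves (set xs))) \<and>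
    ((\<nexists>U. solves U) \<longrightarrow> result s = None))"
    (is "runs w _ _ ?R")
  unfolding search_prog_def
proof (rule runs_SeqI[OF runs_setup], elim conjE)
  fix T1 :: nat and s1 assume 1: "T1 \<le> 10" "running s1" "remaining s1 = nodes D k"
  show "runs w (Seq (WhileLess 27 3 step_prog) finish_prog) s1 (\<lambda>T'. ?R (T1 + T'))"
  proof (rule runs_SeqI[OF runs_search_loop[OF 1(2)]], elim conjE)
    fix T2 s2 assume 2: "T2 \<le> (260 * (k + 1) * size + 1) * remaining s1 + 1" "success s2 \<or> failure s2"
    have "1 \<le> nodes D k" using nodes_pos[of k] by simp
    moreover have "nodes D k \<le> (k + 1) * size * nodes D k" unfolding size_def by simp
    moreover have "(260 * (k + 1) * size + 1) * nodes D k = 260 * ((k + 1) * size * nodes D k) + nodes D k"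
      "300 * (k + 1) * size * nodes D k = 300 * ((k + 1) * size * nodes D k)"
      by (simp_all only: algebra_simps mult_1)
    ultimately have T: "T1 + (T2 + T3) \<le> 300 * (k + 1) * size * nodes D k" if "T3 \<le> 4" for T3
      using 1(1) 2(1)[unfolded 1(3)] that by linarith
    show "runs w finish_prog s2 (\<lambda>T'. ?R (T1 + (T2 + T')))"
      by (rule runs_mono[OF runs_finish[OF 2(2)]]) (use T in auto)
  qed
qed

end

section \<open>Running time\<close>

lemma nodes_le: "nodes D r \<le> (D + 1) ^ r"
proof (induction r)
  case (Suc r)
  have "nodes D (Suc r) \<le> 1 + D * (D + 1) ^ r" using Suc by simp
  also have "\<dots> \<le> (D + 1) ^ Suc r" by simp
  finally show ?case .
qed simp

text \<open>All addresses are below \<open>27 S^2\<close> for \<open>S = n + k + h\<close>, and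
  \<open>S \<ge> 3\<close> turns \<open>27\<close> into \<open>S ^ 3\<close>; this is the origin of
  the constant \<open>5\<close>.\<close>

lemma (in ram) large_if_logarithmic:
  assumes k: "1 \<le> k" and h: "2 \<le> h" and w: "5 * log 2 (real (n + k + h)) \<le> real w"
  shows "Q + 8 * limit + 8 < 2 ^ w"
proof -
  define S where "S = n + k + h"
  have S: "n \<le> S" "k \<le> S" "3 \<le> S" using k h unfolding S_def by auto
  have "length (concat adj) \<le> (\<Sum>v<n. length (closed v))" unfolding sum_length_closed by simp
  also have "\<dots> \<le> n * n" using sum_bounded_above[of "{..<n}" "\<lambda>v. length (closed v)" n] length_closed_le by simp
  also have "\<dots> \<le> S * S" using S by (intro mult_le_mono)
  finally have len: "length (concat adj) \<le> S * S" .
  have nk: "n * k \<le> S * S" using S by (intro mult_le_mono)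
  have SS: "3 * S \<le> S * S" "9 \<le> S * S" using S mult_le_mono[of 3 S S S] mult_le_mono[of 3 S 3 S] by auto
  have "Q + 8 * limit + 8 = 18 * n + 9 * length (concat adj) + k + 8 * (n * k) + 17"
    unfolding Q_def L_def limit_def size_def by (simp add: algebra_simps)
  also have "\<dots> < 27 * (S * S)" using S len nk SS by linarith
  also have "\<dots> \<le> S ^ 3 * (S * S)" using power_mono[of 3 S 3] S by (intro mult_right_mono) auto
  also have "\<dots> = S ^ 5" by (simp add: eval_nat_numeral)
  finally have less: "Q + 8 * limit + 8 < S ^ 5" .
  have "real S ^ 5 = 2 powr (5 * log 2 (real S))"
    using S powr_realpow[of "real S" 5] by (simp add: powr_powr[symmetric] mult.commute[of 5] powr_log_cancel)
  also have "\<dots> \<le> 2 powr real w" using w unfolding S_def by simp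
  also have "\<dots> = real (2 ^ w)" by (simp add: powr_realpow)
  finally have "S ^ 5 \<le> 2 ^ w" by (metis of_nat_le_iff of_nat_power)
  then show ?thesis using less by linarith
qed

lemma runs_search_sparse:
  fixes c h k n w :: nat
  assumes k: "1 \<le> k" and h: "2 \<le> h" and bw: "bw_graph B W E" and V: "B \<union> W = {..<n}"
    and minor: "K_minor_free h (B \<union> W, E)" and adj: "adjacency_lists n E adj"
    and w: "5 * log 2 (real (n + k + h)) \<le> real w"
    and sparse: "\<And>R. graph_rel {..<n} R \<Longrightarrow> no_model h {..<n} R \<Longrightarrow> card (arcs {..<n} R) \<le> c ^ h * n"
      "\<And>R A. graph_rel {..<n} R \<Longrightarrow> no_model h {..<n} R \<Longrightarrow> A \<subseteq> {..<n} \<Longrightarrow> A \<noteq> {} \<Longrightarrow>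
        \<exists>b\<in>A. card {S \<in> dominated_by R A ` {..<n}. b \<in> S} \<le> c ^ h"
  shows "runs w search_prog (init_state k h n B adj) (\<lambda>T s.
    T \<le> 300 * (k + 1) * ((c ^ h + 2) * max 1 n) * (c ^ h + 1) ^ k \<and>
    ((\<exists>U. dominating k B W E U) \<longrightarrow> (\<exists>xs. result s = Some xs \<and> distinct xs \<and> dominating k B W E (set xs))) \<and>
    ((\<nexists>U. dominating k B W E U) \<longrightarrow> result s = None))"
proof -
  define R where "R = (\<lambda>a b. {a, b} \<in> E)"
  have sg: "simple_graph ({..<n}, E)" using bw V unfolding bw_graph_def by simp
  have neq: "a \<noteq> b" if "R a b" for a b
  proof -
    have "card {a, b} = 2" using sg that unfolding simple_graph_def R_def by blast
    then show ?thesis by auto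
  qed
  have "irreflp R" using neq by (auto intro: irreflpI)
  moreover have "symp R" unfolding R_def by (auto simp: symp_def insert_commute)
  ultimately have G: "graph_rel {..<n} R" unfolding graph_rel_def by simp
  have nm: "no_model h {..<n} R" using K_minor_free_no_model[OF sg] minor V unfolding R_def by simp
  interpret ram w k n B E adj using sg V adj by unfold_locales auto
  interpret ram_search w k n B E adj "c ^ h"
  proof unfold_locales
    show "Q + 8 * limit + 8 < 2 ^ w" by (rule large_if_logarithmic[OF k h w])
    fix A :: "nat set" assume A: "A \<subseteq> {..<n}" "A \<noteq> {}"
    have "dominated_by R A v = {b \<in> A. v \<in> set (closed b)}" for v
    proof -
      have "b = v \<or> R v b \<longleftrightarrow> v \<in> set (closed b)" if "b \<in> A" for b
        using closed(3)[of b] that A(1) unfolding R_def by auto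
      then show ?thesis unfolding dominated_by_def by blast
    qed
    then show "\<exists>b\<in>A. card {S \<in> (\<lambda>v. {b \<in> A. v \<in> set (closed b)}) ` {..<n}. b \<in> S} \<le> c ^ h"
      using sparse(2)[OF G nm A] by simp
  qed
  have "length (concat adj) = (\<Sum>v<n. length (adj ! v))"
    using sum_length_closed unfolding closed_def by (simp add: sum_Suc)
  also have "\<dots> = (\<Sum>v<n. rdeg R {..<n} v)"
  proof (rule sum.cong[OF refl])
    fix v assume "v \<in> {..<n}"
    then have v: "distinct (adj ! v)" "set (adj ! v) = nbrs E v" using adj unfolding adjacency_lists_def by auto
    have "nbrs E v = {b \<in> {..<n}. R v b}"
      using sg neq unfolding nbrs_def R_def simple_graph_def by (auto simp: insert_commute)
    then show "length (adj ! v) = rdeg R {..<n} v" unfolding rdeg_def using v distinct_card by metis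
  qed
  also have "\<dots> \<le> c ^ h * n" using sum_rdeg[of "{..<n}" R] sparse(1)[OF G nm] by simp
  finally have len: "length (concat adj) \<le> c ^ h * n" .
  \<comment> \<open>\<open>max 1 n\<close> covers the empty graph, on which the program still takes
    some steps.\<close>
  have "c ^ h * n \<le> c ^ h * max 1 n" by (rule mult_left_mono) auto
  moreover have "(c ^ h + 2) * max 1 n = c ^ h * max 1 n + 2 * max 1 n" by (rule distrib_right)
  ultimately have size: "size \<le> (c ^ h + 2) * max 1 n" using len unfolding size_def by linarith
  have dom: "dominating k B W E U \<longleftrightarrow> solves U" for U
  proof (cases "U \<subseteq> {..<n}")
    case True
    have "nbrs E v \<inter> U \<noteq> {} \<longleftrightarrow> (\<exists>u\<in>U. v \<in> set (closed u))" if "v \<in> B - U" for v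
    proof -
      have "u \<in> nbrs E v \<longleftrightarrow> v \<in> set (closed u)" if "u \<in> U" for u
        using closed(3)[of u] True that \<open>v \<in> B - U\<close> unfolding nbrs_def by (auto simp: insert_commute)
      then show ?thesis by blast
    qed
    moreover have "\<exists>u\<in>U. v \<in> set (closed u)" if "v \<in> U" for v using that closed_self by blast
    ultimately show ?thesis unfolding dominating_def solves_def V using True by blast
  qed (auto simp: dominating_def solves_def V)
  have bound: "300 * (k + 1) * size * nodes (c ^ h) k \<le> 300 * (k + 1) * ((c ^ h + 2) * max 1 n) * (c ^ h + 1) ^ k"
    by (intro mult_le_mono size nodes_le le_refl)
  show ?thesis
    unfolding dom by (rule runs_mono[OF runs_search]) (blast intro: le_trans[OF _ bound])
qed

text \<open>Every factor except \<open>N\<close> is at most a constant to the power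
  \<open>h * k\<close>, which gives \<open>a ^ (h * k)\<close>. This is \<open>a ^ 2\<close> to the
  power \<open>h * k / 2\<close>, and \<open>ln h / ln 2 \<ge> 1\<close> because
  \<open>h \<ge> 2\<close>.\<close>

lemma time_bound:
  fixes c h k N :: nat
  assumes c: "2 \<le> c" and k: "1 \<le> k" and h: "2 \<le> h"
  defines "a \<equiv> 600 * real c ^ 4"
  shows "real (300 * (k + 1) * ((c ^ h + 2) * N) * (c ^ h + 1) ^ k) \<le>
    (a ^ 2 / ln 2 * ln (real h)) powr (real h * real k / 2) * real N"
proof -
  have ch: "2 \<le> c ^ h" using c h power_increasing[of 1 h c] by simp
  have hk: "1 \<le> h * k" "h \<le> h * k" "k \<le> h * k" using h k by auto
  have d: "c ^ h + 2 \<le> c ^ h * c ^ h" "c ^ h + 1 \<le> c ^ h * c ^ h"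
    using ch mult_le_mono1[of 2 "c ^ h" "c ^ h"] by linarith+
  have k2: "k + 1 \<le> 2 ^ k" using Suc_leI[OF less_exp[of k]] by simp
  have "300 * (k + 1) * ((c ^ h + 2) * N) * (c ^ h + 1) ^ k \<le> 300 * 2 ^ k * (c ^ h * c ^ h * N) * (c ^ h * c ^ h) ^ k"
    by (intro mult_le_mono power_mono d k2) auto
  also have "\<dots> = 300 * 2 ^ k * c ^ (2 * h) * c ^ (2 * (h * k)) * N"
  proof -
    have "c ^ h * c ^ h = c ^ (2 * h)" by (simp add: mult_2 power_add)
    moreover have "(c ^ (2 * h)) ^ k = c ^ (2 * (h * k))" by (simp only: power_mult[symmetric] mult.assoc)
    ultimately show ?thesis by (simp only: mult.assoc mult.left_commute mult.commute)
  qed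
  also have "\<dots> \<le> 300 ^ (h * k) * 2 ^ (h * k) * c ^ (2 * (h * k)) * c ^ (2 * (h * k)) * N"
  proof (intro mult_le_mono le_refl)
    show "(300::nat) \<le> 300 ^ (h * k)" using self_le_power[of "300::nat" "h * k"] hk by simp
    show "(2::nat) ^ k \<le> 2 ^ (h * k)" using hk by (intro power_increasing) auto
    show "c ^ (2 * h) \<le> c ^ (2 * (h * k))" using hk c by (intro power_increasing) auto
  qed
  also have "\<dots> = (600 * c ^ 4) ^ (h * k) * N"
  proof -
    have "c ^ 2 * c ^ 2 = c ^ 4" using power_add[of c 2 2] by simp
    then have "600 * c ^ 4 = 300 * 2 * c ^ 2 * c ^ 2" by simp
    then show ?thesis by (simp only: power_mult power_mult_distrib)
  qed
  finally have "real (300 * (k + 1) * ((c ^ h + 2) * N) * (c ^ h + 1) ^ k) \<le> real ((600 * c ^ 4) ^ (h * k) * N)"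
    by (rule of_nat_mono)
  also have "\<dots> = a ^ (h * k) * real N" unfolding a_def by simp
  also have "a ^ (h * k) \<le> (a ^ 2 / ln 2 * ln (real h)) powr (real h * real k / 2)"
  proof -
    have a: "0 < a" unfolding a_def using c by simp
    have "a ^ (h * k) = a powr (2 * (real h * real k / 2))" using powr_realpow[OF a, of "h * k"] by simp
    also have "\<dots> = (a powr 2) powr (real h * real k / 2)" by (rule powr_powr[symmetric])
    also have "a powr 2 = a ^ 2" using powr_realpow[OF a, of 2] by simp
    also have "(a ^ 2) powr (real h * real k / 2) \<le> (a ^ 2 / ln 2 * ln (real h)) powr (real h * real k / 2)"
    proof (rule powr_mono2)
      have "ln 2 \<le> ln (real h)" using h by simp
      then have "a ^ 2 * 1 \<le> a ^ 2 * (ln (real h) / ln 2)" by (intro mult_left_mono) auto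
      then show "a ^ 2 \<le> a ^ 2 / ln 2 * ln (real h)" by simp
    qed auto
    finally show ?thesis .
  qed
  finally show ?thesis by (simp add: mult_right_mono)
qed

text \<open>The program is fixed before \<open>k\<close>, \<open>h\<close> and the graph, so one
  program serves all of them. Words of logarithmic length are what addressing the memory
  requires.\<close>

theorem theorem5:
  "\<exists>(P :: com) (C :: real) (c :: nat). C > 0 \<and>
    (\<forall>(k :: nat) (h :: nat) (n :: nat) (B :: nat set) (W :: nat set) (E :: nat set set)
       (adj :: nat list list) (w :: nat).
      k \<ge> 1 \<longrightarrow> h \<ge> 2 \<longrightarrow>
      bw_graph B W E \<longrightarrow> B \<union> W = {..<n} \<longrightarrow> K_minor_free h (B \<union> W, E) \<longrightarrow>
      adjacency_lists n E adj \<longrightarrow>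
      real w \<ge> real c * log 2 (real (n + k + h)) \<longrightarrow>
      (\<exists>T s. exec w P (init_state k h n B adj) T s \<and>
        real T \<le> (C * ln (real h)) powr (real h * real k / 2) * real (max 1 n) \<and>
        ((\<exists>U. dominating k B W E U) \<longrightarrow>
          (\<exists>xs. result s = Some xs \<and> distinct xs \<and> dominating k B W E (set xs))) \<and>
        ((\<nexists>U. dominating k B W E U) \<longrightarrow> result s = None)))"
proof -
  obtain c :: nat where c: "2 \<le> c \<and> (\<forall>h (V :: nat set) R. 1 \<le> h \<longrightarrow> graph_rel V R \<longrightarrow> no_model h V R \<longrightarrow>
    card (arcs V R) \<le> c ^ h * card V \<and>
    (\<forall>B\<subseteq>V. B \<noteq> {} \<longrightarrow> (\<exists>b\<in>B. card {S \<in> dominated_by R B ` V. b \<in> S} \<le> c ^ h)))"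
    using exists_sparsity_constant by (rule exE)
  define C where "C = (600 * real c ^ 4) ^ 2 / ln 2"
  show ?thesis
  proof (rule exI[of _ search_prog], rule exI[of _ C], rule exI[of _ 5], rule conjI, goal_cases)
    case 1
    then show ?case unfolding C_def using c by simp
  next
    case 2
    show ?case
    proof (intro allI impI)
      fix k h n :: nat and B W :: "nat set" and E :: "nat set set" and adj :: "nat list list" and w :: nat
      assume a: "k \<ge> 1" "h \<ge> 2" "bw_graph B W E" "B \<union> W = {..<n}" "K_minor_free h (B \<union> W, E)"
        "adjacency_lists n E adj" "real w \<ge> real 5 * log 2 (real (n + k + h))"
      have w: "5 * log 2 (real (n + k + h)) \<le> real w" using a(7) by simp
      have h1: "1 \<le> h" using a(2) by simp
      have s1: "card (arcs {..<n} R) \<le> c ^ h * n" if "graph_rel {..<n} R" "no_model h {..<n} R" for R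
        using c h1 that card_lessThan[of n] by metis
      have s2: "\<exists>b\<in>A. card {S \<in> dominated_by R A ` {..<n}. b \<in> S} \<le> c ^ h"
        if "graph_rel {..<n} R" "no_model h {..<n} R" "A \<subseteq> {..<n}" "A \<noteq> {}" for R A
        using c h1 that by blast
      obtain T s where T: "exec w search_prog (init_state k h n B adj) T s"
        "T \<le> 300 * (k + 1) * ((c ^ h + 2) * max 1 n) * (c ^ h + 1) ^ k"
        "(\<exists>U. dominating k B W E U) \<longrightarrow> (\<exists>xs. result s = Some xs \<and> distinct xs \<and> dominating k B W E (set xs))"
        "(\<nexists>U. dominating k B W E U) \<longrightarrow> result s = None"
        using runs_search_sparse[OF a(1-6) w s1 s2] unfolding runs_def by blast
      have "real T \<le> (C * ln (real h)) powr (real h * real k / 2) * real (max 1 n)"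
        using order_trans[OF of_nat_mono[OF T(2)] time_bound[OF conjunct1[OF c] a(1,2)]] unfolding C_def .
      then show "\<exists>T s. exec w search_prog (init_state k h n B adj) T s \<and>
          real T \<le> (C * ln (real h)) powr (real h * real k / 2) * real (max 1 n) \<and>
          ((\<exists>U. dominating k B W E U) \<longrightarrow>
            (\<exists>xs. result s = Some xs \<and> distinct xs \<and> dominating k B W E (set xs))) \<and>
          ((\<nexists>U. dominating k B W E U) \<longrightarrow> result s = None)"
        using T by blast
    qed
  qed
qed

end
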